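(* Let $H=(h_1,\dots,h_m)\in\mathfrak b^m$ be a positive marking (i.e. $\lambda_\ell(h_\ell)>0$ for all $\ell$) of a rotational datum, and let $r=\sum_{\ell=1}^m h_\ell\wedge u_\ell\in S_H$ with $u_\ell\in P_\ell$. (a) One has $[r,r]=\Phi_H(r)+\mu_H(r)\in D_H\oplus X_H$, where $$\Phi_H(r)=\sum_{\ell=1}^m\|u_\ell\|^2E_\ell(H)\in D_H,$$ $$\mu_H(r)=2\sum_{1\le i<j\le m}\bigl(\lambda_j(h_i)\,h_j\wedge u_i\wedge J_ju_j-\lambda_i(h_j)\,h_i\wedge J_iu_i\wedge u_j\bigr)\in X_H.$$ Moreover $\Phi_H(S_H)=C_H$, which is a simplicial cone, and for $Y=\sum_\ell t_\ell E_\ell(H)\in C_H$ (with $t_\ell\ge 0$) the radial fibre $T_Y:=\Phi_H^{-1}(Y)$ is, under the identification $S_H\cong\bigoplus_\ell P_\ell$, $\sum_\ell h_\ell\wedge u_\ell\leftrightarrow (u_\ell)_\ell$, $$T_Y=\prod_{t_\ell>0}S^1_{\sqrt{t_\ell}}\times\prod_{t_\ell=0}\{0\},$$ where $S^1_\rho\subset P_\ell$ denotes the circle of radius $\rho$ centred at $0$. Under the same identification, let $\mathbb T^m$ act by independent rotations of the planes $P_\ell$, with symplectic form $\omega(v,w)=\sum_\ell\langle v_\ell,J_\ell w_\ell\rangle$, and let $(\varepsilon_\ell^* )_\ell$ be the standard basis of the dual $(\operatorname{Lie}\mathbb T^m)^*=(\mathbb R^m)^*$. Then $\Phi_H=\iota_H\circ\mu_{\mathbb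 T}$, where $\mu_{\mathbb T}(u)=\tfrac12\sum_\ell\|u_\ell\|^2\varepsilon_\ell^*$ is the standard toric moment map of this action and $\iota_H$ is the injective linear map with $\iota_H(\varepsilon_\ell^* )=2E_\ell(H)$. (b) For every positive-definite inner product on $\mathfrak b$, set $$\kappa_0(H)=2\Bigl(\sum_{\ell=1}^m\frac{\|h_\ell\|^2}{\lambda_\ell(h_\ell)^2}\Bigr)^{-1/2}.$$ Then $\|\Phi_H(r)\|\ge\kappa_0(H)\|r\|^2$ for all $r\in S_H$, and the constant is optimal: for $\|r\|^2=R^2>0$, equality holds if and only if $$\|u_\ell\|^2=\frac{R^2\lambda_\ell(h_\ell)^{-2}}{\sum_{j=1}^m\|h_j\|^2\lambda_j(h_j)^{-2}}\qquad(1\le\ell\le m).$$ (c) The restricted Schouten map $\Sigma_H\colon S_H\to D_H\oplus X_H$, $\Sigma_H(r)=[r,r]$, is proper; its image over $Y\in C_H$ (the set of elements of $\Sigma_H(S_H)$ whose $D_H$-component is $Y$) is $Y+F_Y(T_Y)$, where $F_Y=\mu_H|_{T_Y}$, and $F_Y(T_Y)$ is compact. The image $\Sigma_H(S_H)$ is closed and semialgebraic, and every fibre $\Sigma_H^{-1}(\Theta)$ is compact.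
   Context: Rotational datum: a finite-dimensional real abelian Lie algebra $\mathfrak b$; an orthogonal direct sum $V=\bigoplus_{\ell=1}^m P_\ell$ of oriented Euclidean two-planes; nonzero weights $\lambda_1,\dots,\lambda_m\in\mathfrak b^*$. Let $J_\ell$ be the positive quarter-turn on $P_\ell$, let $(e_\ell,f_\ell)=(e_\ell,J_\ell e_\ell)$ be an oriented orthonormal basis of $P_\ell$, and $\Omega_\ell=e_\ell\wedge f_\ell$. Let $\rho\colon\mathfrak b\to\mathfrak{so}(V)$ be given by $\rho(b)|_{P_\ell}=\lambda_\ell(b)J_\ell$. Set $\mathfrak z=\mathfrak b^*$ and $\beta\colon\Lambda^2V\to\mathfrak z$, $\beta(u,v)(b)=\langle\rho(b)u,v\rangle$. The Lie algebra $\mathfrak g=\mathfrak b\oplus V\oplus\mathfrak z$ has bracket $[b,b']=0$, $[b,u]=\rho(b)u$, $[u,v]=\beta(u,v)$, $[\mathfrak z,\mathfrak g]=0$ for $b,b'\in\mathfrak b$, $u,v\in V$. The Schouten bracket on $\Lambda^2\mathfrak g$ is the symmetric bilinear map $\Lambda^2\mathfrak g\times\Lambda^2\mathfrak g\to\Lambda^3\mathfrak g$ with $[x\wedge y,z\wedge w]=[x,z]\wedge y\wedge w-[x,w]\wedge y\wedge z-[y,z]\wedge x\wedge w+[y,w]\wedge x\wedge z$. For a positive marking $H$: the marked slice is $S_H=\bigoplus_\ell h_\ell\wedge P_\ell\subset\Lambda^2\mathfrak g$; $E_\ell(H)=2\lambda_\ell(h_\ell)\,h_\ell\wedge\Omega_\ell$;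 $D_H=\bigoplus_\ell\mathbb R E_\ell(H)$; $C_H=\{\sum_\ell t_\ell E_\ell(H):t_\ell\ge0\}$; $X_H=\bigoplus_{1\le i<j\le m}\mathfrak b\wedge P_i\wedge P_j$. Norms: given a positive-definite inner product on $\mathfrak b$, use the dual one on $\mathfrak z$, declare $\mathfrak b,V,\mathfrak z$ mutually orthogonal, and use the induced norms on exterior powers of $\mathfrak g$. Here $\mathbb T=\mathbb R/2\pi\mathbb Z$; the $\ell$-th factor of $\mathbb T^m$ acts on $P_\ell$ with infinitesimal generator $X_\ell(u)=J_\ell u_\ell$, and a moment map $\mu$ satisfies $d\langle\mu,\varepsilon_\ell\rangle=\omega(X_\ell,\cdot)$, where $(\varepsilon_\ell)$ is the standard basis of $\mathbb R^m$. *)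

theory Defs
  imports "HOL-Analysis.Analysis"
begin

subsection \<open>Exterior powers\<close>

type_synonym 'a dual = "'a \<Rightarrow>\<^sub>L real"
type_synonym 'a tensor2 = "'a dual \<Rightarrow>\<^sub>L 'a dual \<Rightarrow>\<^sub>L real"
type_synonym 'a tensor3 = "'a dual \<Rightarrow>\<^sub>L 'a dual \<Rightarrow>\<^sub>L 'a dual \<Rightarrow>\<^sub>L real"

text \<open>
  For a finite-dimensional space \<open>W\<close> (every linear form is then bounded), the exterior powers
  \<open>\<Lambda>\<^sup>2W\<close>, \<open>\<Lambda>\<^sup>3W\<close> are realised as the spans of the decomposable multivectors inside the
  multilinear forms on \<open>W\<^sup>*\<close>, where \<open>x\<^sub>1 \<and> \<dots> \<and> x\<^sub>k\<close> is
  \<open>(\<phi>\<^sub>1, \<dots>, \<phi>\<^sub>k) \<mapsto> det (\<phi>\<^sub>i x\<^sub>j)\<close>. The topology of the ambient normed space is the usual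
  one on a finite-dimensional space; its operator norm is not the norm induced by an inner
  product of \<open>W\<close>, which is defined separately below.
\<close>

definition wedge2 :: "'a::real_normed_vector \<Rightarrow> 'a \<Rightarrow> 'a tensor2" where
  "wedge2 x y = Blinfun (\<lambda>\<phi> :: 'a dual. Blinfun (\<lambda>\<psi> :: 'a dual. \<phi> x * \<psi> y - \<phi> y * \<psi> x))"

definition wedge3 :: "'a::real_normed_vector \<Rightarrow> 'a \<Rightarrow> 'a \<Rightarrow> 'a tensor3" where
  "wedge3 x y z = Blinfun (\<lambda>\<phi> :: 'a dual. Blinfun (\<lambda>\<psi> :: 'a dual. Blinfun (\<lambda>\<eta> :: 'a dual.
      \<phi> x * (\<psi> y * \<eta> z - \<psi> z * \<eta> y)
    - \<phi> y * (\<psi> x * \<eta> z - \<psi> z * \<eta> x)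
    + \<phi> z * (\<psi> x * \<eta> y - \<psi> y * \<eta> x))))"

definition Ext2 :: "'a::real_normed_vector tensor2 set" where
  "Ext2 = span {wedge2 x y | x y. True}"

definition Ext3 :: "'a::real_normed_vector tensor3 set" where
  "Ext3 = span {wedge3 x y z | x y z. True}"

definition bilinear_on ::
  "'a::real_vector set \<Rightarrow> 'b::real_vector set \<Rightarrow> ('a \<Rightarrow> 'b \<Rightarrow> 'c::real_vector) \<Rightarrow> bool" where
  "bilinear_on S T q \<longleftrightarrow>
     (\<forall>x\<in>S. \<forall>x'\<in>S. \<forall>y\<in>T. q (x + x') y = q x y + q x' y) \<and>
     (\<forall>c. \<forall>x\<in>S. \<forall>y\<in>T. q (c *\<^sub>R x) y = c *\<^sub>R q x y) \<and>
     (\<forall>x\<in>S. \<forall>y\<in>T. \<forall>y'\<in>T. q x (y + y') = q x y + q x y') \<and>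
     (\<forall>c. \<forall>x\<in>S. \<forall>y\<in>T. q x (c *\<^sub>R y) = c *\<^sub>R q x y)"

definition is_schouten ::
  "('a \<Rightarrow> 'a \<Rightarrow> 'a::real_normed_vector) \<Rightarrow> ('a tensor2 \<Rightarrow> 'a tensor2 \<Rightarrow> 'a tensor3) \<Rightarrow> bool" where
  "is_schouten br S \<longleftrightarrow>
     bilinear_on Ext2 Ext2 S \<and> (\<forall>A\<in>Ext2. \<forall>B\<in>Ext2. S A B = S B A) \<and>
     (\<forall>x y z w. S (wedge2 x y) (wedge2 z w) =
         wedge3 (br x z) y w - wedge3 (br x w) y z - wedge3 (br y z) x w + wedge3 (br y w) x z)"

definition schouten ::
  "('a \<Rightarrow> 'a \<Rightarrow> 'a::real_normed_vector) \<Rightarrow> 'a tensor2 \<Rightarrow> 'a tensor2 \<Rightarrow> 'a tensor3" where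
  "schouten br A B = (THE C. \<exists>S. is_schouten br S \<and> C = S A B)"


subsection \<open>Inner products and induced norms\<close>

definition pos_def_inner :: "('a::real_vector \<Rightarrow> 'a \<Rightarrow> real) \<Rightarrow> bool" where
  "pos_def_inner G \<longleftrightarrow> bilinear G \<and> (\<forall>x y. G x y = G y x) \<and> (\<forall>x. x \<noteq> 0 \<longrightarrow> G x x > 0)"

definition riesz :: "('a \<Rightarrow> 'a \<Rightarrow> real) \<Rightarrow> 'a::real_normed_vector dual \<Rightarrow> 'a" where
  "riesz G \<zeta> = (THE a. \<forall>x. \<zeta> x = G a x)"

definition dual_inner ::
  "('a \<Rightarrow> 'a \<Rightarrow> real) \<Rightarrow> 'a::real_normed_vector dual \<Rightarrow> 'a dual \<Rightarrow> real" where
  "dual_inner G \<zeta> \<xi> = G (riesz G \<zeta>) (riesz G \<xi>)"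

definition is_ext2_inner ::
  "('a \<Rightarrow> 'a \<Rightarrow> real) \<Rightarrow> ('a::real_normed_vector tensor2 \<Rightarrow> 'a tensor2 \<Rightarrow> real) \<Rightarrow> bool" where
  "is_ext2_inner G q \<longleftrightarrow> bilinear_on Ext2 Ext2 q \<and>
     (\<forall>x y x' y'. q (wedge2 x y) (wedge2 x' y') = G x x' * G y y' - G x y' * G y x')"

definition is_ext3_inner ::
  "('a \<Rightarrow> 'a \<Rightarrow> real) \<Rightarrow> ('a::real_normed_vector tensor3 \<Rightarrow> 'a tensor3 \<Rightarrow> real) \<Rightarrow> bool" where
  "is_ext3_inner G q \<longleftrightarrow> bilinear_on Ext3 Ext3 q \<and>
     (\<forall>x y z x' y' z'. q (wedge3 x y z) (wedge3 x' y' z') =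
          G x x' * (G y y' * G z z' - G y z' * G z y')
        - G x y' * (G y x' * G z z' - G y z' * G z x')
        + G x z' * (G y x' * G z y' - G y y' * G z x'))"

definition ext2_norm :: "('a \<Rightarrow> 'a \<Rightarrow> real) \<Rightarrow> 'a::real_normed_vector tensor2 \<Rightarrow> real" where
  "ext2_norm G A = sqrt (THE c. \<exists>q. is_ext2_inner G q \<and> c = q A A)"

definition ext3_norm :: "('a \<Rightarrow> 'a \<Rightarrow> real) \<Rightarrow> 'a::real_normed_vector tensor3 \<Rightarrow> real" where
  "ext3_norm G A = sqrt (THE c. \<exists>q. is_ext3_inner G q \<and> c = q A A)"


subsection \<open>Well-definedness\<close>

lemma Blinfun2_apply:
  fixes f :: "'a::real_normed_vector \<Rightarrow> 'b::real_normed_vector \<Rightarrow> 'c::real_normed_vector"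
  assumes "bounded_bilinear f"
  shows "blinfun_apply (blinfun_apply (Blinfun (\<lambda>x. Blinfun (f x))) x) y = f x y"
    and "bounded_linear (\<lambda>x. Blinfun (f x))"
proof -
  interpret bounded_bilinear f by fact
  have a: "blinfun_apply (Blinfun (f x)) = f x" for x
    by (intro bounded_linear_Blinfun_apply bounded_linear_right)
  obtain K where K: "\<And>x y. norm (f x y) \<le> norm x * norm y * K" "K \<ge> 0" 
    using nonneg_bounded by blast
  show b: "bounded_linear (\<lambda>x. Blinfun (f x))"
  proof (rule bounded_linear_intro[where K = K])
    show "norm (Blinfun (f x)) \<le> norm x * K" for x
      using K by (intro norm_blinfun_bound) (auto simp: a mult_ac)
  qed (rule blinfun_eqI, simp add: a blinfun.add_left add_left blinfun.scaleR_left scaleR_left)+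
  show "blinfun_apply (blinfun_apply (Blinfun (\<lambda>x. Blinfun (f x))) x) y = f x y"
    by (simp add: bounded_linear_Blinfun_apply[OF b] a)
qed

lemma Blinfun3_apply:
  fixes f :: "'a::real_normed_vector \<Rightarrow> 'b::real_normed_vector \<Rightarrow> 'c::real_normed_vector \<Rightarrow> 'd::real_normed_vector"
  assumes "\<And>x. bounded_bilinear (f x)"
    and "\<And>x x' y z. f (x + x') y z = f x y z + f x' y z"
    and "\<And>c x y z. f (c *\<^sub>R x) y z = c *\<^sub>R f x y z"
    and K: "\<And>x y z. norm (f x y z) \<le> K * (norm x * norm y * norm z)" "K \<ge> 0"
  shows "blinfun_apply (blinfun_apply (blinfun_apply
           (Blinfun (\<lambda>x. Blinfun (\<lambda>y. Blinfun (f x y)))) x) y) z = f x y z"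
proof -
  note b = Blinfun2_apply[OF assms(1)]
  have a: "blinfun_apply (Blinfun (f x y)) = f x y" for x y
    by (intro bounded_linear_Blinfun_apply bounded_bilinear.bounded_linear_right assms)
  have c: "bounded_linear (\<lambda>x. Blinfun (\<lambda>y. Blinfun (f x y)))"
  proof (rule bounded_linear_intro[where K = K])
    fix x
    show "norm (Blinfun (\<lambda>y. Blinfun (f x y))) \<le> norm x * K"
    proof (rule norm_blinfun_bound)
      fix y
      show "norm (blinfun_apply (Blinfun (\<lambda>y. Blinfun (f x y))) y) \<le> norm x * K * norm y"
        unfolding bounded_linear_Blinfun_apply[OF b(2)]
        using K by (intro norm_blinfun_bound) (auto simp: a mult_ac)
    qed (use K in auto)
  qed (rule blinfun_eqI, rule blinfun_eqI,
       simp add: b assms blinfun.add_left blinfun.scaleR_left)+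
  show ?thesis by (simp add: bounded_linear_Blinfun_apply[OF c] b)
qed

lemma bounded_bilinear_diff':
  assumes f: "bounded_bilinear f" and g: "bounded_bilinear g"
  shows "bounded_bilinear (\<lambda>x y. f x y - g x y)"
proof -
  interpret f: bounded_bilinear f by fact
  interpret g: bounded_bilinear g by fact
  obtain K L where K: "\<And>x y. norm (f x y) \<le> norm x * norm y * K" "\<And>x y. norm (g x y) \<le> norm x * norm y * L"
    using f.bounded g.bounded by blast
  show ?thesis
  proof
    have "norm (f x y - g x y) \<le> norm x * norm y * (K + L)" for x y
      using norm_triangle_ineq4[of "f x y" "g x y"] K[of x y] by (simp add: distrib_left)
    then show "\<exists>K. \<forall>x y. norm (f x y - g x y) \<le> norm x * norm y * K" by blast
  qed (simp_all add: f.add_left f.add_right g.add_left g.add_right f.scaleR_left f.scaleR_right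
          g.scaleR_left g.scaleR_right scaleR_diff_right)
qed

lemma wedge2_apply [simp]:
  fixes \<phi> \<psi> :: "'a::real_normed_vector dual"
  shows "wedge2 x y \<phi> \<psi> = \<phi> x * \<psi> y - \<phi> y * \<psi> x"
proof -
  have "bounded_bilinear (\<lambda>(\<phi>::'a dual) (\<psi>::'a dual). \<phi> x * \<psi> y - \<phi> y * \<psi> x)"
    by (intro bounded_bilinear_diff' bounded_bilinear.comp[OF bounded_bilinear_mult] blinfun.bounded_linear_left)
  from Blinfun2_apply(1)[OF this] show ?thesis by (simp add: wedge2_def)
qed

lemma bounded_bilinear_minor: "bounded_bilinear (\<lambda>(\<psi>::'a::real_normed_vector dual) (\<eta>::'a dual). \<psi> y * \<eta> z - \<psi> z * \<eta> y)"
    by (intro bounded_bilinear_diff' bounded_bilinear.comp[OF bounded_bilinear_mult] blinfun.bounded_linear_left)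

lemma wedge3_apply [simp]:
  fixes \<phi> \<psi> \<eta> :: "'a::real_normed_vector dual"
  shows "wedge3 x y z \<phi> \<psi> \<eta> =
      \<phi> x * (\<psi> y * \<eta> z - \<psi> z * \<eta> y)
    - \<phi> y * (\<psi> x * \<eta> z - \<psi> z * \<eta> x)
    + \<phi> z * (\<psi> x * \<eta> y - \<psi> y * \<eta> x)"
proof -
  let ?f = "\<lambda>(\<phi>::'a dual) (\<psi>::'a dual) (\<eta>::'a dual). \<phi> x * (\<psi> y * \<eta> z - \<psi> z * \<eta> y)
    - \<phi> y * (\<psi> x * \<eta> z - \<psi> z * \<eta> x)
    + \<phi> z * (\<psi> x * \<eta> y - \<psi> y * \<eta> x)"
  have bil: "bounded_bilinear (?f \<phi>)" for \<phi>
  proof -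
    have m: "bounded_bilinear (\<lambda>(\<psi>::'a dual) (\<eta>::'a dual). c * (\<psi> u * \<eta> v - \<psi> v * \<eta> u))" for c u v
      using bounded_bilinear.comp[OF bounded_bilinear_minor[of u v] bounded_linear_scaleR_right[of c] bounded_linear_ident]
      by (simp add: blinfun.scaleR_left algebra_simps)
    show ?thesis
      using bounded_bilinear_diff'[OF bounded_bilinear_diff'[OF m[of "\<phi> x" y z] m[of "\<phi> y" x z]] m[of "- \<phi> z" x y]]
      by simp
  qed
  have n: "\<bar>(p::'a dual) a * (q b * r c - q c * r b)\<bar> \<le> 2 * (norm a * norm b * norm c) * (norm p * norm q * norm r)"
    for p q r :: "'a dual" and a b c
  proof -
    have "\<bar>p a\<bar> \<le> norm p * norm a" "\<bar>q b\<bar> \<le> norm q * norm b" "\<bar>r c\<bar> \<le> norm r * norm c"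
      "\<bar>q c\<bar> \<le> norm q * norm c" "\<bar>r b\<bar> \<le> norm r * norm b"
      using norm_blinfun[of p a] norm_blinfun[of q b] norm_blinfun[of r c] norm_blinfun[of q c]
        norm_blinfun[of r b] by auto
    then have "\<bar>q b\<bar> * \<bar>r c\<bar> \<le> (norm q * norm b) * (norm r * norm c)"
      "\<bar>q c\<bar> * \<bar>r b\<bar> \<le> (norm q * norm c) * (norm r * norm b)" by (auto intro!: mult_mono)
    then have "\<bar>q b * r c - q c * r b\<bar> \<le> 2 * (norm q * norm r * norm b * norm c)"
      by (simp add: abs_mult[symmetric] mult_ac)
    then have "\<bar>p a\<bar> * \<bar>q b * r c - q c * r b\<bar> \<le> (norm p * norm a) * (2 * (norm q * norm r * norm b * norm c))"
      using \<open>\<bar>p a\<bar> \<le> _\<close> by (intro mult_mono) auto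
    then show ?thesis by (simp add: abs_mult mult_ac)
  qed
  have "blinfun_apply (blinfun_apply (blinfun_apply
           (Blinfun (\<lambda>x. Blinfun (\<lambda>y. Blinfun (?f x y)))) \<phi>) \<psi>) \<eta> = ?f \<phi> \<psi> \<eta>"
  proof (rule Blinfun3_apply[where K = "6 * (norm x * norm y * norm z)"])
    fix p q r :: "'a dual"
    show "norm (?f p q r) \<le> 6 * (norm x * norm y * norm z) * (norm p * norm q * norm r)"
      using n[of p x q y r z] n[of p y q x r z] n[of p z q x r y] 
      by (simp add: mult_ac) 
  qed (use bil in \<open>auto simp: blinfun.add_left blinfun.scaleR_left algebra_simps\<close>)
  then show ?thesis by (simp add: wedge3_def)
qed

lemma lift_ex:
  fixes W :: "'i \<Rightarrow> 't::real_vector" and W' :: "'j \<Rightarrow> 'u::real_vector" and F :: "'i \<Rightarrow> 'j \<Rightarrow> 'e::real_vector"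
  assumes L: "\<And>q. \<exists>L. linear L \<and> (\<forall>p. L (W p) = F p q)"
    and M: "\<And>p. \<exists>M. linear M \<and> (\<forall>q. M (W' q) = F p q)"
  shows "\<exists>S. bilinear_on (span (range W)) (span (range W')) S \<and> (\<forall>p q. S (W p) (W' q) = F p q)"
proof -
  obtain L where L: "\<And>q. linear (L q)" "\<And>p q. L q (W p) = F p q" using L by metis
  obtain M where M: "\<And>p. linear (M p)" "\<And>p q. M p (W' q) = F p q" using M by metis
  have rep: "\<exists>T c. finite T \<and> B = (\<Sum>q\<in>T. c q *\<^sub>R V q)"
    if "B \<in> span (range V)" for B :: "'x::real_vector" and V :: "'k \<Rightarrow> 'x"
  proof -
    obtain T r where T: "finite T" "T \<subseteq> range V" "B = (\<Sum>a\<in>T. r a *\<^sub>R a)"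
      using \<open>B \<in> _\<close> unfolding span_explicit by blast
    obtain T' where T': "T' \<subseteq> UNIV" "inj_on V T'" "T = V ` T'"
      using T(2) by (auto simp: subset_image_inj)
    show ?thesis 
      using T T' finite_image_iff by (intro exI[of _ T'] exI[of _ "\<lambda>q. r (V q)"]) (auto simp: sum.reindex)
  qed
  obtain T c where T: "\<And>B. B \<in> span (range W') \<Longrightarrow> finite (T B) \<and> B = (\<Sum>q\<in>T B. c B q *\<^sub>R W' q)"
    using rep[of _ W'] by metis
  define S where "S A B = (\<Sum>q\<in>T B. c B q *\<^sub>R L q A)" for A B
  have SM: "S (W p) B = M p B" if "B \<in> span (range W')" for p B
  proof -
    have "M p B = M p (\<Sum>q\<in>T B. c B q *\<^sub>R W' q)"
      using T[OF that] by (intro arg_cong[of _ _ "M p"]) blast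
    also have "\<dots> = (\<Sum>q\<in>T B. c B q *\<^sub>R F p q)"
      by (simp add: linear_sum[OF M(1)] linear_scale[OF M(1)] M(2))
    finally show ?thesis by (simp add: S_def L(2))
  qed
  have lin: "linear (\<lambda>A. S A B)" for B
    unfolding S_def by (intro linear_compose_sum linear_compose_scale_right ballI L) 
  have S2: "S (\<Sum>p\<in>I. d p *\<^sub>R W p) B = (\<Sum>p\<in>I. d p *\<^sub>R M p B)" if "B \<in> span (range W')" for I d B
    by (simp add: linear_sum[OF lin[of B]] linear_scale[OF lin[of B]] SM[OF that])
  have "bilinear_on (span (range W)) (span (range W')) S"
    unfolding bilinear_on_def
  proof safe
    fix A B C c assume A: "A \<in> span (range W)" and B: "B \<in> span (range W')" and C: "C \<in> span (range W')"
    obtain I d where A: "A = (\<Sum>p\<in>I. d p *\<^sub>R W p)" using rep[OF A] by blast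
    show "S A (B + C) = S A B + S A C"
      using B C span_add[OF B C] by (simp add: A S2 linear_add[OF M(1)] scaleR_add_right sum.distrib)
    show "S A (c *\<^sub>R B) = c *\<^sub>R S A B"
      using B span_scale[OF B] by (simp add: A S2 linear_scale[OF M(1)] scaleR_sum_right mult.commute)
  qed (simp_all add: linear_add[OF lin] linear_scale[OF lin])
  moreover have "S (W p) (W' q) = F p q" for p q
    by (simp add: SM span_base M(2))
  ultimately show ?thesis by blast
qed

lemma bilinear_on_unique:
  assumes "bilinear_on (span X) (span Y) S" "bilinear_on (span X) (span Y) S'"
    and eq: "\<And>x y. x \<in> X \<Longrightarrow> y \<in> Y \<Longrightarrow> S x y = S' x y"
    and A: "A \<in> span X" and B: "B \<in> span Y"
  shows "S A B = S' A B"
proof -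
  have z: "T A 0 = 0" "T 0 B = 0"
    if "bilinear_on (span X) (span Y) T" "A \<in> span X" "B \<in> span Y" for T :: "'a \<Rightarrow> 'b \<Rightarrow> 'c" and A B
    using that span_zero[of X] span_zero[of Y] unfolding bilinear_on_def
    by (metis scaleR_zero_left)+
  note z = z[OF assms(1)] z[OF assms(2)]
  note b = assms(1,2)[unfolded bilinear_on_def]
  have 1: "S x B = S' x B" if x: "x \<in> X" for x
  proof -
    have "subspace {B \<in> span Y. S x B = S' x B}"
      using b z(1,3)[OF span_base[OF x]] span_base[OF x] span_zero[of Y]
      by (auto simp: subspace_def span_add span_scale)
    then have "span Y \<subseteq> {B \<in> span Y. S x B = S' x B}"
      using eq[OF x] by (intro span_minimal) (auto intro: span_base)
    then show ?thesis using B by auto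
  qed
  have "subspace {A \<in> span X. S A B = S' A B}"
    using b z(2,4)[OF _ B] B span_zero[of X]
    by (auto simp: subspace_def span_add span_scale)
  then have "span X \<subseteq> {A \<in> span X. S A B = S' A B}"
    using 1 by (intro span_minimal) (auto intro: span_base)
  then show ?thesis using A by auto
qed

lemma Ext2_eq: "Ext2 = span (range (\<lambda>(x, y). wedge2 x y))"
  by (simp add: Ext2_def full_SetCompr_eq[symmetric] case_prod_unfold)

lemma Ext3_eq: "Ext3 = span (range (\<lambda>(x, y, z). wedge3 x y z))"
  by (simp add: Ext3_def full_SetCompr_eq[symmetric] case_prod_unfold)

text \<open>
  The definite descriptions in \<open>schouten\<close>, \<open>ext2_norm\<close> and \<open>ext3_norm\<close> are proper: the bilinear maps
  they refer to exist and are determined on the exterior powers.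
\<close>

lemma ext2_inner_ex:
  fixes G :: "'a::real_normed_vector \<Rightarrow> 'a \<Rightarrow> real"
  assumes G: "bounded_bilinear G" and sym: "\<And>x y. G x y = G y x"
  shows "\<exists>q. is_ext2_inner G q"
proof -
  have a: "blinfun_apply (Blinfun (G x)) = G x" for x
    by (intro bounded_linear_Blinfun_apply bounded_bilinear.bounded_linear_right G)
  have 1: "\<exists>L. linear L \<and> (\<forall>p. L (case p of (x, y) \<Rightarrow> wedge2 x y) =
      (case p of (x, y) \<Rightarrow> \<lambda>(x', y'). G x x' * G y y' - G x y' * G y x') q)" for q
  proof (cases q)
    case (Pair x' y')
    have s: "G x' u = G u x'" "G y' u = G u y'" for u
      by (rule sym)+
    show ?thesis
      unfolding Pair
      by (intro exI[of _ "\<lambda>A. blinfun_apply (blinfun_apply A (Blinfun (G x'))) (Blinfun (G y'))"])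
         (simp only: linear_iff split_paired_All prod.case blinfun.add_left blinfun.scaleR_left
            wedge2_apply a s simp_thms, simp add: algebra_simps)
  qed
  have 2: "\<exists>M. linear M \<and> (\<forall>q. M (case q of (x, y) \<Rightarrow> wedge2 x y) =
      (case p of (x, y) \<Rightarrow> \<lambda>(x', y'). G x x' * G y y' - G x y' * G y x') q)" for p
  proof (cases p)
    case (Pair x y)
    then show ?thesis
      by (intro exI[of _ "\<lambda>A. blinfun_apply (blinfun_apply A (Blinfun (G x))) (Blinfun (G y))"])
         (auto simp: a linear_iff blinfun.add_left blinfun.scaleR_left algebra_simps)
  qed
  obtain q where q: "bilinear_on Ext2 Ext2 q"
    "\<And>p p'. q (case p of (x, y) \<Rightarrow> wedge2 x y) (case p' of (x, y) \<Rightarrow> wedge2 x y) =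
       (case p of (x, y) \<Rightarrow> \<lambda>(x', y'). G x x' * G y y' - G x y' * G y x') p'"
    using lift_ex[of "\<lambda>(x, y). wedge2 x y" "\<lambda>p q. (case p of (x, y) \<Rightarrow> \<lambda>(x', y'). G x x' * G y y' - G x y' * G y x') q", OF 1 2]
    unfolding Ext2_eq by blast
  have "is_ext2_inner G q"
    unfolding is_ext2_inner_def
  proof (intro conjI allI q(1))
    fix x y x' y'
    show "q (wedge2 x y) (wedge2 x' y') = G x x' * G y y' - G x y' * G y x'"
      using q(2)[of "(x, y)" "(x', y')"] by (simp only: prod.case)
  qed
  then show ?thesis by blast
qed

lemma ext3_inner_ex:
  fixes G :: "'a::real_normed_vector \<Rightarrow> 'a \<Rightarrow> real"
  assumes G: "bounded_bilinear G" and sym: "\<And>x y. G x y = G y x"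
  shows "\<exists>q. is_ext3_inner G q"
proof -
  have a: "blinfun_apply (Blinfun (G x)) = G x" for x
    by (intro bounded_linear_Blinfun_apply bounded_bilinear.bounded_linear_right G)
  let ?F = "\<lambda>p q. (case p of (x, y, z) \<Rightarrow> \<lambda>(x', y', z').
          G x x' * (G y y' * G z z' - G y z' * G z y')
        - G x y' * (G y x' * G z z' - G y z' * G z x')
        + G x z' * (G y x' * G z y' - G y y' * G z x')) q"
  have 1: "\<exists>L. linear L \<and> (\<forall>p. L (case p of (x, y, z) \<Rightarrow> wedge3 x y z) = ?F p q)" for q
  proof (cases q)
    case (fields x' y' z')
    have s: "G x' u = G u x'" "G y' u = G u y'" "G z' u = G u z'" for u
      by (rule sym)+
    show ?thesis
      unfolding fields
      by (intro exI[of _ "\<lambda>A. blinfun_apply (blinfun_apply (blinfun_apply A (Blinfun (G x'))) (Blinfun (G y'))) (Blinfun (G z'))"])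
         (simp only: linear_iff split_paired_All prod.case blinfun.add_left blinfun.scaleR_left
            wedge3_apply a s simp_thms, simp add: algebra_simps)
  qed
  have 2: "\<exists>M. linear M \<and> (\<forall>q. M (case q of (x, y, z) \<Rightarrow> wedge3 x y z) = ?F p q)" for p
  proof (cases p)
    case (fields x y z)
    then show ?thesis
      by (intro exI[of _ "\<lambda>A. blinfun_apply (blinfun_apply (blinfun_apply A (Blinfun (G x))) (Blinfun (G y))) (Blinfun (G z))"])
         (auto simp: a linear_iff blinfun.add_left blinfun.scaleR_left algebra_simps)
  qed
  obtain q where q: "bilinear_on Ext3 Ext3 q"
    "\<And>p p'. q (case p of (x, y, z) \<Rightarrow> wedge3 x y z) (case p' of (x, y, z) \<Rightarrow> wedge3 x y z) = ?F p p'"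
    using lift_ex[of "\<lambda>(x, y, z). wedge3 x y z" ?F, OF 1 2] unfolding Ext3_eq by blast
  have "is_ext3_inner G q"
    unfolding is_ext3_inner_def
  proof (intro conjI allI q(1))
    fix x y z x' y' z'
    show "q (wedge3 x y z) (wedge3 x' y' z') =
          G x x' * (G y y' * G z z' - G y z' * G z y')
        - G x y' * (G y x' * G z z' - G y z' * G z x')
        + G x z' * (G y x' * G z y' - G y y' * G z x')"
      using q(2)[of "(x, y, z)" "(x', y', z')"] by (simp only: prod.case)
  qed
  then show ?thesis by blast
qed

lemma ext2_norm_eq:
  fixes G :: "'a::real_normed_vector \<Rightarrow> 'a \<Rightarrow> real"
  assumes "is_ext2_inner G q" "A \<in> Ext2"
  shows "ext2_norm G A = sqrt (q A A)"
proof -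
  have "q' A A = q A A" if "is_ext2_inner G q'" for q'
  proof (rule bilinear_on_unique[of "{wedge2 x y | x y. True} :: 'a tensor2 set" "{wedge2 x y | x y. True}" q' q])
    fix X Y :: "'a tensor2" assume "X \<in> {wedge2 x y | x y. True}" "Y \<in> {wedge2 x y | x y. True}"
    then show "q' X Y = q X Y"
      using that assms(1) unfolding is_ext2_inner_def by clarsimp
  qed (use that assms in \<open>simp_all only: is_ext2_inner_def Ext2_def\<close>)
  with assms(1) show ?thesis
    unfolding ext2_norm_def by (intro arg_cong[of _ _ sqrt] the_equality) blast+
qed

lemma ext3_norm_eq:
  fixes G :: "'a::real_normed_vector \<Rightarrow> 'a \<Rightarrow> real"
  assumes "is_ext3_inner G q" "A \<in> Ext3"
  shows "ext3_norm G A = sqrt (q A A)"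
proof -
  have "q' A A = q A A" if "is_ext3_inner G q'" for q'
  proof (rule bilinear_on_unique[of "{wedge3 x y z | x y z. True} :: 'a tensor3 set" "{wedge3 x y z | x y z. True}" q' q])
    fix X Y :: "'a tensor3" assume "X \<in> {wedge3 x y z | x y z. True}" "Y \<in> {wedge3 x y z | x y z. True}"
    then show "q' X Y = q X Y"
      using that assms(1) unfolding is_ext3_inner_def by clarsimp
  qed (use that assms in \<open>simp_all only: is_ext3_inner_def Ext3_def\<close>)
  with assms(1) show ?thesis
    unfolding ext3_norm_def by (intro arg_cong[of _ _ sqrt] the_equality) blast+
qed

lemma schouten_eq:
  fixes br :: "'a::real_normed_vector \<Rightarrow> 'a \<Rightarrow> 'a"
  assumes "is_schouten br S" "A \<in> Ext2" "B \<in> Ext2"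
  shows "schouten br A B = S A B"
proof -
  have "S' A B = S A B" if "is_schouten br S'" for S'
  proof (rule bilinear_on_unique[of "{wedge2 x y | x y. True} :: 'a tensor2 set" "{wedge2 x y | x y. True}" S' S])
    fix X Y :: "'a tensor2" assume "X \<in> {wedge2 x y | x y. True}" "Y \<in> {wedge2 x y | x y. True}"
    then show "S' X Y = S X Y"
      using that assms(1) unfolding is_schouten_def by clarsimp
  qed (use that assms in \<open>simp_all only: is_schouten_def Ext2_def\<close>)
  with assms(1) show ?thesis
    unfolding schouten_def by (intro the_equality) blast+
qed

lemma schouten_ex:
  fixes br :: "'a::real_normed_vector \<Rightarrow> 'a \<Rightarrow> 'a"
  assumes br: "bounded_bilinear br" and skew: "\<And>x y. br x y = - br y x"
  shows "\<exists>S. is_schouten br S"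
proof -
  let ?F = "\<lambda>p q. (case p of (x, y) \<Rightarrow> \<lambda>(z, w).
     wedge3 (br x z) y w - wedge3 (br x w) y z - wedge3 (br y z) x w + wedge3 (br y w) x z) q"
  let ?W = "\<lambda>(x, y). wedge2 x y"
  define ad where "ad z = Blinfun (\<lambda>x. br x z)" for z
  have ad: "blinfun_apply (ad z) x = br x z" for z x
    unfolding ad_def
    by (subst bounded_linear_Blinfun_apply) (auto intro: bounded_bilinear.bounded_linear_left br)
  define T where "T z A \<phi> \<psi> = blinfun_apply (blinfun_apply A (\<phi> o\<^sub>L ad z)) \<psi> + blinfun_apply (blinfun_apply A \<phi>) (\<psi> o\<^sub>L ad z)"
    for z and A :: "'a tensor2" and \<phi> \<psi>
  have T_wedge: "T z (wedge2 x y) \<phi> \<psi> = 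
     \<phi> (br x z) * \<psi> y - \<phi> y * \<psi> (br x z) + \<phi> x * \<psi> (br y z) - \<phi> (br y z) * \<psi> x" for z x y \<phi> \<psi>
    by (simp add: T_def ad)
  define U where "U z w A \<phi> \<psi> \<eta> = T z A \<phi> \<psi> * blinfun_apply \<eta> w - T z A \<phi> \<eta> * blinfun_apply \<psi> w + T z A \<psi> \<eta> * blinfun_apply \<phi> w"
    for z w and A :: "'a tensor2" and \<phi> \<psi> \<eta>
  have Tb: "\<bar>T z A \<phi> \<psi>\<bar> \<le> (2 * norm A * norm (ad z)) * (norm \<phi> * norm \<psi>)" for z A \<phi> \<psi>
  proof -
    have n: "\<bar>blinfun_apply (blinfun_apply A \<phi>) \<psi>\<bar> \<le> norm A * norm \<phi> * norm \<psi>" for \<phi> \<psi>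
      using norm_blinfun[of "blinfun_apply A \<phi>" \<psi>] norm_blinfun[of A \<phi>]
      by (smt (verit) mult_right_mono norm_ge_zero real_norm_def)
    have m: "norm (\<phi> o\<^sub>L ad z) \<le> norm \<phi> * norm (ad z)" for \<phi> :: "'a dual"
      by (rule norm_blinfun_compose)
    have "\<bar>blinfun_apply (blinfun_apply A (\<phi> o\<^sub>L ad z)) \<psi>\<bar> \<le> norm A * (norm \<phi> * norm (ad z)) * norm \<psi>"
      by (rule order_trans[OF n]) (intro mult_mono m order_refl; simp)
    moreover have "\<bar>blinfun_apply (blinfun_apply A \<phi>) (\<psi> o\<^sub>L ad z)\<bar> \<le> norm A * norm \<phi> * (norm \<psi> * norm (ad z))"
      by (rule order_trans[OF n]) (intro mult_mono m order_refl; simp)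
    ultimately show ?thesis by (simp add: T_def mult_ac)
  qed
  have Ub: "\<bar>U z w A \<phi> \<psi> \<eta>\<bar> \<le> (6 * norm A * norm (ad z) * norm w) * (norm \<phi> * norm \<psi> * norm \<eta>)" for z w A \<phi> \<psi> \<eta>
  proof -
    have "\<bar>T z A \<phi> \<psi> * blinfun_apply \<eta> w\<bar> \<le> (2 * norm A * norm (ad z)) * (norm \<phi> * norm \<psi>) * (norm \<eta> * norm w)" for \<phi> \<psi> \<eta>
      using norm_blinfun[of \<eta> w] Tb[of z A \<phi> \<psi>] unfolding abs_mult 
      by (intro mult_mono) auto
    from this[of \<phi> \<psi> \<eta>] this[of \<phi> \<eta> \<psi>] this[of \<psi> \<eta> \<phi>] show ?thesis
      by (simp add: U_def mult_ac)
  qed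
  have comp_lin: "(\<phi> + \<phi>') o\<^sub>L ad z = (\<phi> o\<^sub>L ad z) + (\<phi>' o\<^sub>L ad z)" "(c *\<^sub>R \<phi>) o\<^sub>L ad z = c *\<^sub>R (\<phi> o\<^sub>L ad z)" 
    for \<phi> \<phi>' :: "'a dual" and c z
    by (auto intro!: blinfun_eqI simp: blinfun.add_left blinfun.scaleR_left)
  note lins = comp_lin blinfun.add_left blinfun.scaleR_left blinfun.add_right blinfun.scaleR_right
  have U_lin: "U z w A (\<phi> + \<phi>') \<psi> \<eta> = U z w A \<phi> \<psi> \<eta> + U z w A \<phi>' \<psi> \<eta>"
     "U z w A (c *\<^sub>R \<phi>) \<psi> \<eta> = c *\<^sub>R U z w A \<phi> \<psi> \<eta>"
     "U z w A \<phi> (\<psi> + \<psi>') \<eta> = U z w A \<phi> \<psi> \<eta> + U z w A \<phi> \<psi>' \<eta>"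
     "U z w A \<phi> (c *\<^sub>R \<psi>) \<eta> = c *\<^sub>R U z w A \<phi> \<psi> \<eta>"
     "U z w A \<phi> \<psi> (\<eta> + \<eta>') = U z w A \<phi> \<psi> \<eta> + U z w A \<phi> \<psi> \<eta>'"
     "U z w A \<phi> \<psi> (c *\<^sub>R \<eta>) = c *\<^sub>R U z w A \<phi> \<psi> \<eta>"
     "U z w (A + A') \<phi> \<psi> \<eta> = U z w A \<phi> \<psi> \<eta> + U z w A' \<phi> \<psi> \<eta>"
     "U z w (c *\<^sub>R A) \<phi> \<psi> \<eta> = c *\<^sub>R U z w A \<phi> \<psi> \<eta>"
     for z w A A' \<phi> \<phi>' \<psi> \<psi>' \<eta> \<eta>' c
    by (simp_all add: U_def T_def lins algebra_simps)
  define L where "L z w A = Blinfun (\<lambda>\<phi>. Blinfun (\<lambda>\<psi>. Blinfun (U z w A \<phi> \<psi>)))" for z w A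
  have L: "blinfun_apply (blinfun_apply (blinfun_apply (L z w A) \<phi>) \<psi>) \<eta> = U z w A \<phi> \<psi> \<eta>" for z w A \<phi> \<psi> \<eta>
    unfolding L_def
  proof (rule Blinfun3_apply[where K = "6 * norm A * norm (ad z) * norm w"])
    show "bounded_bilinear (U z w A \<phi>)" for \<phi>
    proof
      show "\<exists>K. \<forall>a b. norm (U z w A \<phi> a b) \<le> norm a * norm b * K"
        using Ub[of z w A \<phi>] by (intro exI[of _ "6 * norm A * norm (ad z) * norm w * norm \<phi>"]) (simp add: mult_ac)
    qed (rule U_lin)+
  qed (use Ub U_lin in auto)
  have L_lin: "linear (L z w)" for z w
    by (intro linearI blinfun_eqI) (simp_all add: L U_lin blinfun.add_left blinfun.scaleR_left)
  have L_wedge: "L z w (wedge2 x y) - L w z (wedge2 x y) = ?F (x, y) (z, w)" for x y z w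
    by (intro blinfun_eqI) (simp add: L U_def T_wedge blinfun.add_left blinfun.diff_left algebra_simps)
  have 1: "\<exists>L. linear L \<and> (\<forall>p. L (?W p) = ?F p q)" for q
    using L_wedge by (intro exI[of _ "\<lambda>A. L (fst q) (snd q) A - L (snd q) (fst q) A"])
       (auto intro: linear_compose_sub L_lin simp: case_prod_unfold)
  have Fsym: "?F p q = ?F q p" for p q
  proof (cases p; cases q)
    fix x y z w assume p: "p = (x, y)" "q = (z, w)"
    have s: "br z x = - br x z" "br z y = - br y z" "br w x = - br x w" "br w y = - br y w"
      using skew by blast+
    show ?thesis
      unfolding p prod.case s
      by (intro blinfun_eqI) (simp add: blinfun.add_left blinfun.diff_left blinfun.minus_right algebra_simps)
  qed
  have 2: "\<exists>M. linear M \<and> (\<forall>q. M (?W q) = ?F p q)" for p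
  proof -
    obtain L where L: "linear L" "\<And>q. L (?W q) = ?F q p" using 1[of p] by blast
    show ?thesis by (intro exI[of _ L] conjI allI L(1)) (simp only: L(2) Fsym[of p])
  qed
  obtain S where S: "bilinear_on Ext2 Ext2 S" "\<And>p q. S (?W p) (?W q) = ?F p q"
    using lift_ex[of ?W ?F, OF 1 2] unfolding Ext2_eq by blast
  have flip: "bilinear_on Ext2 Ext2 (\<lambda>A B. S B A)"
    using S(1) unfolding bilinear_on_def by blast
  have "S A B = S B A" if "A \<in> Ext2" "B \<in> Ext2" for A B
  proof (rule bilinear_on_unique[of "range ?W" "range ?W" S "\<lambda>A B. S B A"])
    fix X Y :: "'a tensor2" assume "X \<in> range ?W" "Y \<in> range ?W"
    then obtain p q where "X = ?W p" "Y = ?W q" by blast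
    then show "S X Y = S Y X" by (simp only: S(2) Fsym[of p q])
  qed (use S(1) that flip in \<open>simp_all only: Ext2_eq\<close>)
  moreover have "S (wedge2 x y) (wedge2 z w) = ?F (x, y) (z, w)" for x y z w
    using S(2)[of "(x, y)" "(z, w)"] by (simp only: prod.case)
  ultimately have "is_schouten br S"
    unfolding is_schouten_def using S(1) by (simp only: prod.case) blast
  then show ?thesis by blast
qed


subsection \<open>Semialgebraic sets and simplicial cones\<close>

text \<open>
  On a finite-dimensional space the real polynomial functions are exactly the polynomials in
  linear coordinates, so this is the Boolean algebra generated by polynomial inequalities.
\<close>

inductive semialgebraic :: "'a::real_normed_vector set \<Rightarrow> bool" where
  pos: "real_polynomial_function p \<Longrightarrow> semialgebraic {x. p x > 0}"
| compl: "semialgebraic A \<Longrightarrow> semialgebraic (- A)"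
| union: "semialgebraic A \<Longrightarrow> semialgebraic B \<Longrightarrow> semialgebraic (A \<union> B)"

definition simplicial_cone :: "'a::real_vector set \<Rightarrow> bool" where
  "simplicial_cone C \<longleftrightarrow> (\<exists>B. finite B \<and> independent B \<and>
     C = {\<Sum>v\<in>B. t v *\<^sub>R v | t. \<forall>v\<in>B. t v \<ge> 0})"


subsection \<open>Rotational data\<close>

text \<open>
  The index set \<open>{1, \<dots>, m}\<close> is a finite linearly ordered type \<open>'m\<close>. The type \<open>'b\<close> is the
  underlying space of the abelian Lie algebra; its class inner product only serves to make it
  finite-dimensional and is never used below. The inner product of the type \<open>'v\<close> is the
  Euclidean structure of \<open>V\<close>. An orientation of a plane is an equivalence class of ordered bases.
  The field \<open>frame\<close> is the auxiliary choice of unit vectors \<open>e\<^sub>\<ell>\<close>.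
\<close>

record (overloaded) ('m, 'b, 'v) rot_datum =
  plane :: "'m \<Rightarrow> 'v set"
  orient :: "'m \<Rightarrow> ('v \<times> 'v) set"
  weight :: "'m \<Rightarrow> 'b \<Rightarrow>\<^sub>L real"
  frame :: "'m \<Rightarrow> 'v"

definition plane_orientation :: "'v::real_vector set \<Rightarrow> ('v \<times> 'v) set \<Rightarrow> bool" where
  "plane_orientation P Or \<longleftrightarrow> (\<exists>a b. span {a, b} = P \<and> a \<noteq> b \<and> independent {a, b} \<and>
     Or = {(p *\<^sub>R a + q *\<^sub>R b, r *\<^sub>R a + s *\<^sub>R b) | p q r s. p * s - q * r > 0})"

definition rotational_datum ::
  "('m::{finite,linorder}, 'b::euclidean_space, 'v::euclidean_space) rot_datum \<Rightarrow> bool" where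
  "rotational_datum D \<longleftrightarrow>
     (\<forall>l. subspace (plane D l) \<and> dim (plane D l) = 2 \<and>
          plane_orientation (plane D l) (orient D l) \<and>
          weight D l \<noteq> 0 \<and>
          frame D l \<in> plane D l \<and> norm (frame D l) = 1) \<and>
     (\<forall>k l. k \<noteq> l \<longrightarrow> (\<forall>u\<in>plane D k. \<forall>v\<in>plane D l. u \<bullet> v = 0)) \<and>
     span (\<Union>l. plane D l) = UNIV"

definition proj :: "('m, 'b, 'v::euclidean_space) rot_datum \<Rightarrow> 'm \<Rightarrow> 'v \<Rightarrow> 'v" where
  "proj D l v = (THE p. p \<in> plane D l \<and> v - p \<in> span (\<Union>k\<in>-{l}. plane D k))"

definition qturn :: "('m, 'b, 'v::euclidean_space) rot_datum \<Rightarrow> 'm \<Rightarrow> 'v \<Rightarrow> 'v" where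
  "qturn D l u = (THE w. w \<in> plane D l \<and> norm w = norm u \<and> w \<bullet> u = 0 \<and>
                         (u \<noteq> 0 \<longrightarrow> (u, w) \<in> orient D l))"

definition rho ::
  "('m::finite, 'b::euclidean_space, 'v::euclidean_space) rot_datum \<Rightarrow> 'b \<Rightarrow> 'v \<Rightarrow> 'v" where
  "rho D b v = (\<Sum>l\<in>UNIV. weight D l b *\<^sub>R qturn D l (proj D l v))"

definition beta ::
  "('m::finite, 'b::euclidean_space, 'v::euclidean_space) rot_datum \<Rightarrow> 'v \<Rightarrow> 'v \<Rightarrow> 'b dual" where
  "beta D u v = Blinfun (\<lambda>b. rho D b u \<bullet> v)"

type_synonym ('b, 'v) lie = "'b \<times> 'v \<times> 'b dual"

abbreviation inB :: "'b::real_normed_vector \<Rightarrow> ('b, 'v::real_normed_vector) lie" where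
  "inB b \<equiv> (b, 0, 0)"

abbreviation inV :: "'v::real_normed_vector \<Rightarrow> ('b::real_normed_vector, 'v) lie" where
  "inV u \<equiv> (0, u, 0)"

definition bracket ::
  "('m::finite, 'b::euclidean_space, 'v::euclidean_space) rot_datum
     \<Rightarrow> ('b, 'v) lie \<Rightarrow> ('b, 'v) lie \<Rightarrow> ('b, 'v) lie" where
  "bracket D = (\<lambda>(b, u, \<zeta>) (b', u', \<zeta>'). (0, rho D b u' - rho D b' u, beta D u u'))"

text \<open>The inner product on \<open>\<b> \<oplus> V \<oplus> \<b>\<^sup>*\<close> determined by one on \<open>\<b>\<close>.\<close>

definition lie_inner ::
  "('b \<Rightarrow> 'b \<Rightarrow> real) \<Rightarrow> ('b::euclidean_space, 'v::euclidean_space) lie \<Rightarrow> ('b, 'v) lie \<Rightarrow> real" where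
  "lie_inner ip = (\<lambda>(b, u, \<zeta>) (b', u', \<zeta>'). ip b b' + u \<bullet> u' + dual_inner ip \<zeta> \<zeta>')"


subsection \<open>Positive markings\<close>

definition positive_marking :: "('m, 'b::euclidean_space, 'v) rot_datum \<Rightarrow> ('m \<Rightarrow> 'b) \<Rightarrow> bool" where
  "positive_marking D H \<longleftrightarrow> (\<forall>l. weight D l (H l) > 0)"

text \<open>
  Elements of \<open>\<Oplus>\<^sub>\<ell> P\<^sub>\<ell>\<close> are families in \<open>Pi UNIV (plane D)\<close>; \<open>slice\<close> is the identification
  of this space with the marked slice, and \<open>coords\<close> is its inverse.
\<close>

definition slice ::
  "('m::finite \<Rightarrow> 'b::euclidean_space) \<Rightarrow> ('m \<Rightarrow> 'v::euclidean_space) \<Rightarrow> ('b, 'v) lie tensor2" where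
  "slice H u = (\<Sum>l\<in>UNIV. wedge2 (inB (H l)) (inV (u l)))"

definition marked_slice ::
  "('m::finite, 'b::euclidean_space, 'v::euclidean_space) rot_datum \<Rightarrow> ('m \<Rightarrow> 'b)
     \<Rightarrow> ('b, 'v) lie tensor2 set" where
  "marked_slice D H = slice H ` Pi UNIV (plane D)"

definition coords ::
  "('m::finite, 'b::euclidean_space, 'v::euclidean_space) rot_datum \<Rightarrow> ('m \<Rightarrow> 'b)
     \<Rightarrow> ('b, 'v) lie tensor2 \<Rightarrow> 'm \<Rightarrow> 'v" where
  "coords D H = the_inv_into (Pi UNIV (plane D)) (slice H)"

definition Evec ::
  "('m, 'b::euclidean_space, 'v::euclidean_space) rot_datum \<Rightarrow> ('m \<Rightarrow> 'b)
     \<Rightarrow> 'm \<Rightarrow> ('b, 'v) lie tensor3" where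
  "Evec D H l = (2 * weight D l (H l)) *\<^sub>R
     wedge3 (inB (H l)) (inV (frame D l)) (inV (qturn D l (frame D l)))"

definition D_space ::
  "('m, 'b::euclidean_space, 'v::euclidean_space) rot_datum \<Rightarrow> ('m \<Rightarrow> 'b)
     \<Rightarrow> ('b, 'v) lie tensor3 set" where
  "D_space D H = span (range (Evec D H))"

definition C_cone ::
  "('m::finite, 'b::euclidean_space, 'v::euclidean_space) rot_datum \<Rightarrow> ('m \<Rightarrow> 'b)
     \<Rightarrow> ('b, 'v) lie tensor3 set" where
  "C_cone D H = {\<Sum>l\<in>UNIV. t l *\<^sub>R Evec D H l | t. \<forall>l. t l \<ge> 0}"

definition X_space ::
  "('m::linorder, 'b::euclidean_space, 'v::euclidean_space) rot_datum
     \<Rightarrow> ('b, 'v) lie tensor3 set" where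
  "X_space D = span {wedge3 (inB b) (inV p) (inV q) | b p q i j.
                       i < j \<and> p \<in> plane D i \<and> q \<in> plane D j}"

definition DX_space ::
  "('m::linorder, 'b::euclidean_space, 'v::euclidean_space) rot_datum \<Rightarrow> ('m \<Rightarrow> 'b)
     \<Rightarrow> ('b, 'v) lie tensor3 set" where
  "DX_space D H = {d + x | d x. d \<in> D_space D H \<and> x \<in> X_space D}"

definition D_component ::
  "('m::linorder, 'b::euclidean_space, 'v::euclidean_space) rot_datum \<Rightarrow> ('m \<Rightarrow> 'b)
     \<Rightarrow> ('b, 'v) lie tensor3 \<Rightarrow> ('b, 'v) lie tensor3" where
  "D_component D H \<Theta> = (THE d. d \<in> D_space D H \<and> \<Theta> - d \<in> X_space D)"

definition Phi ::
  "('m::finite, 'b::euclidean_space, 'v::euclidean_space) rot_datum \<Rightarrow> ('m \<Rightarrow> 'b)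
     \<Rightarrow> ('b, 'v) lie tensor2 \<Rightarrow> ('b, 'v) lie tensor3" where
  "Phi D H r = (let u = coords D H r in \<Sum>l\<in>UNIV. (norm (u l))\<^sup>2 *\<^sub>R Evec D H l)"

definition mu ::
  "('m::{finite,linorder}, 'b::euclidean_space, 'v::euclidean_space) rot_datum \<Rightarrow> ('m \<Rightarrow> 'b)
     \<Rightarrow> ('b, 'v) lie tensor2 \<Rightarrow> ('b, 'v) lie tensor3" where
  "mu D H r = (let u = coords D H r in
     2 *\<^sub>R (\<Sum>(i, j)\<in>{(i, j). i < j}.
        weight D j (H i) *\<^sub>R wedge3 (inB (H j)) (inV (u i)) (inV (qturn D j (u j)))
      - weight D i (H j) *\<^sub>R wedge3 (inB (H i)) (inV (qturn D i (u i))) (inV (u j))))"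

definition Sigma_map ::
  "('m::finite, 'b::euclidean_space, 'v::euclidean_space) rot_datum
     \<Rightarrow> ('b, 'v) lie tensor2 \<Rightarrow> ('b, 'v) lie tensor3" where
  "Sigma_map D r = schouten (bracket D) r r"

definition radial_fibre ::
  "('m::finite, 'b::euclidean_space, 'v::euclidean_space) rot_datum \<Rightarrow> ('m \<Rightarrow> 'b)
     \<Rightarrow> ('b, 'v) lie tensor3 \<Rightarrow> ('b, 'v) lie tensor2 set" where
  "radial_fibre D H Y = {r \<in> marked_slice D H. Phi D H r = Y}"

definition kappa0 ::
  "('m::finite, 'b::euclidean_space, 'v) rot_datum \<Rightarrow> ('m \<Rightarrow> 'b) \<Rightarrow> ('b \<Rightarrow> 'b \<Rightarrow> real) \<Rightarrow> real" where
  "kappa0 D H ip = 2 * (\<Sum>l\<in>UNIV. ip (H l) (H l) / (weight D l (H l))\<^sup>2) powr (- 1 / 2)"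


subsection \<open>The torus action\<close>

text \<open>
  Here \<open>\<Oplus>\<^sub>\<ell> P\<^sub>\<ell>\<close> is \<open>V\<close> itself, with \<open>v\<close> corresponding to the family \<open>\<lambda>l. proj D l v\<close>. An
  element of the torus is given by angles \<open>\<theta>\<close>, and \<open>real^'m\<close> is also its Lie algebra.
\<close>

definition torus_act ::
  "('m::finite, 'b, 'v::euclidean_space) rot_datum \<Rightarrow> real^'m \<Rightarrow> 'v \<Rightarrow> 'v" where
  "torus_act D \<theta> v =
     (\<Sum>l\<in>UNIV. cos (\<theta> $ l) *\<^sub>R proj D l v + sin (\<theta> $ l) *\<^sub>R qturn D l (proj D l v))"

definition generator :: "('m, 'b, 'v::euclidean_space) rot_datum \<Rightarrow> 'm \<Rightarrow> 'v \<Rightarrow> 'v" where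
  "generator D l v = qturn D l (proj D l v)"

definition omega ::
  "('m::finite, 'b, 'v::euclidean_space) rot_datum \<Rightarrow> 'v \<Rightarrow> 'v \<Rightarrow> real" where
  "omega D v w = (\<Sum>l\<in>UNIV. proj D l v \<bullet> qturn D l (proj D l w))"

definition symplectic :: "('v::real_vector \<Rightarrow> 'v \<Rightarrow> real) \<Rightarrow> bool" where
  "symplectic w \<longleftrightarrow> bilinear w \<and> (\<forall>v. w v v = 0) \<and> (\<forall>v. (\<forall>x. w v x = 0) \<longrightarrow> v = 0)"

definition is_moment_map ::
  "('m::finite, 'b, 'v::euclidean_space) rot_datum \<Rightarrow> ('v \<Rightarrow> (real^'m) dual) \<Rightarrow> bool" where
  "is_moment_map D M \<longleftrightarrow>
     (\<forall>l v. ((\<lambda>x. M x (axis l 1)) has_derivative (\<lambda>w. omega D (generator D l v) w)) (at v))"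

definition eps_dual :: "'m::finite \<Rightarrow> (real^'m) dual" where
  "eps_dual l = Blinfun (\<lambda>x. x $ l)"

definition mu_torus ::
  "('m::finite, 'b, 'v::euclidean_space) rot_datum \<Rightarrow> 'v \<Rightarrow> (real^'m) dual" where
  "mu_torus D v = (1 / 2) *\<^sub>R (\<Sum>l\<in>UNIV. (norm (proj D l v))\<^sup>2 *\<^sub>R eps_dual l)"

end

theory Submission
  imports Defs
begin

text \<open>
  Write \<open>r = \<Sum>\<^sub>l h\<^sub>l \<and> u\<^sub>l\<close>. The Schouten square \<open>[r, r]\<close> is a sum of mixed brackets
  \<open>[h\<^sub>i \<and> u\<^sub>i, h\<^sub>j \<and> u\<^sub>j]\<close>. All central terms cancel, the diagonal brackets depend on the radii \<open>\<parallel>u\<^sub>l\<parallel>\<close> only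
  and form the radial part, and the others lie in the cross space (\<open>schouten_slice\<close>). Linear functionals
  \<open>radial l\<close> that are dual to the \<open>E\<^sub>l\<close> and vanish on the cross space separate the two parts; everything
  about the cone, its fibres and the toric moment map is then a computation in the orthonormal
  frames.

  For the norm estimate, the summands of \<open>r\<close> and the \<open>E\<^sub>l\<close> are orthogonal, which reduces the claim to a
  weighted Cauchy--Schwarz inequality; its defect is a weighted sum of squared
  deviations from the mean, whence the equality case
  (\<open>weighted_Cauchy_Schwarz\<close>, \<open>radial_estimate\<close>).

  For properness, the sum of the radial coordinates of \<open>[r, r]\<close> is \<open>\<Sum>\<^sub>l \<parallel>u\<^sub>l\<parallel>\<^sup>2\<close>. So a bounded image forces a
  bounded argument, and fibres are compact and images of closed sets closed
  (\<open>closed_image_of_norm_controlled\<close>).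

  That the image is semialgebraic is an elimination problem with a special structure. Identify each plane with
  \<open>\<complex>\<close>, with coordinate \<open>z\<^sub>l\<close>. In suitable linear coordinates the image consists of the points whose radial
  coordinates are \<open>\<bar>z\<^sub>l\<bar>\<^sup>2\<close> and whose cross coordinates are prescribed constants times \<open>z\<^sub>i z\<^sub>j\<close> or
  \<open>z\<^sub>i z\<^sub>j\<^sup>*\<close>, with \<open>z\<^sub>j\<^sup>*\<close> the complex conjugate (\<open>range_square_iff\<close>). Once the
  moduli are fixed, what has to be eliminated is a point of a torus subject to monomial equations. Such a
  system is solved by integer row operations: Euclid's algorithm on the exponents leaves at most one
  equation per eliminated phase, and this one is always solvable because the circle is a divisible group
  (\<open>semialgebraic_phase_solvable\<close>). Which cross coordinates see which product depends on the relative
  position of the \<open>h\<^sub>l\<close>; the elimination treats all cases alike.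
\<close>

section \<open>Semialgebraic elimination of phases\<close>

lemma semialgebraic_Int:
  assumes "semialgebraic A" "semialgebraic B"
  shows "semialgebraic (A \<inter> B)"
proof -
  have "A \<inter> B = - (- A \<union> - B)" by blast
  then show ?thesis using assms by (simp only:) (intro semialgebraic.compl semialgebraic.union)
qed

lemma semialgebraic_UNIV: "semialgebraic UNIV"
  using semialgebraic.pos[OF real_polynomial_function.intros(2)[of 1]] by simp

lemma semialgebraic_zero:
  assumes "real_polynomial_function p"
  shows "semialgebraic {x. p x = 0}"
proof -
  have "{x. p x = 0} = - ({x. p x > 0} \<union> {x. - p x > 0})" by auto
  then show ?thesis
    using assms by (simp only:) (intro semialgebraic.intros real_polynomial_function_minus)
qed

lemma semialgebraic_Ball:
  assumes "finite I" "\<And>i. i \<in> I \<Longrightarrow> semialgebraic {x. Q i x}"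
  shows "semialgebraic {x. \<forall>i\<in>I. Q i x}"
  using assms
proof (induction I)
  case (insert i I)
  have "{x. \<forall>k\<in>insert i I. Q k x} = {x. Q i x} \<inter> {x. \<forall>k\<in>I. Q k x}" by blast
  with insert show ?case by (simp add: semialgebraic_Int)
qed (simp add: semialgebraic_UNIV)

lemma semialgebraic_Bex:
  assumes "finite I" "\<And>i. i \<in> I \<Longrightarrow> semialgebraic {x. Q i x}"
  shows "semialgebraic {x. \<exists>i\<in>I. Q i x}"
proof -
  have "semialgebraic (- {x. \<forall>i\<in>I. \<not> Q i x})"
    using assms semialgebraic.compl
    by (intro semialgebraic.compl semialgebraic_Ball) (auto simp: Collect_neg_eq)
  moreover have "- {x. \<forall>i\<in>I. \<not> Q i x} = {x. \<exists>i\<in>I. Q i x}" by blast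
  ultimately show ?thesis by simp
qed

lemma semialgebraic_conj:
  "semialgebraic {x. P x} \<Longrightarrow> semialgebraic {x. Q x} \<Longrightarrow> semialgebraic {x. P x \<and> Q x}"
  using semialgebraic_Int[of "{x. P x}" "{x. Q x}"] by (simp add: Collect_conj_eq)

definition complex_polynomial :: "('a::real_normed_vector \<Rightarrow> complex) \<Rightarrow> bool" where
  "complex_polynomial P \<longleftrightarrow>
     real_polynomial_function (\<lambda>x. Re (P x)) \<and> real_polynomial_function (\<lambda>x. Im (P x))"

lemma complex_polynomial_mult:
  "complex_polynomial P \<Longrightarrow> complex_polynomial Q \<Longrightarrow> complex_polynomial (\<lambda>x. P x * Q x)"
  unfolding complex_polynomial_def by (auto intro!: real_polynomial_function_diff)

lemma complex_polynomial_cnj: "complex_polynomial P \<Longrightarrow> complex_polynomial (\<lambda>x. cnj (P x))"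
  unfolding complex_polynomial_def by auto

lemma complex_polynomial_const: "complex_polynomial (\<lambda>x. c)"
  unfolding complex_polynomial_def by auto

lemma complex_polynomial_zero:
  assumes "complex_polynomial P"
  shows "semialgebraic {x. P x = 0}"
  using assms unfolding complex_polynomial_def complex_eq_iff
  by (auto intro!: semialgebraic_conj semialgebraic_zero)

definition pos_real :: "complex \<Rightarrow> bool" where
  "pos_real z \<longleftrightarrow> Im z = 0 \<and> Re z > 0"

lemma pos_real_iff_norm: "pos_real z \<longleftrightarrow> z \<noteq> 0 \<and> z = of_real (cmod z)"
  unfolding pos_real_def by (auto simp: complex_eq_iff cmod_def)

lemma pos_real_cnj: "pos_real (cnj z) \<longleftrightarrow> pos_real z"
  unfolding pos_real_def by simp

lemma pos_real_cancel: "pos_real w \<Longrightarrow> pos_real (z * w) \<longleftrightarrow> pos_real z"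
  unfolding pos_real_def by (auto simp: zero_less_mult_iff)

lemma semialgebraic_pos_real:
  "complex_polynomial P \<Longrightarrow> semialgebraic {x. pos_real (P x)}"
  unfolding complex_polynomial_def pos_real_def
  by (intro semialgebraic_conj semialgebraic_zero semialgebraic.pos) auto

text \<open>
  With \<open>\<theta>\<^sub>l = exp(\<i> t\<^sub>l)\<close> this is the solvability in \<open>\<theta>\<close> of the monomial equations
  \<open>P\<^sub>i(x) / \<bar>P\<^sub>i(x)\<bar> = \<Prod>\<^sub>l \<theta>\<^sub>l\<^bsup>a i l\<^esup>\<close> on a torus. Asking a product to be positive instead of dividing by
  \<open>\<bar>P\<^sub>i(x)\<bar>\<close> keeps everything polynomial in \<open>x\<close>.
\<close>

definition phase_solvable ::
  "'i set \<Rightarrow> 'm set \<Rightarrow> ('i \<Rightarrow> 'a \<Rightarrow> complex) \<Rightarrow> ('i \<Rightarrow> 'm \<Rightarrow> int) \<Rightarrow> 'a \<Rightarrow> bool" where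
  "phase_solvable I S P a x \<longleftrightarrow>
     (\<exists>t. \<forall>i\<in>I. pos_real (P i x * cis (- (\<Sum>l\<in>S. of_int (a i l) * t l))))"

text \<open>
  If \<open>\<theta>\<^sub>k\<close> occurs in one equation only, that equation can be solved for \<open>\<theta>\<^sub>k\<close> whatever the other
  phases are, because every element of the circle has roots of every order. All that remains of it is
  that its left-hand side has a phase at all.
\<close>

lemma phase_solvable_drop:
  assumes "k \<notin> S" "finite S" "finite I" "j \<in> I" "a j k \<noteq> 0" "\<And>i. i \<in> I - {j} \<Longrightarrow> a i k = 0"
  shows "phase_solvable I (insert k S) P a x \<longleftrightarrow> P j x \<noteq> 0 \<and> phase_solvable (I - {j}) S P a x"
proof
  assume "phase_solvable I (insert k S) P a x"
  then obtain t where t: "\<And>i. i \<in> I \<Longrightarrow>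
      pos_real (P i x * cis (- (\<Sum>l\<in>insert k S. of_int (a i l) * t l)))"
    unfolding phase_solvable_def by blast
  have "P j x \<noteq> 0" using t[OF assms(4)] by (auto simp: pos_real_def)
  moreover have "pos_real (P i x * cis (- (\<Sum>l\<in>S. of_int (a i l) * t l)))" if "i \<in> I - {j}" for i
    using t[of i] that assms by simp
  ultimately show "P j x \<noteq> 0 \<and> phase_solvable (I - {j}) S P a x"
    unfolding phase_solvable_def by blast
next
  assume R: "P j x \<noteq> 0 \<and> phase_solvable (I - {j}) S P a x"
  then obtain t where t: "\<And>i. i \<in> I - {j} \<Longrightarrow>
      pos_real (P i x * cis (- (\<Sum>l\<in>S. of_int (a i l) * t l)))"
    unfolding phase_solvable_def by blast
  \<comment> \<open>the new angle solves equation \<open>j\<close>; the other equations do not see it\<close>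
  define s where "s = t(k := (Arg (P j x) - (\<Sum>l\<in>S. of_int (a j l) * t l)) / of_int (a j k))"
  have s: "(\<Sum>l\<in>S. of_int (a i l) * s l) = (\<Sum>l\<in>S. of_int (a i l) * t l)" for i
    using assms(1) by (intro sum.cong) (auto simp: s_def)
  have "pos_real (P i x * cis (- (\<Sum>l\<in>insert k S. of_int (a i l) * s l)))" if "i \<in> I" for i
  proof (cases "i = j")
    case True
    have "(\<Sum>l\<in>insert k S. of_int (a j l) * s l) = Arg (P j x)"
      using assms by (simp add: s s_def[THEN fun_cong, of k])
    moreover have "P j x * cis (- Arg (P j x)) = of_real (cmod (P j x))"
      using rcis_cmod_Arg[of "P j x"]
      by (metis (no_types, lifting) add.right_neutral add.right_inverse cis_mult cis_zero mult.assoc mult.right_neutral rcis_def)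
    ultimately show ?thesis using R True by (simp add: pos_real_def)
  next
    case False
    then show ?thesis using t[of i] that assms by (simp add: s)
  qed
  then show "phase_solvable I (insert k S) P a x"
    unfolding phase_solvable_def by blast
qed

lemma pos_real_Ball_replace:
  assumes "i \<in> I" "j \<in> I" "i \<noteq> j" "\<And>r. r \<noteq> i \<Longrightarrow> f r = g r"
    and "pos_real (g j) \<Longrightarrow> pos_real (f i) \<longleftrightarrow> pos_real (g i)"
  shows "(\<forall>r\<in>I. pos_real (f r)) \<longleftrightarrow> (\<forall>r\<in>I. pos_real (g r))"
  using assms by metis

text \<open>
  Multiplying or dividing one equation by another is an invertible operation on the system; it adds or
  subtracts the rows of exponents.
\<close>

lemma phase_solvable_add:
  assumes "i \<in> I" "j \<in> I" "i \<noteq> j"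
  shows "phase_solvable I S (P(i := \<lambda>x. P i x * P j x)) (a(i := \<lambda>l. a i l + a j l))
     = phase_solvable I S P a"
  unfolding phase_solvable_def
proof (intro ext ex_cong1 pos_real_Ball_replace[OF assms])
  fix x and t :: "_ \<Rightarrow> real"
  have "P i x * P j x * cis (- (\<Sum>l\<in>S. of_int (a i l + a j l) * t l))
     = (P i x * cis (- (\<Sum>l\<in>S. of_int (a i l) * t l))) * (P j x * cis (- (\<Sum>l\<in>S. of_int (a j l) * t l)))"
    by (simp add: sum.distrib cis_mult algebra_simps)
  then show "pos_real ((P(i := \<lambda>x. P i x * P j x)) i x
        * cis (- (\<Sum>l\<in>S. of_int ((a(i := \<lambda>l. a i l + a j l)) i l) * t l))) \<longleftrightarrow>
     pos_real (P i x * cis (- (\<Sum>l\<in>S. of_int (a i l) * t l)))"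
    if "pos_real (P j x * cis (- (\<Sum>l\<in>S. of_int (a j l) * t l)))"
    using that by (simp only: fun_upd_same pos_real_cancel)
qed simp

lemma phase_solvable_diff:
  assumes "i \<in> I" "j \<in> I" "i \<noteq> j"
  shows "phase_solvable I S (P(i := \<lambda>x. P i x * cnj (P j x))) (a(i := \<lambda>l. a i l - a j l))
     = phase_solvable I S P a"
  unfolding phase_solvable_def
proof (intro ext ex_cong1 pos_real_Ball_replace[OF assms])
  fix x and t :: "_ \<Rightarrow> real"
  have "P i x * cnj (P j x) * cis (- (\<Sum>l\<in>S. of_int (a i l - a j l) * t l))
     = (P i x * cis (- (\<Sum>l\<in>S. of_int (a i l) * t l))) * cnj (P j x * cis (- (\<Sum>l\<in>S. of_int (a j l) * t l)))"
    by (simp add: sum_subtractf cis_cnj cis_mult algebra_simps)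
  then show "pos_real ((P(i := \<lambda>x. P i x * cnj (P j x))) i x
        * cis (- (\<Sum>l\<in>S. of_int ((a(i := \<lambda>l. a i l - a j l)) i l) * t l))) \<longleftrightarrow>
     pos_real (P i x * cis (- (\<Sum>l\<in>S. of_int (a i l) * t l)))"
    if "pos_real (P j x * cis (- (\<Sum>l\<in>S. of_int (a j l) * t l)))"
    using that by (simp only: fun_upd_same pos_real_cancel pos_real_cnj)
qed simp

text \<open>
  Elimination of the phases one at a time. Euclid's algorithm on the exponents of \<open>\<theta>\<^sub>k\<close>, carried out by
  the row operations above, decreases the sum of their absolute values until at most one equation
  involves \<open>\<theta>\<^sub>k\<close>; then \<open>\<theta>\<^sub>k\<close> can be dropped.
\<close>

proposition semialgebraic_phase_solvable:
  fixes P :: "'i \<Rightarrow> 'a::real_normed_vector \<Rightarrow> complex"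
  assumes "finite S" "finite I" "\<And>i. i \<in> I \<Longrightarrow> complex_polynomial (P i)"
  shows "semialgebraic {x. phase_solvable I S P a x}"
  using assms
proof (induction S arbitrary: I P a)
  case empty
  then show ?case
    unfolding phase_solvable_def by (auto intro!: semialgebraic_Ball semialgebraic_pos_real)
next
  case (insert k S)
  have "semialgebraic {x. phase_solvable I (insert k S) P a x}"
    if "finite I" "\<And>i. i \<in> I \<Longrightarrow> complex_polynomial (P i)" for I :: "'i set" and P :: "'i \<Rightarrow> 'a \<Rightarrow> complex" and a
    using that
  proof (induction "\<Sum>i\<in>I. nat \<bar>a i k\<bar>" arbitrary: P a rule: less_induct)
    case less
    consider "\<forall>i\<in>I. a i k = 0"
      | j where "j \<in> I" "a j k \<noteq> 0" "\<forall>i\<in>I - {j}. a i k = 0"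
      | i j where "i \<in> I" "j \<in> I" "i \<noteq> j" "a j k \<noteq> 0" "\<bar>a j k\<bar> \<le> \<bar>a i k\<bar>"
      by (metis Diff_iff insert_iff nle_le)
    then show ?case
    proof cases
      case 1
      then have eq: "phase_solvable I (insert k S) P a x \<longleftrightarrow> phase_solvable I S P a x" for x
        using insert.hyps unfolding phase_solvable_def by simp
      show ?thesis unfolding eq by (intro insert.IH less.prems)
    next
      case 2
      then have eq: "phase_solvable I (insert k S) P a x \<longleftrightarrow> P j x \<noteq> 0 \<and> phase_solvable (I - {j}) S P a x" for x
        using insert.hyps less.prems by (intro phase_solvable_drop) auto
      have "semialgebraic {x. P j x \<noteq> 0}"
        using semialgebraic.compl[OF complex_polynomial_zero[OF less.prems(2)[OF \<open>j \<in> I\<close>]]]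
        by (simp add: Collect_neg_eq)
      then show ?thesis
        unfolding eq using insert.IH[of "I - {j}" P a] less.prems by (intro semialgebraic_conj) auto
    next
      case 3
      have dec: "(\<Sum>r\<in>I. nat \<bar>(a(i := b)) r k\<bar>) < (\<Sum>r\<in>I. nat \<bar>a r k\<bar>)"
        if "\<bar>b k\<bar> < \<bar>a i k\<bar>" for b
        using less.prems(1) \<open>i \<in> I\<close> that by (intro sum_strict_mono_ex1) (auto intro!: bexI[of _ i])
      show ?thesis
      proof (cases "sgn (a i k) = sgn (a j k)")
        case True
        then have "\<bar>a i k - a j k\<bar> < \<bar>a i k\<bar>" using 3 by (auto simp: sgn_if split: if_splits)
        note lt = dec[of "\<lambda>l. a i l - a j l", OF this]
        have "\<forall>r\<in>I. complex_polynomial ((P(i := \<lambda>x. P i x * cnj (P j x))) r)"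
          using less.prems(2) 3 by (auto intro!: complex_polynomial_mult complex_polynomial_cnj)
        from less.hyps[where P = "P(i := \<lambda>x. P i x * cnj (P j x))" and a = "a(i := \<lambda>l. a i l - a j l)", OF lt less.prems(1) this[rule_format]]
        show ?thesis unfolding phase_solvable_diff[OF 3(1-3)] .
      next
        case False
        then have "\<bar>a i k + a j k\<bar> < \<bar>a i k\<bar>" using 3 by (auto simp: sgn_if split: if_splits)
        note lt = dec[of "\<lambda>l. a i l + a j l", OF this]
        have "\<forall>r\<in>I. complex_polynomial ((P(i := \<lambda>x. P i x * P j x)) r)"
          using less.prems(2) 3 by (auto intro!: complex_polynomial_mult)
        from less.hyps[where P = "P(i := \<lambda>x. P i x * P j x)" and a = "a(i := \<lambda>l. a i l + a j l)", OF lt less.prems(1) this[rule_format]]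
        show ?thesis unfolding phase_solvable_add[OF 3(1-3)] .
      qed
    qed
  qed
  then show ?case using insert.prems by blast
qed

text \<open>
  The moduli \<open>\<bar>z\<^sub>l\<bar>\<close> are prescribed by \<open>T\<^sub>l\<close>, so only phases have to be eliminated. A phase exists only for a
  nonzero coordinate, hence the decomposition according to the set \<open>S\<close> of indices with \<open>z\<^sub>l \<noteq> 0\<close>. An
  equation whose right-hand side does not vanish identically on that stratum is equivalent to an
  equation of squared moduli together with one of phases.
\<close>

proposition semialgebraic_quadratic_monomials:
  fixes T :: "'m::finite \<Rightarrow> 'a::real_normed_vector \<Rightarrow> real" and Z :: "'e \<Rightarrow> 'a \<Rightarrow> complex"
    and c :: "'e \<Rightarrow> complex" and i j :: "'e \<Rightarrow> 'm" and conj :: "'e \<Rightarrow> bool"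
  assumes T: "\<And>l. real_polynomial_function (T l)" and fin: "finite A"
    and Z: "\<And>e. e \<in> A \<Longrightarrow> complex_polynomial (Z e)"
  shows "semialgebraic {x. \<exists>z. (\<forall>l. T l x = (cmod (z l))\<^sup>2) \<and>
     (\<forall>e\<in>A. Z e x = c e * z (i e) * (if conj e then cnj (z (j e)) else z (j e)))}" (is "semialgebraic {x. ?ex x}")
proof -
  define live where "live S = {e\<in>A. c e \<noteq> 0 \<and> i e \<in> S \<and> j e \<in> S}" for S
  \<comment> \<open>the two contributions are added, not distinguished by cases, because \<open>i e = j e\<close> is possible\<close>
  define a where "a e l = (if l = i e then 1 else 0) + (if l = j e then (if conj e then - 1 else 1) else (0::int))" for e l
  have a: "(\<Sum>l\<in>UNIV. of_int (a e l) * t l) = t (i e) + (if conj e then - t (j e) else t (j e))" for e and t :: "'m \<Rightarrow> real"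
  proof -
    have "of_int (a e l) * t l = (if l = i e then t l else 0) + (if l = j e then (if conj e then - t l else t l) else 0)" for l
      by (simp add: a_def)
    then show ?thesis by (simp only: sum.distrib sum.delta finite_UNIV) simp
  qed
  define Q where "Q S x \<longleftrightarrow> (\<forall>l\<in>S. T l x > 0) \<and> (\<forall>l\<in>-S. T l x = 0) \<and> (\<forall>e\<in>A - live S. Z e x = 0) \<and>
     (\<forall>e\<in>live S. (Re (Z e x))\<^sup>2 + (Im (Z e x))\<^sup>2 - (cmod (c e))\<^sup>2 * (T (i e) x * T (j e) x) = 0) \<and>
     phase_solvable (live S) UNIV (\<lambda>e x. (1 / c e) * Z e x) a x" for S x
  have fl: "finite (live S)" for S unfolding live_def using fin by simp
  have "semialgebraic {x. Q S x}" for S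
    unfolding Q_def
    using fl T Z fin
    by (intro semialgebraic_conj semialgebraic_Ball semialgebraic.pos semialgebraic_zero complex_polynomial_zero
        semialgebraic_phase_solvable complex_polynomial_mult complex_polynomial_const real_polynomial_function_diff
        real_polynomial_function.intros(2-4) real_polynomial_function_power)
      (auto simp: complex_polynomial_def live_def)
  then have "semialgebraic {x. \<exists>S\<in>UNIV. Q S x}" by (intro semialgebraic_Bex) auto
  moreover have "?ex x \<longleftrightarrow> (\<exists>S. Q S x)" for x
  proof
    assume "?ex x"
    then obtain z where z: "\<And>l. T l x = (cmod (z l))\<^sup>2"
      "\<And>e. e \<in> A \<Longrightarrow> Z e x = c e * z (i e) * (if conj e then cnj (z (j e)) else z (j e))" by blast
    have pz: "z l = of_real (cmod (z l)) * cis (Arg (z l))" for l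
      using rcis_cmod_Arg[of "z l"] by (simp add: rcis_def)
    have "pos_real (1 / c e * Z e x * cis (- (\<Sum>l\<in>UNIV. of_int (a e l) * Arg (z l))))"
      if "e \<in> live {l. z l \<noteq> 0}" for e
    proof -
      have e: "e \<in> A" "c e \<noteq> 0" "z (i e) \<noteq> 0" "z (j e) \<noteq> 0" using that by (auto simp: live_def)
      have "1 / c e * Z e x = z (i e) * (if conj e then cnj (z (j e)) else z (j e))"
        using e z(2) by simp
      also have "\<dots> = of_real (cmod (z (i e)) * cmod (z (j e))) *
          cis (Arg (z (i e)) + (if conj e then - Arg (z (j e)) else Arg (z (j e))))"
        by (subst (1) pz, subst (2 3) pz) (simp add: cis_cnj cis_mult[symmetric])
      finally show ?thesis
        using e by (simp add: a mult.assoc cis_mult pos_real_def)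
    qed
    then have "phase_solvable (live {l. z l \<noteq> 0}) UNIV (\<lambda>e x. 1 / c e * Z e x) a x"
      unfolding phase_solvable_def by (intro exI[of _ "\<lambda>l. Arg (z l)"] ballI)
    moreover have "(Re (Z e x))\<^sup>2 + (Im (Z e x))\<^sup>2 - (cmod (c e))\<^sup>2 * (T (i e) x * T (j e) x) = 0" if "e \<in> A" for e
      unfolding z(1) z(2)[OF that] cmod_power2[symmetric] by (simp add: norm_mult power_mult_distrib)
    ultimately have "Q {l. z l \<noteq> 0} x"
      unfolding Q_def by (auto simp: z live_def)
    then show "\<exists>S. Q S x" by blast
  next
    assume "\<exists>S. Q S x"
    then obtain S t where Q: "Q S x" and t: "\<And>e. e \<in> live S \<Longrightarrow>
        pos_real (1 / c e * Z e x * cis (- (\<Sum>l\<in>UNIV. of_int (a e l) * t l)))"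
      unfolding Q_def phase_solvable_def by blast
    define z where "z l = of_real (sqrt (T l x)) * cis (t l)" for l
    have pos: "l \<in> S \<Longrightarrow> T l x > 0" "l \<notin> S \<Longrightarrow> T l x = 0" for l using Q unfolding Q_def by auto
    have "T l x = (cmod (z l))\<^sup>2" for l
      using pos[of l] by (cases "l \<in> S") (auto simp: z_def norm_mult)
    moreover have "Z e x = c e * z (i e) * (if conj e then cnj (z (j e)) else z (j e))" if "e \<in> A" for e
    proof (cases "e \<in> live S")
      case False
      then have "Z e x = 0" "c e = 0 \<or> z (i e) = 0 \<or> z (j e) = 0"
        using Q that pos by (auto simp: Q_def live_def z_def)
      then show ?thesis by auto
    next
      case True
      let ?w = "1 / c e * Z e x" and ?s = "t (i e) + (if conj e then - t (j e) else t (j e))"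
      have e: "c e \<noteq> 0" "T (i e) x > 0" "T (j e) x > 0" using True pos by (auto simp: live_def)
      have "(cmod (Z e x))\<^sup>2 = (cmod (c e))\<^sup>2 * (T (i e) x * T (j e) x)"
        using Q True unfolding Q_def cmod_power2 by simp
      then have "cmod (Z e x) = sqrt ((cmod (c e))\<^sup>2 * (T (i e) x * T (j e) x))"
        by (metis norm_ge_zero real_sqrt_unique)
      then have n: "cmod ?w = sqrt (T (i e) x) * sqrt (T (j e) x)"
        using e by (simp add: norm_divide norm_mult real_sqrt_mult)
      have "?w * cis (- ?s) = of_real (cmod (?w * cis (- ?s)))"
        using t[OF True] unfolding a pos_real_iff_norm by blast
      moreover have "cmod (?w * cis (- ?s)) = sqrt (T (i e) x) * sqrt (T (j e) x)"
        unfolding norm_mult[of ?w] n by simp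
      ultimately have "?w * cis (- ?s) = of_real (sqrt (T (i e) x) * sqrt (T (j e) x))" by metis
      then have "?w * (cis (- ?s) * cis ?s) = of_real (sqrt (T (i e) x) * sqrt (T (j e) x)) * cis ?s"
        by (metis mult.assoc)
      then have "?w = of_real (sqrt (T (i e) x) * sqrt (T (j e) x)) * cis ?s"
        by (simp add: cis_mult)
      also have "\<dots> = z (i e) * (if conj e then cnj (z (j e)) else z (j e))"
        by (simp add: z_def cis_cnj flip: cis_mult)
      finally show ?thesis using e by (simp add: field_simps)
    qed
    ultimately show "?ex x" by blast
  qed
  ultimately show ?thesis by simp
qed

section \<open>Oriented planes and the quarter-turn\<close>

text \<open>
  The vector \<open>g = \<langle>e, a\<rangle> b - \<langle>e, b\<rangle> a\<close> is orthogonal to \<open>e\<close>, and the determinant of \<open>(e, g)\<close> in the basis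
  \<open>(a, b)\<close> equals \<open>\<langle>e, e\<rangle> = 1\<close>. So \<open>g\<close> lies on the positive side of \<open>e\<close>, and orientation can be read off
  from the coordinates with respect to \<open>e\<close> and the normalised \<open>g\<close>.
\<close>

lemma oriented_plane_frame:
  fixes e :: "'v::euclidean_space"
  assumes P: "subspace P" "dim P = 2" and Or: "plane_orientation P Or" and e: "e \<in> P" "norm e = 1"
  obtains f where "f \<in> P" "norm f = 1" "e \<bullet> f = 0"
    "\<And>u. u \<in> P \<Longrightarrow> u = (u \<bullet> e) *\<^sub>R e + (u \<bullet> f) *\<^sub>R f"
    "\<And>u w. u \<in> P \<Longrightarrow> w \<in> P \<Longrightarrow> (u, w) \<in> Or \<longleftrightarrow> (u \<bullet> e) * (w \<bullet> f) - (u \<bullet> f) * (w \<bullet> e) > 0"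
proof -
  obtain a b where ab: "span {a, b} = P" "a \<noteq> b" "independent {a, b}"
    and Or_eq: "Or = {(p *\<^sub>R a + q *\<^sub>R b, r *\<^sub>R a + s *\<^sub>R b) | p q r s. p * s - q * r > 0}"
    using Or unfolding plane_orientation_def by blast
  have inP: "p *\<^sub>R a + q *\<^sub>R b \<in> P" for p q
    unfolding ab(1)[symmetric] by (intro span_add span_scale span_base) auto
  have coord: "p = p' \<and> q = q'" if "p *\<^sub>R a + q *\<^sub>R b = p' *\<^sub>R a + q' *\<^sub>R b" for p q p' q'
  proof -
    have "(\<Sum>v\<in>{a, b}. (if v = a then p - p' else q - q') *\<^sub>R v) = 0"
      using that ab(2) by (simp add: algebra_simps)
    then have "\<forall>v\<in>{a, b}. (if v = a then p - p' else q - q') = 0"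
      using independentD[OF ab(3), of "{a, b}" "\<lambda>v. if v = a then p - p' else q - q'"] by blast
    then show ?thesis using ab(2) by (auto split: if_splits)
  qed
  have "e \<in> span {a, b}" using e ab by simp
  then obtain p0 q0 where e_ab: "e = p0 *\<^sub>R a + q0 *\<^sub>R b"
    by (auto simp: span_insert span_singleton algebra_simps)
  have e1: "e \<bullet> e = 1" using e by (simp add: norm_eq_1)
  define g where "g = (- (e \<bullet> b)) *\<^sub>R a + (e \<bullet> a) *\<^sub>R b"
  have det: "p0 * (e \<bullet> a) - q0 * (- (e \<bullet> b)) = 1"
    using e1 by (subst (asm) (2) e_ab) (simp add: inner_add_right)
  have "g \<noteq> 0"
  proof
    assume "g = 0"
    then have "- (e \<bullet> b) = 0 \<and> e \<bullet> a = 0" unfolding g_def using coord[of "- (e \<bullet> b)" "e \<bullet> a" 0 0] by simp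
    then show False using det by simp
  qed
  define f where "f = (1 / norm g) *\<^sub>R g"
  have "g \<in> P" "e \<bullet> g = 0" unfolding g_def by (rule inP) (simp add: inner_add_right inner_diff_right mult.commute)
  then have f: "f \<in> P" "norm f = 1" "e \<bullet> f = 0"
    using \<open>g \<noteq> 0\<close> P(1) by (auto simp: f_def subspace_scale)
  then have ff: "f \<bullet> f = 1" by (simp add: norm_eq_1)
  have ne: "e \<noteq> f" using f e1 by auto
  have "independent {e, f}"
    using f e1 ff ne by (intro pairwise_orthogonal_independent) (auto simp: pairwise_def orthogonal_def inner_commute)
  then have "P \<subseteq> span {e, f}"
    using P e f ne by (intro card_ge_dim_independent) auto
  then have ex: "\<exists>x y. u = x *\<^sub>R e + y *\<^sub>R f" if "u \<in> P" for u
    using that by (force simp: span_insert span_singleton algebra_simps)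
  have expand: "u = (u \<bullet> e) *\<^sub>R e + (u \<bullet> f) *\<^sub>R f" if u: "u \<in> P" for u
  proof -
    obtain x y where "u = x *\<^sub>R e + y *\<^sub>R f" using ex[OF u] by blast
    then show ?thesis using f(3) e1 ff by (simp add: inner_add_left inner_commute[of f e])
  qed
  have "(u, w) \<in> Or \<longleftrightarrow> (u \<bullet> e) * (w \<bullet> f) - (u \<bullet> f) * (w \<bullet> e) > 0" if uw: "u \<in> P" "w \<in> P" for u w
  proof -
    let ?n = "1 / norm g"
    have c: "u = ((u \<bullet> e) * p0 - (u \<bullet> f) * ?n * (e \<bullet> b)) *\<^sub>R a + ((u \<bullet> e) * q0 + (u \<bullet> f) * ?n * (e \<bullet> a)) *\<^sub>R b"
      if "u \<in> P" for u
    proof -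
      have "u = (u \<bullet> e) *\<^sub>R (p0 *\<^sub>R a + q0 *\<^sub>R b) + (u \<bullet> f) *\<^sub>R (?n *\<^sub>R g)"
        using expand[OF that] unfolding f_def[symmetric] e_ab[symmetric] .
      then show ?thesis by (simp add: g_def algebra_simps)
    qed
    define A B A' B' where "A = (u \<bullet> e) * p0 - (u \<bullet> f) * ?n * (e \<bullet> b)" "B = (u \<bullet> e) * q0 + (u \<bullet> f) * ?n * (e \<bullet> a)"
      "A' = (w \<bullet> e) * p0 - (w \<bullet> f) * ?n * (e \<bullet> b)" "B' = (w \<bullet> e) * q0 + (w \<bullet> f) * ?n * (e \<bullet> a)"
    note AB = this
    have uw_ab: "u = A *\<^sub>R a + B *\<^sub>R b" "w = A' *\<^sub>R a + B' *\<^sub>R b"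
      using c[OF uw(1)] c[OF uw(2)] unfolding AB .
    have "(u, w) \<in> Or \<longleftrightarrow> A * B' - B * A' > 0"
      unfolding Or_eq using uw_ab by (auto dest!: coord)
    moreover have "A * B' - B * A' = ?n * ((u \<bullet> e) * (w \<bullet> f) - (u \<bullet> f) * (w \<bullet> e)) * (p0 * (e \<bullet> a) - q0 * (- (e \<bullet> b)))"
      unfolding AB by (simp add: algebra_simps)
    ultimately show ?thesis
      unfolding det using \<open>g \<noteq> 0\<close> by (simp add: zero_less_divide_iff)
  qed
  then show ?thesis using that f expand by blast
qed

text \<open>
  By Lagrange's identity the determinant of \<open>(\<alpha>, \<beta>)\<close> and \<open>(x, y)\<close> has absolute value \<open>\<alpha>\<^sup>2 + \<beta>\<^sup>2\<close>. Its sign is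
  given, so it is known along with the inner product, and the two determine \<open>(x, y)\<close>.
\<close>

lemma qturn_unique_algebra:
  fixes x y \<alpha> \<beta> :: real
  assumes perp: "x * \<alpha> + y * \<beta> = 0" and n: "x\<^sup>2 + y\<^sup>2 = \<alpha>\<^sup>2 + \<beta>\<^sup>2" and pos: "\<alpha> * y - \<beta> * x > 0"
  shows "x = - \<beta> \<and> y = \<alpha>"
proof -
  define N where "N = \<alpha>\<^sup>2 + \<beta>\<^sup>2"
  have "(\<alpha> * y - \<beta> * x)\<^sup>2 + (x * \<alpha> + y * \<beta>)\<^sup>2 = N * (x\<^sup>2 + y\<^sup>2)"
    by (simp add: N_def power2_eq_square algebra_simps)
  then have "(\<alpha> * y - \<beta> * x)\<^sup>2 = N\<^sup>2" using perp n by (simp add: N_def power2_eq_square)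
  then have d: "\<alpha> * y - \<beta> * x = N" using pos by (simp add: N_def power2_eq_iff_nonneg)
  then have "N > 0" using pos by simp
  have "N * y = \<alpha> * (\<alpha> * y - \<beta> * x) + \<beta> * (x * \<alpha> + y * \<beta>)"
    "N * x = \<alpha> * (x * \<alpha> + y * \<beta>) - \<beta> * (\<alpha> * y - \<beta> * x)"
    by (simp_all add: N_def power2_eq_square algebra_simps)
  then have "N * y = N * \<alpha>" "N * x = N * (- \<beta>)" unfolding d perp by simp_all
  then show ?thesis using \<open>N > 0\<close> by (metis less_irrefl mult_left_cancel)
qed

locale rotational =
  fixes D :: "('m::{finite,linorder}, 'b::euclidean_space, 'v::euclidean_space) rot_datum"
  assumes datum: "rotational_datum D"
begin

abbreviation e :: "'m \<Rightarrow> 'v" where "e \<equiv> frame D"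
definition f :: "'m \<Rightarrow> 'v" where "f l = qturn D l (e l)"

text \<open>
  The quarter-turn is linear on its plane. This replaces the definite description by a formula in the
  orthonormal basis \<open>(e l, f l)\<close>, on which all later computations rest.
\<close>

lemma frame_qturn:
  shows f_in: "f l \<in> plane D l" and norm_f: "norm (f l) = 1" and e_f: "e l \<bullet> f l = 0"
    and plane_expand: "u \<in> plane D l \<Longrightarrow> u = (u \<bullet> e l) *\<^sub>R e l + (u \<bullet> f l) *\<^sub>R f l"
    and qturn_eq: "u \<in> plane D l \<Longrightarrow> qturn D l u = (u \<bullet> e l) *\<^sub>R f l - (u \<bullet> f l) *\<^sub>R e l"
proof -
  have D: "subspace (plane D l)" "dim (plane D l) = 2" "plane_orientation (plane D l) (orient D l)"
    "e l \<in> plane D l" "norm (e l) = 1"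
    using datum unfolding rotational_datum_def by auto
  obtain g where g: "g \<in> plane D l" "norm g = 1" "e l \<bullet> g = 0"
    and ex: "\<And>u. u \<in> plane D l \<Longrightarrow> u = (u \<bullet> e l) *\<^sub>R e l + (u \<bullet> g) *\<^sub>R g"
    and orient: "\<And>u w. u \<in> plane D l \<Longrightarrow> w \<in> plane D l \<Longrightarrow>
      (u, w) \<in> orient D l \<longleftrightarrow> (u \<bullet> e l) * (w \<bullet> g) - (u \<bullet> g) * (w \<bullet> e l) > 0"
    by (rule oriented_plane_frame[OF D]) blast
  have e1: "e l \<bullet> e l = 1" "g \<bullet> g = 1" using D g by (simp_all add: norm_eq_1)
  have ip: "u \<bullet> w = (u \<bullet> e l) * (w \<bullet> e l) + (u \<bullet> g) * (w \<bullet> g)" if "u \<in> plane D l" for u w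
    using arg_cong[OF ex[OF that], of "\<lambda>v. v \<bullet> w"]
    by (simp add: inner_add_left inner_commute[of "e l" w] inner_commute[of g w])
  have q: "qturn D l u = (u \<bullet> e l) *\<^sub>R g - (u \<bullet> g) *\<^sub>R e l" if u: "u \<in> plane D l" for u
    unfolding qturn_def
  proof (rule the_equality)
    let ?w = "(u \<bullet> e l) *\<^sub>R g - (u \<bullet> g) *\<^sub>R e l"
    have w: "?w \<in> plane D l" using D g by (intro subspace_diff subspace_scale)
    have wi: "?w \<bullet> e l = - (u \<bullet> g)" "?w \<bullet> g = u \<bullet> e l"
      using g(3) e1 by (simp_all add: inner_diff_left inner_commute[of g "e l"])
    have "?w \<bullet> ?w = u \<bullet> u" unfolding ip[OF w, of ?w] ip[OF u, of u] wi by simp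
    moreover have "u \<noteq> 0 \<Longrightarrow> u \<bullet> u > 0" by simp
    ultimately show "?w \<in> plane D l \<and> norm ?w = norm u \<and> ?w \<bullet> u = 0 \<and> (u \<noteq> 0 \<longrightarrow> (u, ?w) \<in> orient D l)"
      using w unfolding orient[OF u w] wi norm_eq_sqrt_inner ip[OF w, of u] ip[OF u, of u] by simp
  next
    fix w assume w: "w \<in> plane D l \<and> norm w = norm u \<and> w \<bullet> u = 0 \<and> (u \<noteq> 0 \<longrightarrow> (u, w) \<in> orient D l)"
    show "w = (u \<bullet> e l) *\<^sub>R g - (u \<bullet> g) *\<^sub>R e l"
    proof (cases "u = 0")
      case False
      have wP: "w \<in> plane D l" using w by blast
      have "w \<bullet> w = u \<bullet> u" using w by (simp add: norm_eq)
      then have "w \<bullet> e l = - (u \<bullet> g) \<and> w \<bullet> g = u \<bullet> e l"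
        using w False unfolding orient[OF u wP] ip[OF wP, of w] ip[OF wP, of u] ip[OF u, of u]
        by (intro qturn_unique_algebra) (auto simp: power2_eq_square)
      then show ?thesis using ex[OF wP] by simp
    qed (use w in simp)
  qed
  have fg: "f l = g" unfolding f_def q[OF D(4)] using e1 g(3) by simp
  show "f l \<in> plane D l" "norm (f l) = 1" "e l \<bullet> f l = 0"
    "u \<in> plane D l \<Longrightarrow> u = (u \<bullet> e l) *\<^sub>R e l + (u \<bullet> f l) *\<^sub>R f l"
    "u \<in> plane D l \<Longrightarrow> qturn D l u = (u \<bullet> e l) *\<^sub>R f l - (u \<bullet> f l) *\<^sub>R e l"
    unfolding fg using g ex q by blast+
qed

lemma subspace_plane: "subspace (plane D l)" and e_in: "e l \<in> plane D l" and norm_e: "norm (e l) = 1"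
  using datum unfolding rotational_datum_def by auto

lemma plane_orthogonal: "u \<in> plane D k \<Longrightarrow> v \<in> plane D l \<Longrightarrow> k \<noteq> l \<Longrightarrow> u \<bullet> v = 0"
  using datum unfolding rotational_datum_def by blast

lemma frame_orthonormal [simp]:
  "e k \<bullet> e l = (if k = l then 1 else 0)" "f k \<bullet> f l = (if k = l then 1 else 0)"
  "e k \<bullet> f l = 0" "f k \<bullet> e l = 0"
  using plane_orthogonal[OF e_in e_in, of k l] plane_orthogonal[OF f_in f_in, of k l] plane_orthogonal[OF e_in f_in, of k l]
    plane_orthogonal[OF f_in e_in, of k l] e_f[of l] norm_e[of k] norm_f[of k]
  by (cases "k = l"; simp add: norm_eq_1 inner_commute[of "f l" "e l"])+

lemma plane_other: "u \<in> plane D k \<Longrightarrow> k \<noteq> l \<Longrightarrow> u \<bullet> e l = 0" "u \<in> plane D k \<Longrightarrow> k \<noteq> l \<Longrightarrow> u \<bullet> f l = 0"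
  using plane_orthogonal e_in f_in by blast+

lemma plane_combination: "x *\<^sub>R e l + y *\<^sub>R f l \<in> plane D l"
  by (intro subspace_add subspace_scale subspace_plane e_in f_in)

lemma qturn_in: "u \<in> plane D l \<Longrightarrow> qturn D l u \<in> plane D l"
  unfolding qturn_eq by (intro subspace_diff subspace_scale subspace_plane e_in f_in)

lemma qturn_e [simp]: "qturn D l (e l) = f l"
  by (simp add: f_def)

lemma frame_expand: "v = (\<Sum>l\<in>UNIV. (v \<bullet> e l) *\<^sub>R e l + (v \<bullet> f l) *\<^sub>R f l)" (is "v = ?s")
proof -
  have d: "c * (if b then 1 else 0) = (if b then c else 0)" for b and c :: real by simp
  have i: "(v - ?s) \<bullet> e l = 0" "(v - ?s) \<bullet> f l = 0" for l
    unfolding inner_diff_left inner_sum_left inner_add_left inner_scaleR_left frame_orthonormal d by simp_all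
  have "orthogonal (v - ?s) u" if "u \<in> plane D l" for u l
    unfolding orthogonal_def by (subst plane_expand[OF that]) (simp add: inner_add_right i)
  moreover have "v - ?s \<in> span (\<Union>l. plane D l)" using datum unfolding rotational_datum_def by simp
  ultimately have "orthogonal (v - ?s) (v - ?s)" by (blast intro: orthogonal_to_span)
  then show ?thesis by (simp add: orthogonal_def)
qed

text \<open>
  The planes are mutually orthogonal, so the component along the other planes is invisible to \<open>e l\<close>
  and \<open>f l\<close>.
\<close>

lemma proj_eq: "proj D l v = (v \<bullet> e l) *\<^sub>R e l + (v \<bullet> f l) *\<^sub>R f l"
  unfolding proj_def
proof (rule the_equality)
  let ?p = "\<lambda>l. (v \<bullet> e l) *\<^sub>R e l + (v \<bullet> f l) *\<^sub>R f l"
  have "(\<Sum>k\<in>UNIV. ?p k) = ?p l + (\<Sum>k\<in>-{l}. ?p k)"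
    unfolding Compl_eq_Diff_UNIV by (rule sum.remove) auto
  then have "v = ?p l + (\<Sum>k\<in>-{l}. ?p k)" unfolding frame_expand[of v, symmetric] .
  then have "v - ?p l = (\<Sum>k\<in>-{l}. ?p k)" unfolding diff_eq_eq by (simp only: add.commute)
  also have "\<dots> \<in> span (\<Union>k\<in>-{l}. plane D k)"
    using plane_combination by (intro span_sum span_base) blast
  finally show "?p l \<in> plane D l \<and> v - ?p l \<in> span (\<Union>k\<in>-{l}. plane D k)" using plane_combination by blast
next
  fix p assume p: "p \<in> plane D l \<and> v - p \<in> span (\<Union>k\<in>-{l}. plane D k)"
  have "orthogonal w (v - p)" if "w \<in> plane D l" for w
  proof (rule orthogonal_to_span)
    show "v - p \<in> span (\<Union>k\<in>-{l}. plane D k)" using p by blast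
    show "orthogonal w y" if "y \<in> (\<Union>k\<in>-{l}. plane D k)" for y
      using that plane_orthogonal[OF \<open>w \<in> plane D l\<close>] unfolding orthogonal_def by blast
  qed
  from this[OF e_in] this[OF f_in] have vp: "v \<bullet> e l = p \<bullet> e l" "v \<bullet> f l = p \<bullet> f l"
    by (simp_all add: orthogonal_def inner_diff_right inner_commute[of "e l"] inner_commute[of "f l"])
  show "p = (v \<bullet> e l) *\<^sub>R e l + (v \<bullet> f l) *\<^sub>R f l"
    unfolding vp by (rule plane_expand) (use p in blast)
qed

lemma proj_in: "proj D l v \<in> plane D l"
  unfolding proj_eq by (rule plane_combination)

lemma proj_plane: "u \<in> plane D k \<Longrightarrow> proj D l u = (if l = k then u else 0)"
  unfolding proj_eq by (cases "l = k") (simp_all add: plane_expand[symmetric] plane_other)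

lemma norm_proj: "(norm (proj D l v))\<^sup>2 = (v \<bullet> e l)\<^sup>2 + (v \<bullet> f l)\<^sup>2"
  unfolding proj_eq power2_norm_eq_inner by (simp add: inner_add_left inner_add_right power2_eq_square)

lemma norm_plane: "u \<in> plane D l \<Longrightarrow> (norm u)\<^sup>2 = (u \<bullet> e l)\<^sup>2 + (u \<bullet> f l)\<^sup>2"
  using norm_proj[of l u] by (simp add: proj_plane)

lemma rho_eq: "rho D b v = (\<Sum>l\<in>UNIV. weight D l b *\<^sub>R ((v \<bullet> e l) *\<^sub>R f l - (v \<bullet> f l) *\<^sub>R e l))"
  unfolding rho_def proj_eq qturn_eq[OF plane_combination] by (simp add: inner_add_left)

lemma rho_plane:
  assumes "u \<in> plane D l"
  shows "rho D b u = weight D l b *\<^sub>R qturn D l u"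
proof -
  have "weight D k b *\<^sub>R ((u \<bullet> e k) *\<^sub>R f k - (u \<bullet> f k) *\<^sub>R e k) =
      (if k = l then weight D l b *\<^sub>R qturn D l u else 0)" for k
    using plane_other[OF assms] qturn_eq[OF assms] by auto
  then show ?thesis unfolding rho_eq by simp
qed

lemma rho_inner: "rho D b u \<bullet> v = (\<Sum>l\<in>UNIV. ((u \<bullet> e l) * (v \<bullet> f l) - (u \<bullet> f l) * (v \<bullet> e l)) * weight D l b)"
  unfolding rho_eq inner_sum_left
  by (intro sum.cong refl) (simp add: inner_diff_left inner_commute[of "e _" v] inner_commute[of "f _" v] algebra_simps)

lemma beta_eq: "beta D u v = (\<Sum>l\<in>UNIV. ((u \<bullet> e l) * (v \<bullet> f l) - (u \<bullet> f l) * (v \<bullet> e l)) *\<^sub>R weight D l)"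
proof (rule blinfun_eqI)
  fix b
  have "bounded_linear (\<lambda>b. rho D b u \<bullet> v)"
    unfolding rho_inner by (intro bounded_linear_intros blinfun.bounded_linear_right)
  then show "beta D u v b = (\<Sum>l\<in>UNIV. ((u \<bullet> e l) * (v \<bullet> f l) - (u \<bullet> f l) * (v \<bullet> e l)) *\<^sub>R weight D l) b"
    unfolding beta_def by (simp add: bounded_linear_Blinfun_apply rho_inner blinfun.sum_left blinfun.scaleR_left)
qed

lemma beta_distinct_planes: "u \<in> plane D k \<Longrightarrow> v \<in> plane D l \<Longrightarrow> k \<noteq> l \<Longrightarrow> beta D u v = 0"
  unfolding beta_eq by (intro sum.neutral ballI) (metis diff_self mult_eq_0_iff plane_other scaleR_eq_0_iff)

lemma beta_self: "beta D u u = 0"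
  unfolding beta_eq by (simp add: mult.commute)

lemma bilinear_rho: "bounded_bilinear (rho D)"
  unfolding bilinear_conv_bounded_bilinear[symmetric] bilinear_def linear_iff rho_eq
  by (auto simp: blinfun.add_right blinfun.scaleR_right inner_add_left sum.distrib[symmetric]
      scaleR_sum_right algebra_simps intro!: sum.cong)

lemma bilinear_beta: "bounded_bilinear (beta D)"
  unfolding bilinear_conv_bounded_bilinear[symmetric] bilinear_def linear_iff beta_eq
  by (auto simp: inner_add_left sum.distrib[symmetric]
      scaleR_sum_right algebra_simps intro!: sum.cong)

lemma bracket_eq: "bracket D x y = (0, rho D (fst x) (fst (snd y)) - rho D (fst y) (fst (snd x)), beta D (fst (snd x)) (fst (snd y)))"
  unfolding bracket_def by (simp add: case_prod_unfold)

lemma bracket_skew: "bracket D x y = - bracket D y x"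
  unfolding bracket_eq beta_eq by (simp add: sum_negf[symmetric] algebra_simps)

lemma bounded_bilinear_bracket: "bounded_bilinear (bracket D)"
proof -
  interpret r: bounded_bilinear "rho D" by (rule bilinear_rho)
  interpret be: bounded_bilinear "beta D" by (rule bilinear_beta)
  obtain K where K: "K \<ge> 0" "\<And>b u. norm (rho D b u) \<le> norm b * norm u * K" using r.nonneg_bounded by blast
  obtain L where L: "L \<ge> 0" "\<And>b u. norm (beta D b u) \<le> norm b * norm u * L" using be.nonneg_bounded by blast
  have n: "norm (fst x) \<le> norm x" "norm (fst (snd x)) \<le> norm x" for x :: "('b, 'v) lie"
    using norm_fst_le[of "fst x" "snd x"] norm_snd_le[of "snd x" "fst x"] norm_fst_le[of "fst (snd x)" "snd (snd x)"] by auto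
  show ?thesis
  proof
    have "norm (bracket D x y) \<le> norm x * norm y * (K + K + L)" for x y
    proof -
      have "norm (rho D (fst x) (fst (snd y))) \<le> norm x * norm y * K" for x y :: "('b, 'v) lie"
        by (rule order_trans[OF K(2)]) (intro mult_mono n K(1) mult_nonneg_nonneg norm_ge_zero order_refl)
      from norm_triangle_le_diff[OF add_mono[OF this this]]
      have 1: "norm (rho D (fst x) (fst (snd y)) - rho D (fst y) (fst (snd x))) \<le> norm x * norm y * K + norm y * norm x * K" .
      have 2: "norm (beta D (fst (snd x)) (fst (snd y))) \<le> norm x * norm y * L"
        by (rule order_trans[OF L(2)]) (intro mult_mono n L(1) mult_nonneg_nonneg norm_ge_zero order_refl)
      show ?thesis unfolding bracket_eq
        by (rule order_trans[OF norm_Pair_le], rule order_trans[OF add_left_mono[OF norm_Pair_le]])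
           (use 1 2 in \<open>simp add: algebra_simps\<close>)
    qed
    then show "\<exists>K. \<forall>a b. norm (bracket D a b) \<le> norm a * norm b * K" by blast
  qed (simp_all add: bracket_eq r.add_left r.add_right be.add_left be.add_right r.scaleR_left r.scaleR_right
        be.scaleR_left be.scaleR_right scaleR_diff_right)
qed

end

section \<open>Multilinear algebra\<close>

lemma wedge2_linear:
  "wedge2 (x + x') y = wedge2 x y + wedge2 x' y" "wedge2 (c *\<^sub>R x) y = c *\<^sub>R wedge2 x y"
  "wedge2 x (y + y') = wedge2 x y + wedge2 x y'" "wedge2 x (c *\<^sub>R y) = c *\<^sub>R wedge2 x y"
  by (intro blinfun_eqI; simp add: blinfun.add_left blinfun.add_right blinfun.scaleR_left blinfun.scaleR_right algebra_simps)+

lemma wedge3_linear: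
  "wedge3 (x + x') y z = wedge3 x y z + wedge3 x' y z" "wedge3 (c *\<^sub>R x) y z = c *\<^sub>R wedge3 x y z"
  "wedge3 x (y + y') z = wedge3 x y z + wedge3 x y' z" "wedge3 x (c *\<^sub>R y) z = c *\<^sub>R wedge3 x y z"
  "wedge3 x y (z + z') = wedge3 x y z + wedge3 x y z'" "wedge3 x y (c *\<^sub>R z) = c *\<^sub>R wedge3 x y z"
  by (intro blinfun_eqI; simp add: blinfun.add_left blinfun.add_right blinfun.scaleR_left blinfun.scaleR_right algebra_simps)+

lemma wedge3_swap: "wedge3 y x z = - wedge3 x y z" "wedge3 x z y = - wedge3 x y z"
  by (intro blinfun_eqI; simp add: blinfun.minus_left algebra_simps)+

lemma wedge3_zero: "wedge3 0 y z = 0" "wedge3 x 0 z = 0" "wedge3 x y 0 = 0"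
  using wedge3_linear(2)[of 0 0 y z] wedge3_linear(4)[of x 0 0 z] wedge3_linear(6)[of x y 0 0] by simp_all

lemma bounded_linear_eval3: "bounded_linear (\<lambda>\<Theta> :: 'a::real_normed_vector tensor3. \<Theta> \<phi> \<psi> \<eta>)"
  by (intro bounded_linear_compose[OF blinfun.bounded_linear_left] blinfun.bounded_linear_left)

lemma wedge2_Ext2: "wedge2 x y \<in> Ext2"
  unfolding Ext2_def by (intro span_base) blast

lemma subspace_Ext2: "subspace Ext2" and subspace_Ext3: "subspace Ext3"
  unfolding Ext2_def Ext3_def by (rule subspace_span)+

lemma wedge3_Ext3: "wedge3 x y z \<in> Ext3"
  unfolding Ext3_def by (intro span_base) blast

lemma bilinear_on_sum:
  assumes q: "bilinear_on X Y q" and X: "subspace X" and Y: "subspace Y" and "finite I" "finite K"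
    and A: "\<And>i. i \<in> I \<Longrightarrow> A i \<in> X" and B: "\<And>k. k \<in> K \<Longrightarrow> B k \<in> Y"
  shows "q (\<Sum>i\<in>I. A i) (\<Sum>k\<in>K. B k) = (\<Sum>i\<in>I. \<Sum>k\<in>K. q (A i) (B k))"
proof -
  note q = q[unfolded bilinear_on_def]
  have z: "q a 0 = 0" "q 0 b = 0" if "a \<in> X" "b \<in> Y" for a b
    using q that subspace_0[OF X] subspace_0[OF Y] by (metis scaleR_zero_left)+
  have 1: "q a (\<Sum>k\<in>K. B k) = (\<Sum>k\<in>K. q a (B k))" if "a \<in> X" for a
    using \<open>finite K\<close> B
  proof (induction K)
    case (insert k K)
    then have "(\<Sum>k\<in>K. B k) \<in> Y" by (intro subspace_sum Y) auto
    then show ?case using insert q that by simp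
  qed (use z[OF that subspace_0[OF Y]] in simp)
  have sB: "(\<Sum>k\<in>K. B k) \<in> Y" using B by (intro subspace_sum Y)
  show ?thesis
    using \<open>finite I\<close> A
  proof (induction I)
    case (insert i I)
    then have "(\<Sum>i\<in>I. A i) \<in> X" by (intro subspace_sum X) auto
    then show ?case using insert q sB 1 by simp
  qed (use z[OF subspace_0[OF X] sB] in simp)
qed

text \<open>
  The diagonal of such a double sum becomes the radial part of a Schouten square, the rest its cross
  part.
\<close>

lemma sum_symmetric_pairs:
  fixes G :: "'m::{finite,linorder} \<Rightarrow> 'm \<Rightarrow> 'c::real_vector"
  assumes "\<And>i j. G i j = G j i"
  shows "(\<Sum>i\<in>UNIV. \<Sum>j\<in>UNIV. G i j) = (\<Sum>i\<in>UNIV. G i i) + 2 *\<^sub>R (\<Sum>(i, j)\<in>{(i, j). i < j}. G i j)"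
proof -
  let ?G = "\<lambda>(i, j). G i j"
  have "(\<Sum>i\<in>UNIV. \<Sum>j\<in>UNIV. G i j) = sum ?G UNIV"
    by (simp add: sum.cartesian_product)
  also have "(UNIV :: ('m \<times> 'm) set) = {(i, j). i = j} \<union> ({(i, j). i < j} \<union> {(i, j). j < i})"
    by auto
  also have "sum ?G \<dots> = sum ?G {(i, j). i = j} + (sum ?G {(i, j). i < j} + sum ?G {(i, j). j < i})"
    by (subst sum.union_disjoint, simp, simp, force, subst sum.union_disjoint) auto
  also have "sum ?G {(i, j). i = j} = (\<Sum>i\<in>UNIV. G i i)"
    by (rule sum.reindex_bij_witness[of _ "\<lambda>i. (i, i)" fst]) auto
  also have "sum ?G {(i, j). j < i} = sum ?G {(i, j). i < j}"
    by (rule sum.reindex_bij_witness[of _ prod.swap prod.swap]) (auto simp: assms)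
  finally show ?thesis by (simp add: scaleR_2)
qed

definition formB :: "('b::euclidean_space \<Rightarrow>\<^sub>L real) \<Rightarrow> ('b, 'v::euclidean_space) lie dual" where
  "formB \<alpha> = Blinfun (\<lambda>x. \<alpha> (fst x))"

definition formV :: "'v \<Rightarrow> ('b::euclidean_space, 'v::euclidean_space) lie dual" where
  "formV p = Blinfun (\<lambda>x. p \<bullet> fst (snd x))"

lemma formB_apply [simp]: "formB \<alpha> x = \<alpha> (fst x)"
  unfolding formB_def by (subst bounded_linear_Blinfun_apply)
    (auto intro: bounded_linear_compose[OF blinfun.bounded_linear_right bounded_linear_fst])

lemma formV_apply [simp]: "formV p x = p \<bullet> fst (snd x)"
  unfolding formV_def by (subst bounded_linear_Blinfun_apply)
    (auto intro!: bounded_linear_compose[OF bounded_linear_inner_right]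
      bounded_linear_compose[OF bounded_linear_fst bounded_linear_snd])

lemma inV_linear: "inV (u + v) = inV u + inV v" "inV (c *\<^sub>R u) = c *\<^sub>R inV u" "inV (u - v) = inV u - inV v"
  by simp_all

section \<open>The Schouten square of a slice element\<close>

locale marked = rotational D
  for D :: "('m::{finite,linorder}, 'b::euclidean_space, 'v::euclidean_space) rot_datum" +
  fixes H :: "'m \<Rightarrow> 'b"
  assumes positive: "positive_marking D H"
begin

abbreviation w :: "'m \<Rightarrow> real" where "w l \<equiv> weight D l (H l)"

lemma w_pos: "w l > 0"
  using positive unfolding positive_marking_def by blast

text \<open>
  The mixed Schouten bracket \<open>[h\<^sub>i \<and> u\<^sub>i, h\<^sub>j \<and> u\<^sub>j]\<close>.
\<close>

definition cross :: "('m \<Rightarrow> 'v) \<Rightarrow> 'm \<Rightarrow> 'm \<Rightarrow> ('b, 'v) lie tensor3" where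
  "cross u i j = weight D j (H i) *\<^sub>R wedge3 (inB (H j)) (inV (u i)) (inV (qturn D j (u j)))
      - weight D i (H j) *\<^sub>R wedge3 (inB (H i)) (inV (qturn D i (u i))) (inV (u j))"

lemma cross_commute: "cross u i j = cross u j i"
proof -
  have "wedge3 (inB (H i)) (inV (u j)) (inV (qturn D i (u i))) = - wedge3 (inB (H i)) (inV (qturn D i (u i))) (inV (u j))"
    "wedge3 (inB (H j)) (inV (qturn D j (u j))) (inV (u i)) = - wedge3 (inB (H j)) (inV (u i)) (inV (qturn D j (u j)))"
    by (rule wedge3_swap)+
  then show ?thesis unfolding cross_def by simp
qed

lemma wedge3_qturn:
  assumes "u \<in> plane D l"
  shows "wedge3 x (inV u) (inV (qturn D l u)) = (norm u)\<^sup>2 *\<^sub>R wedge3 x (inV (e l)) (inV (f l))"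
proof -
  define a b where "a = u \<bullet> e l" and "b = u \<bullet> f l"
  have u: "u = a *\<^sub>R e l + b *\<^sub>R f l" "qturn D l u = a *\<^sub>R f l - b *\<^sub>R e l" "(norm u)\<^sup>2 = a\<^sup>2 + b\<^sup>2"
    using plane_expand[OF assms] qturn_eq[OF assms] norm_plane[OF assms] unfolding a_def b_def by blast+
  show ?thesis
    unfolding u(3) u(2) unfolding u(1) inV_linear
    by (intro blinfun_eqI) (simp add: blinfun.add_right blinfun.add_left blinfun.scaleR_left blinfun.scaleR_right blinfun.diff_right
       power2_eq_square algebra_simps del: scaleR_Pair)
qed

text \<open>
  The two terms of the diagonal bracket agree, and \<open>u \<and> J u = \<parallel>u\<parallel>\<^sup>2 e \<and> f\<close>: the diagonal sees only the radius.
\<close>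

lemma cross_self:
  assumes "u l \<in> plane D l"
  shows "cross u l l = (norm (u l))\<^sup>2 *\<^sub>R Evec D H l"
proof -
  have "wedge3 (inB (H l)) (inV (qturn D l (u l))) (inV (u l)) = - wedge3 (inB (H l)) (inV (u l)) (inV (qturn D l (u l)))"
    by (rule wedge3_swap)
  then have "cross u l l = w l *\<^sub>R wedge3 (inB (H l)) (inV (u l)) (inV (qturn D l (u l)))
      - w l *\<^sub>R - wedge3 (inB (H l)) (inV (u l)) (inV (qturn D l (u l)))"
    unfolding cross_def by simp
  also have "\<dots> = (2 * w l) *\<^sub>R wedge3 (inB (H l)) (inV (u l)) (inV (qturn D l (u l)))"
    by (simp only: scaleR_minus_right diff_minus_eq_add mult_2 scaleR_left_distrib)
  finally show ?thesis unfolding wedge3_qturn[OF assms] Evec_def by (simp add: mult.commute)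
qed

text \<open>
  Only the brackets of an element of the abelian part with a vector survive. The central term
  \<open>\<beta>(u\<^sub>i, u\<^sub>j)\<close> vanishes: for \<open>i \<noteq> j\<close> because the rotations preserve the mutually orthogonal planes, for
  \<open>i = j\<close> because \<open>\<beta>\<close> is alternating.
\<close>

lemma schouten_decomposable:
  assumes S: "is_schouten (bracket D) S" and u: "u \<in> Pi UNIV (plane D)"
  shows "S (wedge2 (inB (H i)) (inV (u i))) (wedge2 (inB (H j)) (inV (u j))) = cross u i j"
proof -
  interpret r: bounded_bilinear "rho D" by (rule bilinear_rho)
  interpret be: bounded_bilinear "beta D" by (rule bilinear_beta)
  have P: "u k \<in> plane D k" for k using u by blast
  have b: "beta D (u i) (u j) = 0" using beta_distinct_planes[OF P P] beta_self by metis
  have br: "bracket D (inB h) (inB h') = 0" "bracket D (inB h) (inV v) = inV (rho D h v)"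
    "bracket D (inV v) (inB h) = (- 1) *\<^sub>R inV (rho D h v)" "bracket D (inV (u i)) (inV (u j)) = 0" for h h' v
    by (simp_all add: bracket_eq r.zero_left r.zero_right be.zero_left be.zero_right b zero_prod_def)
  have Sw: "S (wedge2 x y) (wedge2 z t) =
      wedge3 (bracket D x z) y t - wedge3 (bracket D x t) y z - wedge3 (bracket D y z) x t + wedge3 (bracket D y t) x z" for x y z t
    using S unfolding is_schouten_def by blast
  have "S (wedge2 (inB (H i)) (inV (u i))) (wedge2 (inB (H j)) (inV (u j))) =
     - wedge3 (inV (rho D (H i) (u j))) (inV (u i)) (inB (H j))
     + wedge3 (inV (rho D (H j) (u i))) (inB (H i)) (inV (u j))"
    unfolding Sw br wedge3_linear wedge3_zero by simp
  also have "- wedge3 (inV (rho D (H i) (u j))) (inV (u i)) (inB (H j)) = wedge3 (inB (H j)) (inV (u i)) (inV (rho D (H i) (u j)))"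
    by (intro blinfun_eqI) (simp add: blinfun.minus_left algebra_simps)
  also have "wedge3 (inV (rho D (H j) (u i))) (inB (H i)) (inV (u j)) = - wedge3 (inB (H i)) (inV (rho D (H j) (u i))) (inV (u j))"
    by (rule wedge3_swap)
  finally show ?thesis
    unfolding rho_plane[OF P] inV_linear wedge3_linear cross_def by simp
qed

lemma slice_Ext2: "slice H u \<in> Ext2"
  unfolding slice_def Ext2_def by (intro span_sum span_base) blast

lemma schouten_slice:
  assumes u: "u \<in> Pi UNIV (plane D)"
  shows "schouten (bracket D) (slice H u) (slice H u) =
     (\<Sum>l\<in>UNIV. (norm (u l))\<^sup>2 *\<^sub>R Evec D H l) + 2 *\<^sub>R (\<Sum>(i, j)\<in>{(i, j). i < j}. cross u i j)"
proof -
  obtain S where S: "is_schouten (bracket D) S"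
    using schouten_ex[OF bounded_bilinear_bracket bracket_skew] by blast
  have "schouten (bracket D) (slice H u) (slice H u) = S (slice H u) (slice H u)"
    by (intro schouten_eq S slice_Ext2)
  also have "\<dots> = (\<Sum>i\<in>UNIV. \<Sum>j\<in>UNIV. cross u i j)"
    unfolding schouten_decomposable[OF S u, symmetric] slice_def
    by (rule bilinear_on_sum[where X = Ext2 and Y = Ext2])
      (use S subspace_span in \<open>simp_all add: is_schouten_def Ext2_def[symmetric] wedge2_Ext2 subspace_Ext2\<close>)
  also have "\<dots> = (\<Sum>l\<in>UNIV. cross u l l) + 2 *\<^sub>R (\<Sum>(i, j)\<in>{(i, j). i < j}. cross u i j)"
    by (intro sum_symmetric_pairs cross_commute)
  finally show ?thesis using u by (simp add: cross_self Pi_iff)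
qed

section \<open>Linear coordinates on the slice and on its image\<close>

text \<open>
  Testing against the weight \<open>\<lambda>\<^sub>l\<close> in the first argument recovers \<open>u\<^sub>l\<close> up to the factor \<open>\<lambda>\<^sub>l(h\<^sub>l)\<close>, which is
  nonzero by positivity. The result is defined and linear on the whole tensor space.
\<close>

definition slot :: "'m \<Rightarrow> ('b, 'v) lie tensor2 \<Rightarrow> 'v" where
  "slot l r = (r (formB (weight D l)) (formV (e l)) / w l) *\<^sub>R e l
            + (r (formB (weight D l)) (formV (f l)) / w l) *\<^sub>R f l"

lemma slot_slice:
  assumes u: "u \<in> Pi UNIV (plane D)"
  shows "slot l (slice H u) = u l"
proof -
  have P: "u k \<in> plane D k" for k using u by blast
  have ev: "slice H u (formB (weight D l)) (formV p) = (\<Sum>k\<in>UNIV. weight D l (H k) * (p \<bullet> u k))" for p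
    unfolding slice_def by (simp add: blinfun.sum_left)
  have s: "(\<Sum>k\<in>UNIV. weight D l (H k) * (p \<bullet> u k)) = w l * (u l \<bullet> p)" if "p = e l \<or> p = f l" for p
  proof -
    have "weight D l (H k) * (p \<bullet> u k) = (if k = l then w l * (u l \<bullet> p) else 0)" for k
      using that plane_other[OF P[of k]] by (auto simp: inner_commute)
    then show ?thesis by simp
  qed
  have "slot l (slice H u) = (u l \<bullet> e l) *\<^sub>R e l + (u l \<bullet> f l) *\<^sub>R f l"
    unfolding slot_def ev using s[of "e l"] s[of "f l"] w_pos[of l] by simp
  then show ?thesis using plane_expand[OF P[of l]] by metis
qed

lemma slice_inj: "inj_on (slice H) (Pi UNIV (plane D))"
  by (rule inj_on_inverseI[where g = "\<lambda>r l. slot l r"]) (simp add: slot_slice)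

lemma coords_slice: "u \<in> Pi UNIV (plane D) \<Longrightarrow> coords D H (slice H u) = u"
  unfolding coords_def by (rule the_inv_into_f_f[OF slice_inj])

lemma Phi_slice: "u \<in> Pi UNIV (plane D) \<Longrightarrow> Phi D H (slice H u) = (\<Sum>l\<in>UNIV. (norm (u l))\<^sup>2 *\<^sub>R Evec D H l)"
  unfolding Phi_def by (simp add: coords_slice)

lemma mu_slice: "u \<in> Pi UNIV (plane D) \<Longrightarrow> mu D H (slice H u) = 2 *\<^sub>R (\<Sum>(i, j)\<in>{(i, j). i < j}. cross u i j)"
  unfolding mu_def by (simp add: coords_slice cross_def)

text \<open>
  The coordinate of \<open>E\<^sub>l\<close>. Testing against \<open>e\<^sub>l\<close> and \<open>f\<^sub>l\<close> kills the other \<open>E\<^sub>k\<close> and everything that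
  involves two different planes; the value at \<open>E\<^sub>l\<close> is \<open>2 \<lambda>\<^sub>l(h\<^sub>l)\<^sup>2\<close>, one factor coming from \<open>E\<^sub>l\<close> and
  one from the weight as test form. These functionals show that the \<open>E\<^sub>l\<close> are independent and that
  their span meets the cross space trivially.
\<close>

definition radial :: "'m \<Rightarrow> ('b, 'v) lie tensor3 \<Rightarrow> real" where
  "radial l \<Theta> = \<Theta> (formB (weight D l)) (formV (e l)) (formV (f l)) / (2 * (w l)\<^sup>2)"

lemma radial_linear: "bounded_linear (radial l)"
  unfolding radial_def by (intro bounded_linear_compose[OF bounded_linear_divide] bounded_linear_eval3)

lemma eval_wedge3: "wedge3 (inB b) (inV u) (inV v) (formB \<alpha>) (formV p) (formV q) = \<alpha> b * ((p \<bullet> u) * (q \<bullet> v) - (p \<bullet> v) * (q \<bullet> u))"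
  by (simp add: algebra_simps)

lemma radial_Evec [simp]: "radial l (Evec D H k) = (if k = l then 1 else 0)"
  using w_pos[of l] unfolding radial_def Evec_def
  by (auto simp: blinfun.scaleR_left eval_wedge3 power2_eq_square)

lemma subspace_X: "subspace (X_space D)"
  unfolding X_space_def by (rule subspace_span)

lemma wedge3_in_X:
  "i < j \<Longrightarrow> p \<in> plane D i \<Longrightarrow> q \<in> plane D j \<Longrightarrow> wedge3 (inB b) (inV p) (inV q) \<in> X_space D"
  unfolding X_space_def by (rule span_base) blast

lemma radial_X: "x \<in> X_space D \<Longrightarrow> radial l x = 0"
  unfolding X_space_def
proof (induction x rule: span_induct)
  case base
  show ?case using linear_simps[OF radial_linear] by (simp add: subspace_def)
next
  case (step x)
  then obtain b p q i j where x: "x = wedge3 (inB b) (inV p) (inV q)" "i < j" "p \<in> plane D i" "q \<in> plane D j" by blast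
  then have "i \<noteq> j" by simp
  then have "e l \<bullet> p = 0 \<or> f l \<bullet> q = 0" "e l \<bullet> q = 0 \<or> f l \<bullet> p = 0"
    using plane_other x(3,4) by (metis inner_commute)+
  then show ?case unfolding radial_def x(1) eval_wedge3 by auto
qed

lemma radial_sum: "radial l (\<Sum>k\<in>UNIV. c k *\<^sub>R Evec D H k) = c l"
proof -
  interpret bounded_linear "radial l" by (rule radial_linear)
  show ?thesis by (simp add: sum scaleR if_distrib cong: if_cong)
qed

lemma Evec_sum_in: "(\<Sum>k\<in>UNIV. c k *\<^sub>R Evec D H k) \<in> D_space D H"
  unfolding D_space_def by (intro span_sum span_scale span_base) blast

lemma D_expand:
  assumes "d \<in> D_space D H"
  shows "d = (\<Sum>k\<in>UNIV. radial k d *\<^sub>R Evec D H k)"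
proof (rule linear_eq_on_span[where f = "\<lambda>d. d" and g = "\<lambda>d. \<Sum>k\<in>UNIV. radial k d *\<^sub>R Evec D H k"])
  show "linear (\<lambda>d. d)" by (rule linear_ident)
  show "linear (\<lambda>d. \<Sum>k\<in>UNIV. radial k d *\<^sub>R Evec D H k)"
    by (intro bounded_linear.linear bounded_linear_sum bounded_linear_compose[OF bounded_linear_scaleR_left] radial_linear)
  show "d \<in> span (range (Evec D H))" using assms unfolding D_space_def .
  fix x assume "x \<in> range (Evec D H)"
  then obtain l where x: "x = Evec D H l" by blast
  have "(if l = k then 1 else 0) *\<^sub>R Evec D H k = (if l = k then Evec D H l else 0)" for k by simp
  then show "x = (\<Sum>k\<in>UNIV. radial k x *\<^sub>R Evec D H k)" unfolding x radial_Evec by simp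
qed

lemma D_X_trivial: "D_space D H \<inter> X_space D = {0}"
proof -
  have "d = 0" if "d \<in> D_space D H" "d \<in> X_space D" for d
    by (subst D_expand[OF that(1)]) (simp add: radial_X[OF that(2)])
  then show ?thesis
    using subspace_0[OF subspace_X] span_zero[of "range (Evec D H)"] unfolding D_space_def by blast
qed

lemma cross_in_X:
  assumes "u \<in> Pi UNIV (plane D)" "i < j"
  shows "cross u i j \<in> X_space D"
proof -
  have P: "u k \<in> plane D k" for k using assms by blast
  show ?thesis unfolding cross_def
    by (intro subspace_diff subspace_scale subspace_X wedge3_in_X[OF assms(2)] P qturn_in)
qed

lemma mu_in_X: "u \<in> Pi UNIV (plane D) \<Longrightarrow> mu D H (slice H u) \<in> X_space D"
  unfolding mu_slice
  by (intro subspace_scale[OF subspace_X] subspace_sum[OF subspace_X]) (auto simp: cross_in_X)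

lemma schouten_decomposition:
  "u \<in> Pi UNIV (plane D) \<Longrightarrow> schouten (bracket D) (slice H u) (slice H u) = Phi D H (slice H u) + mu D H (slice H u)"
  by (simp add: schouten_slice Phi_slice mu_slice)

lemma family_with_norms:
  assumes "\<And>l. t l \<ge> 0"
  obtains u where "u \<in> Pi UNIV (plane D)" "\<And>l. (norm (u l))\<^sup>2 = t l"
proof
  show "(\<lambda>l. sqrt (t l) *\<^sub>R e l) \<in> Pi UNIV (plane D)" using subspace_plane e_in by (auto intro: subspace_scale)
  show "(norm (sqrt (t l) *\<^sub>R e l))\<^sup>2 = t l" for l using assms norm_e by simp
qed

lemma Phi_image: "Phi D H ` marked_slice D H = C_cone D H"
proof
  show "Phi D H ` marked_slice D H \<subseteq> C_cone D H"
  proof (intro image_subsetI)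
    fix r assume "r \<in> marked_slice D H"
    then obtain u where "u \<in> Pi UNIV (plane D)" "r = slice H u" unfolding marked_slice_def by blast
    then have "Phi D H r = (\<Sum>l\<in>UNIV. (norm (u l))\<^sup>2 *\<^sub>R Evec D H l)" by (simp add: Phi_slice)
    moreover have "\<forall>l. (norm (u l))\<^sup>2 \<ge> 0" by simp
    ultimately show "Phi D H r \<in> C_cone D H" unfolding C_cone_def mem_Collect_eq by (intro exI conjI)
  qed
  show "C_cone D H \<subseteq> Phi D H ` marked_slice D H"
  proof
    fix Y assume "Y \<in> C_cone D H"
    then obtain t where Y: "Y = (\<Sum>l\<in>UNIV. t l *\<^sub>R Evec D H l)" and t: "\<And>l. t l \<ge> 0" unfolding C_cone_def by blast
    obtain u where u: "u \<in> Pi UNIV (plane D)" "\<And>l. (norm (u l))\<^sup>2 = t l" by (rule family_with_norms[of t]) (use t in auto)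
    then have "Phi D H (slice H u) = Y" unfolding Y by (simp add: Phi_slice)
    then show "Y \<in> Phi D H ` marked_slice D H" using u unfolding marked_slice_def by blast
  qed
qed

lemma Evec_sum_eq_iff: "(\<Sum>l\<in>UNIV. s l *\<^sub>R Evec D H l) = (\<Sum>l\<in>UNIV. t l *\<^sub>R Evec D H l) \<longleftrightarrow> (\<forall>l. s l = t l)"
proof
  assume eq: "(\<Sum>l\<in>UNIV. s l *\<^sub>R Evec D H l) = (\<Sum>l\<in>UNIV. t l *\<^sub>R Evec D H l)"
  show "\<forall>l. s l = t l" using arg_cong[OF eq, of "radial _"] unfolding radial_sum by blast
qed simp

lemma Evec_inj: "inj (Evec D H)"
proof (rule injI)
  fix k l assume "Evec D H k = Evec D H l"
  then have "radial l (Evec D H k) = radial l (Evec D H l)" by simp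
  then show "k = l" by (simp split: if_splits)
qed

lemma simplicial_C: "simplicial_cone (C_cone D H)"
  unfolding simplicial_cone_def
proof (intro exI[of _ "range (Evec D H)"] conjI)
  have re: "(\<Sum>v\<in>range (Evec D H). c v *\<^sub>R v) = (\<Sum>l\<in>UNIV. c (Evec D H l) *\<^sub>R Evec D H l)" for c
    using Evec_inj by (simp add: sum.reindex)
  show "independent (range (Evec D H))"
  proof -
    have "\<forall>v\<in>range (Evec D H). c v = 0" if "(\<Sum>v\<in>range (Evec D H). c v *\<^sub>R v) = 0" for c
      using that Evec_sum_eq_iff[of "\<lambda>l. c (Evec D H l)" "\<lambda>l. 0"] unfolding re by simp
    then show ?thesis by (subst dependent_finite) (simp, blast)
  qed
  show "C_cone D H = {\<Sum>v\<in>range (Evec D H). t v *\<^sub>R v |t. \<forall>v\<in>range (Evec D H). 0 \<le> t v}"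
    unfolding re C_cone_def
  proof safe
    fix t :: "'m \<Rightarrow> real" assume "\<forall>l. 0 \<le> t l"
    then show "\<exists>s. (\<Sum>l\<in>UNIV. t l *\<^sub>R Evec D H l) = (\<Sum>l\<in>UNIV. s (Evec D H l) *\<^sub>R Evec D H l) \<and> (\<forall>v\<in>range (Evec D H). 0 \<le> s v)"
      using Evec_inj by (intro exI[of _ "\<lambda>v. t (inv (Evec D H) v)"]) auto
  qed auto
qed simp

lemma radial_fibre_eq:
  assumes t: "\<forall>l. t l \<ge> 0"
  shows "radial_fibre D H (\<Sum>l\<in>UNIV. t l *\<^sub>R Evec D H l) =
    slice H ` Pi UNIV (\<lambda>l. if t l > 0 then plane D l \<inter> sphere 0 (sqrt (t l)) else {0})"
proof -
  have "(u \<in> Pi UNIV (plane D) \<and> (\<forall>l. (norm (u l))\<^sup>2 = t l)) \<longleftrightarrow>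
     u \<in> Pi UNIV (\<lambda>l. if t l > 0 then plane D l \<inter> sphere 0 (sqrt (t l)) else {0})" for u
  proof -
    have "u l \<in> plane D l \<and> (norm (u l))\<^sup>2 = t l \<longleftrightarrow> u l \<in> (if t l > 0 then plane D l \<inter> sphere 0 (sqrt (t l)) else {0})" for l
    proof (cases "t l > 0")
      case True
      have "(norm (u l))\<^sup>2 = t l \<longleftrightarrow> norm (u l) = sqrt (t l)"
        using t real_sqrt_unique[of "norm (u l)" "t l"] by auto
      then show ?thesis using True by auto
    next
      case False
      then have "t l = 0" using t by (metis order_less_le)
      then show ?thesis using subspace_0[OF subspace_plane] by auto
    qed
    then show ?thesis unfolding Pi_iff by blast
  qed
  then have "slice H ` Pi UNIV (\<lambda>l. if t l > 0 then plane D l \<inter> sphere 0 (sqrt (t l)) else {0})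
      = slice H ` {u \<in> Pi UNIV (plane D). \<forall>l. (norm (u l))\<^sup>2 = t l}" by blast
  also have "\<dots> = radial_fibre D H (\<Sum>l\<in>UNIV. t l *\<^sub>R Evec D H l)"
    unfolding radial_fibre_def marked_slice_def by (auto simp: Phi_slice Evec_sum_eq_iff)
  finally show ?thesis by simp
qed

end

section \<open>The torus action\<close>

context rotational
begin

lemma omega_eq: "omega D v x = (\<Sum>l\<in>UNIV. (v \<bullet> f l) * (x \<bullet> e l) - (v \<bullet> e l) * (x \<bullet> f l))"
  unfolding omega_def proj_eq qturn_eq[OF plane_combination]
  by (intro sum.cong refl) (simp add: inner_add_left inner_add_right inner_diff_right)

lemma symplectic_omega: "symplectic (omega D)"
  unfolding symplectic_def
proof (intro conjI allI impI)
  show "bilinear (omega D)"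
    unfolding bilinear_def linear_iff omega_eq
    by (auto simp: inner_add_left sum.distrib[symmetric] sum_distrib_left algebra_simps intro!: sum.cong)
  show "omega D v v = 0" for v unfolding omega_eq by (simp add: mult.commute)
  fix v assume v: "\<forall>x. omega D v x = 0"
  have "omega D v (e l) = (\<Sum>k\<in>UNIV. if k = l then v \<bullet> f l else 0)"
    "omega D v (f l) = (\<Sum>k\<in>UNIV. if k = l then - (v \<bullet> e l) else 0)" for l
    unfolding omega_eq by (intro sum.cong refl; simp)+
  then have "v \<bullet> f l = 0" "v \<bullet> e l = 0" for l
    using spec[OF v, of "e l"] spec[OF v, of "f l"] by simp_all
  then show "v = 0" by (subst frame_expand) simp
qed

lemma generator_eq: "generator D l v = (v \<bullet> e l) *\<^sub>R f l - (v \<bullet> f l) *\<^sub>R e l"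
  unfolding generator_def proj_eq qturn_eq[OF plane_combination] by (simp add: inner_add_left)

lemma torus_generator:
  "((\<lambda>s. torus_act D (s *\<^sub>R axis l 1) v) has_vector_derivative generator D l v) (at 0)"
proof -
  define d where "d k = (if k = l then 1 else (0::real))" for k
  have ax: "(s *\<^sub>R axis l 1 :: (real, 'm) vec) $ k = s * d k" for s k
    by (simp add: axis_def d_def)
  have "((\<lambda>s. \<Sum>k\<in>UNIV. cos (s * d k) *\<^sub>R proj D k v + sin (s * d k) *\<^sub>R generator D k v)
      has_vector_derivative (\<Sum>k\<in>UNIV. (- sin (0 * d k) * d k) *\<^sub>R proj D k v + (cos (0 * d k) * d k) *\<^sub>R generator D k v)) (at 0)"
    by (auto intro!: derivative_eq_intros has_vector_derivative_sum simp: algebra_simps)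
  moreover have "d k *\<^sub>R generator D k v = (if k = l then generator D l v else 0)" for k by (simp add: d_def)
  ultimately show ?thesis unfolding torus_act_def generator_def[symmetric] ax by simp
qed

lemma eps_dual_apply [simp]: "eps_dual l x = x $ l"
  unfolding eps_dual_def by (simp add: bounded_linear_Blinfun_apply bounded_linear_vec_nth)

lemma mu_torus_axis: "mu_torus D v (axis l 1) = (1 / 2) * ((v \<bullet> e l)\<^sup>2 + (v \<bullet> f l)\<^sup>2)"
  unfolding mu_torus_def
  by (simp add: blinfun.scaleR_left blinfun.sum_left axis_def norm_proj if_distrib cong: if_cong)

lemma moment_map: "is_moment_map D (mu_torus D)"
  unfolding is_moment_map_def mu_torus_axis
proof (intro allI)
  fix l v
  have om: "omega D (generator D l v) x = (v \<bullet> e l) * (x \<bullet> e l) + (v \<bullet> f l) * (x \<bullet> f l)" for x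
  proof -
    have "omega D (generator D l v) x = (\<Sum>k\<in>UNIV. if k = l then (v \<bullet> e l) * (x \<bullet> e l) + (v \<bullet> f l) * (x \<bullet> f l) else 0)"
      unfolding omega_eq generator_eq by (intro sum.cong refl) (simp add: inner_diff_left)
    then show ?thesis by simp
  qed
  show "((\<lambda>x. 1 / 2 * ((x \<bullet> e l)\<^sup>2 + (x \<bullet> f l)\<^sup>2)) has_derivative omega D (generator D l v)) (at v)"
    unfolding om[abs_def] by (auto intro!: derivative_eq_intros simp: algebra_simps)
qed

end

context marked
begin

text \<open>
  The map \<open>\<iota>\<close> reads off the coordinates of a dual vector; its injectivity is the independence of the \<open>E\<^sub>l\<close>.
\<close>

lemma toric_factorization:
  "\<exists>\<iota>. linear \<iota> \<and> inj \<iota> \<and> (\<forall>l. \<iota> (eps_dual l) = 2 *\<^sub>R Evec D H l) \<and>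
     (\<forall>v. Phi D H (slice H (\<lambda>l. proj D l v)) = \<iota> (mu_torus D v))"
proof (intro exI[of _ "\<lambda>\<phi> :: ((real, 'm) vec) dual. \<Sum>l\<in>UNIV. \<phi> (axis l 1) *\<^sub>R (2 *\<^sub>R Evec D H l)"] conjI allI)
  let ?i = "\<lambda>\<phi> :: ((real, 'm) vec) dual. \<Sum>l\<in>UNIV. \<phi> (axis l 1) *\<^sub>R (2 *\<^sub>R Evec D H l)"
  have i: "?i \<phi> = (\<Sum>l\<in>UNIV. (2 * \<phi> (axis l 1)) *\<^sub>R Evec D H l)" for \<phi> by (simp add: mult.commute)
  show lin: "linear ?i"
    by (intro linearI) (simp_all add: blinfun.add_left blinfun.scaleR_left scaleR_left_distrib sum.distrib scaleR_sum_right mult_ac)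
  show "inj ?i"
  proof (rule injI)
    fix \<phi> \<psi> assume "?i \<phi> = ?i \<psi>"
    then have eq: "\<phi> (axis l 1) = \<psi> (axis l 1)" for l unfolding i Evec_sum_eq_iff by simp
    show "\<phi> = \<psi>"
    proof (rule blinfun_eqI)
      fix x :: "(real, 'm) vec"
      have "x = (\<Sum>l\<in>UNIV. (x $ l) *\<^sub>R axis l 1)" by (simp add: vec_eq_iff axis_def if_distrib cong: if_cong)
      then show "\<phi> x = \<psi> x" using eq by (metis (no_types, lifting) blinfun.scaleR_right blinfun.sum_right sum.cong)
    qed
  qed
  show "?i (eps_dual l) = 2 *\<^sub>R Evec D H l" for l
  proof -
    have "eps_dual l (axis k 1) *\<^sub>R (2 *\<^sub>R Evec D H k) = (if k = l then 2 *\<^sub>R Evec D H l else 0)" for k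
      by (simp add: axis_def)
    then show ?thesis by simp
  qed
  show "Phi D H (slice H (\<lambda>l. proj D l v)) = ?i (mu_torus D v)" for v
    unfolding i mu_torus_axis by (subst Phi_slice) (auto simp: proj_in norm_proj intro!: sum.cong)
qed

end

section \<open>Induced norms\<close>

lemma bounded_bilinear_add':
  assumes "bounded_bilinear f" "bounded_bilinear g"
  shows "bounded_bilinear (\<lambda>x y. f x y + g x y)"
proof -
  have "bounded_bilinear (\<lambda>x y. 0)" by unfold_locales (auto intro: exI[of _ 0])
  from bounded_bilinear_diff'[OF assms(1) bounded_bilinear_diff'[OF this assms(2)]]
  show ?thesis by simp
qed

text \<open>
  With respect to the standard basis \<open>ip a x = \<langle>A a, x\<rangle>\<close> for an invertible linear map \<open>A\<close>, and the Riesz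
  vector of \<open>\<zeta>\<close> is the preimage under \<open>A\<close> of the coordinate vector of \<open>\<zeta>\<close>. This makes the induced form
  on the Lie algebra bounded bilinear, as the existence of the norms on exterior powers requires.
\<close>

lemma riesz_bounded_linear:
  fixes ip :: "'b::euclidean_space \<Rightarrow> 'b \<Rightarrow> real"
  assumes ip: "pos_def_inner ip"
  shows "bounded_linear (riesz ip)"
proof -
  have bil: "bounded_bilinear ip" and pos: "\<And>x. x \<noteq> 0 \<Longrightarrow> ip x x > 0"
    using ip unfolding pos_def_inner_def by (simp_all add: bilinear_conv_bounded_bilinear)
  interpret bounded_bilinear ip by (rule bil)
  define A where "A a = (\<Sum>k\<in>Basis. ip a k *\<^sub>R k)" for a
  have A_inner: "A a \<bullet> x = ip a x" for a x
  proof -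
    have "ip a x = ip a (\<Sum>k\<in>Basis. (x \<bullet> k) *\<^sub>R k)" by (simp add: euclidean_representation)
    also have "\<dots> = A a \<bullet> x" unfolding A_def by (simp add: sum_right scaleR_right inner_sum_left inner_commute[of x] mult.commute)
    finally show ?thesis by simp
  qed
  have lin: "linear A"
    by (intro linearI) (simp_all add: A_def add_left scaleR_left scaleR_left_distrib sum.distrib scaleR_sum_right)
  have "inj A"
  proof (subst linear_injective_0[OF lin], intro allI impI)
    fix a assume "A a = 0"
    then have "ip a a = 0" using A_inner[of a a] by simp
    then show "a = 0" using pos[of a] by force
  qed
  then obtain B where B: "linear B" "\<And>x. B (A x) = x" "\<And>y. A (B y) = y"
    using linear_injective_isomorphism[OF lin] by blast
  have r: "riesz ip \<zeta> = B (\<Sum>k\<in>Basis. \<zeta> k *\<^sub>R k)" for \<zeta>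
    unfolding riesz_def
  proof (rule the_equality)
    show "\<forall>x. \<zeta> x = ip (B (\<Sum>k\<in>Basis. \<zeta> k *\<^sub>R k)) x"
    proof
      fix x
      have "\<zeta> x = \<zeta> (\<Sum>k\<in>Basis. (x \<bullet> k) *\<^sub>R k)" by (simp add: euclidean_representation)
      also have "\<dots> = (\<Sum>k\<in>Basis. \<zeta> k *\<^sub>R k) \<bullet> x"
        by (simp add: blinfun.sum_right blinfun.scaleR_right inner_sum_left inner_commute[of x] mult.commute)
      finally show "\<zeta> x = ip (B (\<Sum>k\<in>Basis. \<zeta> k *\<^sub>R k)) x" unfolding A_inner[symmetric] B(3) .
    qed
    fix a assume "\<forall>x. \<zeta> x = ip a x"
    then have "A a = (\<Sum>k\<in>Basis. \<zeta> k *\<^sub>R k)" unfolding A_def by simp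
    then show "a = B (\<Sum>k\<in>Basis. \<zeta> k *\<^sub>R k)" using B(2)[of a] by simp
  qed
  have "bounded_linear B" using B(1) by (simp add: linear_conv_bounded_linear)
  then show ?thesis
    unfolding r[abs_def]
    by (rule bounded_linear_compose)
       (intro bounded_linear_sum bounded_linear_compose[OF bounded_linear_scaleR_left] blinfun.bounded_linear_left)
qed

lemma lie_inner_eq:
  "lie_inner ip x y = ip (fst x) (fst y) + fst (snd x) \<bullet> fst (snd y) + dual_inner ip (snd (snd x)) (snd (snd y))"
  unfolding lie_inner_def by (simp add: case_prod_unfold)

lemma lie_inner_bounded_bilinear:
  assumes ip: "pos_def_inner ip"
  shows "bounded_bilinear (lie_inner ip)"
proof -
  have bil: "bounded_bilinear ip"
    using ip unfolding pos_def_inner_def by (simp add: bilinear_conv_bounded_bilinear)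
  have fs: "bounded_linear (\<lambda>x. fst (snd x))" "bounded_linear (\<lambda>x. snd (snd x))"
    by (intro bounded_linear_fst_comp bounded_linear_snd_comp bounded_linear_snd)+
  note rz = bounded_linear_compose[OF riesz_bounded_linear[OF ip] fs(2)]
  note parts = bounded_bilinear.comp[OF bil bounded_linear_fst bounded_linear_fst]
    bounded_bilinear.comp[OF bounded_bilinear_inner fs(1) fs(1)] bounded_bilinear.comp[OF bil rz rz]
  show ?thesis
    unfolding lie_inner_eq[abs_def] dual_inner_def
    by (rule bounded_bilinear_add'[OF bounded_bilinear_add'[OF parts(1,2)] parts(3)])
qed

lemma lie_inner_values:
  assumes ip: "pos_def_inner ip"
  shows "lie_inner ip x y = lie_inner ip y x"
    and "lie_inner ip (inB b) (inB b') = ip b b'" "lie_inner ip (inV u) (inV v) = u \<bullet> v"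
    and "lie_inner ip (inB b) (inV v) = 0" "lie_inner ip (inV v) (inB b) = 0"
proof -
  have bil: "bounded_bilinear ip" and sym: "\<And>x y. ip x y = ip y x"
    using ip unfolding pos_def_inner_def by (simp_all add: bilinear_conv_bounded_bilinear)
  interpret bounded_bilinear ip by (rule bil)
  have "dual_inner ip 0 0 = 0"
    unfolding dual_inner_def using linear_simps(4)[OF riesz_bounded_linear[OF ip]] by (simp add: linear_simps[OF riesz_bounded_linear[OF ip]] zero_left)
  then show "lie_inner ip (inB b) (inB b') = ip b b'" "lie_inner ip (inV u) (inV v) = u \<bullet> v"
    "lie_inner ip (inB b) (inV v) = 0" "lie_inner ip (inV v) (inB b) = 0"
    by (simp_all add: lie_inner_eq zero_left zero_right)
  show "lie_inner ip x y = lie_inner ip y x"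
    unfolding lie_inner_eq dual_inner_def using sym inner_commute by metis
qed

section \<open>The sharp radial estimate\<close>

text \<open>
  The weighted sum of the squared deviations of \<open>x\<close> from its mean \<open>N / A\<close> is \<open>Q - N\<^sup>2 / A\<close>. It is
  nonnegative, and zero exactly when all values equal the mean.
\<close>

lemma weighted_Cauchy_Schwarz:
  fixes a x :: "'m::finite \<Rightarrow> real"
  assumes a: "\<And>l. a l > 0"
  defines "A \<equiv> \<Sum>l\<in>UNIV. a l" and "N \<equiv> \<Sum>l\<in>UNIV. a l * x l" and "Q \<equiv> \<Sum>l\<in>UNIV. a l * (x l)\<^sup>2"
  assumes N: "N \<ge> 0"
  shows "A > 0" "A powr (- 1 / 2) * N \<le> sqrt Q"
    and "sqrt Q = A powr (- 1 / 2) * N \<longleftrightarrow> (\<forall>l. x l = N / A)"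
proof -
  show A: "A > 0" unfolding A_def using a by (intro sum_pos) auto
  have pw: "A powr (- 1 / 2) = 1 / sqrt A"
  proof -
    have "A powr (- 1 / 2) = inverse (A powr (1 / 2))" by (simp flip: powr_minus)
    then show ?thesis using A by (simp add: powr_half_sqrt inverse_eq_divide)
  qed
  have var: "(\<Sum>l\<in>UNIV. a l * (x l - N / A)\<^sup>2) = Q - N\<^sup>2 / A"
  proof -
    have "(\<Sum>l\<in>UNIV. a l * (x l - N / A)\<^sup>2) = (\<Sum>l\<in>UNIV. a l * (x l)\<^sup>2 - 2 * (N / A) * (a l * x l) + (N / A)\<^sup>2 * a l)"
      by (intro sum.cong refl) (simp add: power2_eq_square algebra_simps)
    also have "\<dots> = Q - 2 * (N / A) * N + (N / A)\<^sup>2 * A"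
      unfolding sum.distrib sum_subtractf sum_distrib_left[symmetric] Q_def[symmetric] N_def[symmetric] A_def[symmetric] ..
    also have "\<dots> = Q - N\<^sup>2 / A" using A by (simp add: power2_eq_square field_simps)
    finally show ?thesis .
  qed
  have nn: "a l * (x l - N / A)\<^sup>2 \<ge> 0" for l using a[of l] by simp
  have "(\<Sum>l\<in>UNIV. a l * (x l - N / A)\<^sup>2) \<ge> 0" using nn by (intro sum_nonneg)
  then have le: "N\<^sup>2 / A \<le> Q" unfolding var by simp
  have s: "A powr (- 1 / 2) * N = sqrt (N\<^sup>2 / A)" unfolding pw using N by (simp add: real_sqrt_divide)
  show "A powr (- 1 / 2) * N \<le> sqrt Q" unfolding s using le by simp
  have "sqrt Q = A powr (- 1 / 2) * N \<longleftrightarrow> (\<Sum>l\<in>UNIV. a l * (x l - N / A)\<^sup>2) = 0"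
    unfolding s var by simp
  also have "\<dots> \<longleftrightarrow> (\<forall>l. a l * (x l - N / A)\<^sup>2 = 0)" using nn by (subst sum_nonneg_eq_0_iff) auto
  also have "\<dots> \<longleftrightarrow> (\<forall>l. x l = N / A)" using a by (simp add: less_imp_neq[symmetric])
  finally show "sqrt Q = A powr (- 1 / 2) * N \<longleftrightarrow> (\<forall>l. x l = N / A)" .
qed

context marked
begin

lemma ext2_norm_slice:
  assumes ip: "pos_def_inner ip" and u: "u \<in> Pi UNIV (plane D)"
  shows "(ext2_norm (lie_inner ip) (slice H u))\<^sup>2 = (\<Sum>l\<in>UNIV. ip (H l) (H l) * (norm (u l))\<^sup>2)"
proof -
  let ?w = "\<lambda>l. wedge2 (inB (H l)) (inV (u l))"
  have pos: "ip b b \<ge> 0" for b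
    using ip unfolding pos_def_inner_def by (metis bilinear_lzero less_eq_real_def)
  obtain q :: "('b, 'v) lie tensor2 \<Rightarrow> ('b, 'v) lie tensor2 \<Rightarrow> real" where q: "is_ext2_inner (lie_inner ip) q"
    using ext2_inner_ex[OF lie_inner_bounded_bilinear[OF ip] lie_inner_values(1)[OF ip]] by blast
  have qw: "q (?w k) (?w l) = (if l = k then ip (H k) (H k) * (norm (u k))\<^sup>2 else 0)" for k l
  proof -
    have "q (?w k) (?w l) = ip (H k) (H l) * (u k \<bullet> u l)"
      using q unfolding is_ext2_inner_def by (simp add: lie_inner_values(2-5)[OF ip])
    moreover have "u k \<bullet> u l = 0" if "l \<noteq> k" using plane_orthogonal[of "u k" k "u l" l] u that by blast
    ultimately show ?thesis by (simp add: power2_norm_eq_inner)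
  qed
  have "q (slice H u) (slice H u) = (\<Sum>k\<in>UNIV. \<Sum>l\<in>UNIV. q (?w k) (?w l))"
    unfolding slice_def using q
    by (intro bilinear_on_sum[OF _ subspace_Ext2 subspace_Ext2]) (auto simp: is_ext2_inner_def wedge2_Ext2)
  also have "\<dots> = (\<Sum>l\<in>UNIV. ip (H l) (H l) * (norm (u l))\<^sup>2)" unfolding qw by simp
  finally have "ext2_norm (lie_inner ip) (slice H u) = sqrt (\<Sum>l\<in>UNIV. ip (H l) (H l) * (norm (u l))\<^sup>2)"
    unfolding ext2_norm_eq[OF q slice_Ext2] by simp
  then show ?thesis using pos by (simp add: sum_nonneg)
qed

lemma ext3_norm_D:
  assumes ip: "pos_def_inner ip"
  shows "ext3_norm (lie_inner ip) (\<Sum>l\<in>UNIV. t l *\<^sub>R Evec D H l) = 2 * sqrt (\<Sum>l\<in>UNIV. ip (H l) (H l) * (w l * t l)\<^sup>2)"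
proof -
  let ?W = "\<lambda>l. wedge3 (inB (H l)) (inV (e l)) (inV (f l))"
  obtain q :: "('b, 'v) lie tensor3 \<Rightarrow> ('b, 'v) lie tensor3 \<Rightarrow> real" where q: "is_ext3_inner (lie_inner ip) q"
    using ext3_inner_ex[OF lie_inner_bounded_bilinear[OF ip] lie_inner_values(1)[OF ip]] by blast
  have sc: "q (c *\<^sub>R ?W k) (d *\<^sub>R ?W l) = c * d * q (?W k) (?W l)" for c d k l
  proof -
    have "q (a *\<^sub>R x) y = a * q x y" "q x (a *\<^sub>R y) = a * q x y" if "x \<in> Ext3" "y \<in> Ext3" for a x y
      using q that unfolding is_ext3_inner_def bilinear_on_def real_scaleR_def by blast+
    then show ?thesis by (simp add: wedge3_Ext3 subspace_scale[OF subspace_Ext3 wedge3_Ext3])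
  qed
  have qW: "q (?W k) (?W l) = (if l = k then ip (H k) (H k) else 0)" for k l
  proof -
    have "q (?W k) (?W l) = ip (H k) (H l) * ((e k \<bullet> e l) * (f k \<bullet> f l) - (e k \<bullet> f l) * (f k \<bullet> e l))"
      using q unfolding is_ext3_inner_def by (simp add: lie_inner_values(2-5)[OF ip] del: frame_orthonormal)
    then show ?thesis by simp
  qed
  have E: "t l *\<^sub>R Evec D H l = (2 * w l * t l) *\<^sub>R ?W l" for l
    unfolding Evec_def by (simp add: mult.commute)
  have qE: "q (t k *\<^sub>R Evec D H k) (t l *\<^sub>R Evec D H l) = (if l = k then 4 * (ip (H k) (H k) * (w k * t k)\<^sup>2) else 0)" for k l
    unfolding E sc qW by (simp add: power2_eq_square)
  have mem: "t l *\<^sub>R Evec D H l \<in> Ext3" for l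
    unfolding E by (intro subspace_scale subspace_Ext3 wedge3_Ext3)
  let ?s = "\<Sum>l\<in>UNIV. t l *\<^sub>R Evec D H l"
  have "q ?s ?s = (\<Sum>k\<in>UNIV. \<Sum>l\<in>UNIV. q (t k *\<^sub>R Evec D H k) (t l *\<^sub>R Evec D H l))"
    using q mem by (intro bilinear_on_sum[OF _ subspace_Ext3 subspace_Ext3]) (auto simp: is_ext3_inner_def)
  also have "\<dots> = 4 * (\<Sum>l\<in>UNIV. ip (H l) (H l) * (w l * t l)\<^sup>2)" unfolding qE by (simp add: sum_distrib_left)
  finally have "q ?s ?s = 4 * (\<Sum>l\<in>UNIV. ip (H l) (H l) * (w l * t l)\<^sup>2)" .
  then show ?thesis
    by (subst ext3_norm_eq[OF q subspace_sum[OF subspace_Ext3 mem]]) (simp add: real_sqrt_mult)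
qed

lemma coefficient_pos:
  assumes "pos_def_inner ip"
  shows "ip (H l) (H l) / (w l)\<^sup>2 > 0"
proof -
  have "H l \<noteq> 0" using w_pos[of l] by (auto simp: blinfun.zero_right)
  then show ?thesis using assms w_pos[of l] unfolding pos_def_inner_def by simp
qed

text \<open>
  This is the inequality above for the weights \<open>a\<^sub>l = \<parallel>h\<^sub>l\<parallel>\<^sup>2 / \<lambda>\<^sub>l(h\<^sub>l)\<^sup>2\<close> and the values
  \<open>x\<^sub>l = \<lambda>\<^sub>l(h\<^sub>l)\<^sup>2 \<parallel>u\<^sub>l\<parallel>\<^sup>2\<close>, chosen so that \<open>\<Sum> a x = \<parallel>r\<parallel>\<^sup>2\<close> and \<open>4 \<Sum> a x\<^sup>2\<close> is the squared norm of the
  radial part.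
\<close>

lemma radial_estimate:
  assumes ip: "pos_def_inner ip" and u: "u \<in> Pi UNIV (plane D)"
  shows "kappa0 D H ip * (ext2_norm (lie_inner ip) (slice H u))\<^sup>2 \<le> ext3_norm (lie_inner ip) (Phi D H (slice H u))" (is ?le)
    and "ext3_norm (lie_inner ip) (Phi D H (slice H u)) = kappa0 D H ip * (ext2_norm (lie_inner ip) (slice H u))\<^sup>2
      \<longleftrightarrow> (\<forall>l. (norm (u l))\<^sup>2 = ((ext2_norm (lie_inner ip) (slice H u))\<^sup>2 / (w l)\<^sup>2)
            / (\<Sum>j\<in>UNIV. ip (H j) (H j) / (w j)\<^sup>2))" (is ?eq)
proof -
  define a where "a l = ip (H l) (H l) / (w l)\<^sup>2" for l
  define x where "x l = (w l)\<^sup>2 * (norm (u l))\<^sup>2" for l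
  have a: "a l > 0" for l unfolding a_def by (rule coefficient_pos[OF ip])
  have w0: "w l \<noteq> 0" for l using w_pos[of l] by simp
  have ax: "a l * x l = ip (H l) (H l) * (norm (u l))\<^sup>2" "a l * (x l)\<^sup>2 = ip (H l) (H l) * (w l * (norm (u l))\<^sup>2)\<^sup>2" for l
    using w0[of l] by (simp_all add: a_def x_def power2_eq_square)
  have N: "(ext2_norm (lie_inner ip) (slice H u))\<^sup>2 = (\<Sum>l\<in>UNIV. a l * x l)"
    unfolding ax ext2_norm_slice[OF ip u] ..
  have Q: "ext3_norm (lie_inner ip) (Phi D H (slice H u)) = 2 * sqrt (\<Sum>l\<in>UNIV. a l * (x l)\<^sup>2)"
    unfolding ax Phi_slice[OF u] ext3_norm_D[OF ip] ..
  have N0: "(\<Sum>l\<in>UNIV. a l * x l) \<ge> 0" unfolding N[symmetric] by simp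
  note cs = weighted_Cauchy_Schwarz[OF a N0]
  have k: "kappa0 D H ip = 2 * (\<Sum>l\<in>UNIV. a l) powr (- 1 / 2)" unfolding kappa0_def a_def ..
  show ?le unfolding k N Q using cs(2) by simp
  have "x l = (\<Sum>l\<in>UNIV. a l * x l) / (\<Sum>l\<in>UNIV. a l) \<longleftrightarrow>
      (norm (u l))\<^sup>2 = ((\<Sum>l\<in>UNIV. a l * x l) / (w l)\<^sup>2) / (\<Sum>l\<in>UNIV. a l)" for l
    using w0[of l] cs(1) unfolding x_def by (simp add: field_simps)
  then show ?eq unfolding k N Q a_def[symmetric] using cs(3) by simp
qed

text \<open>
  Equality holds at \<open>\<parallel>u\<^sub>l\<parallel>\<^sup>2 = 1 / \<lambda>\<^sub>l(h\<^sub>l)\<^sup>2\<close>, where all the values \<open>x\<^sub>l\<close> above are \<open>1\<close>.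
\<close>

lemma radial_constant_optimal:
  assumes ip: "pos_def_inner ip"
    and \<kappa>: "\<forall>r\<in>marked_slice D H. \<kappa> * (ext2_norm (lie_inner ip) r)\<^sup>2 \<le> ext3_norm (lie_inner ip) (Phi D H r)"
  shows "\<kappa> \<le> kappa0 D H ip"
proof -
  obtain u where u: "u \<in> Pi UNIV (plane D)" "\<And>l. (norm (u l))\<^sup>2 = 1 / (w l)\<^sup>2"
    by (rule family_with_norms[of "\<lambda>l. 1 / (w l)\<^sup>2"]) auto
  let ?N = "\<Sum>l\<in>UNIV. ip (H l) (H l) / (w l)\<^sup>2"
  have N: "(ext2_norm (lie_inner ip) (slice H u))\<^sup>2 = ?N"
    unfolding ext2_norm_slice[OF ip u(1)] u(2) by simp
  have N0: "?N > 0" by (intro sum_pos coefficient_pos[OF ip]) auto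
  have "ext3_norm (lie_inner ip) (Phi D H (slice H u)) = kappa0 D H ip * ?N"
    unfolding N[symmetric] by (subst radial_estimate(2)[OF ip u(1)]) (use N N0 u(2) in simp)
  moreover have "\<kappa> * ?N \<le> ext3_norm (lie_inner ip) (Phi D H (slice H u))"
    using \<kappa> u(1) unfolding N[symmetric] marked_slice_def by blast
  ultimately show ?thesis using N0 by simp
qed

end

section \<open>Properness\<close>

text \<open>
  If the norm of \<open>v\<close> is a continuous function of \<open>g v\<close>, then a sequence with convergent images is bounded,
  and a subsequence converges.
\<close>

lemma closed_image_of_norm_controlled:
  fixes g :: "'a::euclidean_space \<Rightarrow> 'b::real_normed_vector"
  assumes g: "continuous_on UNIV g" and \<tau>: "continuous_on UNIV \<tau>" and n: "\<And>v. (norm v)\<^sup>2 = \<tau> (g v)"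
    and C: "closed C"
  shows "closed (g ` C)"
proof (unfold closed_sequential_limits, intro allI impI, elim conjE)
  fix y l assume y: "\<forall>n. y n \<in> g ` C" and l: "y \<longlonglongrightarrow> l"
  then have "\<forall>n. \<exists>v. v \<in> C \<and> y n = g v" by blast
  then obtain v where "\<forall>n. v n \<in> C \<and> y n = g (v n)" by (rule choice[THEN exE])
  then have v: "v n \<in> C" "y n = g (v n)" for n by simp_all
  have "(\<lambda>n. \<tau> (y n)) \<longlonglongrightarrow> \<tau> l"
    using \<tau> l by (simp add: continuous_on_eq_continuous_at isCont_tendsto_compose)
  then have "(\<lambda>k. (norm (v k))\<^sup>2) \<longlonglongrightarrow> \<tau> l" unfolding n v(2) .
  then have "Bseq (\<lambda>k. (norm (v k))\<^sup>2)" by (intro convergent_imp_Bseq convergentI)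
  then obtain M where "\<forall>k. norm ((norm (v k))\<^sup>2) \<le> M" by (rule BseqE)
  then have M: "(norm (v k))\<^sup>2 \<le> M" for k by simp
  have "norm (v k) \<le> sqrt M" for k using M[of k] real_le_rsqrt by blast
  then have "bounded (range v)" by (auto intro!: boundedI)
  then obtain x r where r: "strict_mono r" "(v \<circ> r) \<longlonglongrightarrow> x"
    using bounded_imp_convergent_subsequence by blast
  have "x \<in> C" using C v(1) r(2) closed_sequentially[of C "v \<circ> r" x] by simp
  have "isCont g x" using g by (simp add: continuous_on_eq_continuous_at)
  then have "(\<lambda>k. g ((v \<circ> r) k)) \<longlonglongrightarrow> g x" using r(2) by (rule isCont_tendsto_compose)
  moreover have "(\<lambda>k. g ((v \<circ> r) k)) \<longlonglongrightarrow> l"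
    using LIMSEQ_subseq_LIMSEQ[OF l r(1)] by (simp add: v(2) o_def)
  ultimately have "l = g x" using LIMSEQ_unique by blast
  then show "l \<in> g ` C" using \<open>x \<in> C\<close> by blast
qed

lemma compact_fibre_of_norm_controlled:
  fixes g :: "'a::euclidean_space \<Rightarrow> 'b::real_normed_vector"
  assumes g: "continuous_on UNIV g" and n: "\<And>v. (norm v)\<^sup>2 = \<tau> (g v)"
  shows "compact {v. g v = y}"
  unfolding compact_eq_bounded_closed
proof (rule conjI)
  have "norm v \<le> sqrt (\<tau> y)" if "g v = y" for v
    using n[of v] that real_le_rsqrt[of "norm v" "\<tau> y"] by simp
  then show "bounded {v. g v = y}" by (intro boundedI[where B = "sqrt (\<tau> y)"]) auto
  show "closed {v. g v = y}" by (rule closed_Collect_eq[OF g continuous_on_const])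
qed

context marked
begin

text \<open>
  The slice parametrised by \<open>V\<close> itself. Compactness arguments take place in \<open>V\<close>, a Euclidean space,
  rather than in the ambient space of tensors.
\<close>

definition slice_of :: "'v \<Rightarrow> ('b, 'v) lie tensor2" where
  "slice_of v = slice H (\<lambda>l. proj D l v)"

lemma proj_family: "(\<lambda>l. proj D l v) \<in> Pi UNIV (plane D)"
  using proj_in by blast

lemma proj_sum:
  assumes "u \<in> Pi UNIV (plane D)"
  shows "proj D l (\<Sum>k\<in>UNIV. u k) = u l"
proof -
  have P: "u k \<in> plane D k" for k using assms by blast
  have "(\<Sum>k\<in>UNIV. u k) \<bullet> e l = (\<Sum>k\<in>UNIV. if k = l then u l \<bullet> e l else 0)"
    "(\<Sum>k\<in>UNIV. u k) \<bullet> f l = (\<Sum>k\<in>UNIV. if k = l then u l \<bullet> f l else 0)"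
    unfolding inner_sum_left by (intro sum.cong refl; use plane_other[OF P] in auto)+
  then show ?thesis unfolding proj_eq by (simp add: plane_expand[OF P[of l], symmetric])
qed

lemma marked_slice_eq: "marked_slice D H = range slice_of"
proof
  show "range slice_of \<subseteq> marked_slice D H"
    unfolding marked_slice_def slice_of_def using proj_family by blast
  show "marked_slice D H \<subseteq> range slice_of"
  proof
    fix r assume "r \<in> marked_slice D H"
    then obtain u where u: "u \<in> Pi UNIV (plane D)" "r = slice H u" unfolding marked_slice_def by blast
    then have "r = slice_of (\<Sum>k\<in>UNIV. u k)" unfolding slice_of_def by (simp add: proj_sum)
    then show "r \<in> range slice_of" by blast
  qed
qed

lemma proj_linear: "proj D l (u + v) = proj D l u + proj D l v" "proj D l (c *\<^sub>R v) = c *\<^sub>R proj D l v"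
  unfolding proj_eq by (simp_all add: inner_add_left algebra_simps)

lemma slice_of_continuous: "continuous_on S slice_of"
proof -
  have "linear slice_of"
  proof (rule linearI)
    show "slice_of (u + v) = slice_of u + slice_of v" for u v
      unfolding slice_of_def slice_def proj_linear inV_linear wedge2_linear sum.distrib ..
    show "slice_of (c *\<^sub>R v) = c *\<^sub>R slice_of v" for c v
      unfolding slice_of_def slice_def proj_linear inV_linear wedge2_linear scaleR_sum_right ..
  qed
  then show ?thesis
    by (simp add: linear_conv_bounded_linear linear_continuous_on)
qed

definition slice_inv :: "('b, 'v) lie tensor2 \<Rightarrow> 'v" where
  "slice_inv r = (\<Sum>l\<in>UNIV. slot l r)"

lemma slice_inv_slice_of: "slice_inv (slice_of v) = v"
  unfolding slice_inv_def slice_of_def slot_slice[OF proj_family] unfolding proj_eq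
  by (rule frame_expand[symmetric])

lemma slice_inv_continuous: "continuous_on S slice_inv"
proof -
  have ev: "bounded_linear (\<lambda>r :: ('b, 'v) lie tensor2. (r \<phi> \<psi> / c) *\<^sub>R p)" for \<phi> \<psi> c and p :: 'v
    by (rule bounded_linear_compose[OF bounded_linear_scaleR_left bounded_linear_compose[OF bounded_linear_divide
        bounded_linear_compose[OF blinfun.bounded_linear_left blinfun.bounded_linear_left]]])
  have "bounded_linear slice_inv"
    unfolding slice_inv_def[abs_def] slot_def by (intro bounded_linear_sum bounded_linear_add ev)
  then show ?thesis by (rule linear_continuous_on)
qed

definition square :: "'v \<Rightarrow> ('b, 'v) lie tensor3" where
  "square v = Sigma_map D (slice_of v)"

lemma square_eq: "square v = Phi D H (slice_of v) + mu D H (slice_of v)"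
  unfolding square_def Sigma_map_def slice_of_def by (rule schouten_decomposition[OF proj_family])

lemma Phi_slice_of: "Phi D H (slice_of v) = (\<Sum>l\<in>UNIV. (norm (proj D l v))\<^sup>2 *\<^sub>R Evec D H l)"
  unfolding slice_of_def by (rule Phi_slice[OF proj_family])

lemma mu_slice_of: "mu D H (slice_of v) = 2 *\<^sub>R (\<Sum>(i, j)\<in>{(i, j). i < j}. cross (\<lambda>l. proj D l v) i j)"
  unfolding slice_of_def by (rule mu_slice[OF proj_family])

lemma proj_continuous: "continuous_on S (proj D l)"
  unfolding proj_eq[abs_def] by (intro continuous_intros)

lemma generator_continuous: "continuous_on S (\<lambda>v. qturn D l (proj D l v))"
  unfolding generator_def[symmetric] generator_eq by (intro continuous_intros)

lemma Phi_slice_of_continuous: "continuous_on S (\<lambda>v. Phi D H (slice_of v))"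
  unfolding Phi_slice_of
  by (intro continuous_on_sum continuous_on_scaleR continuous_on_power continuous_on_norm proj_continuous continuous_on_const)

lemma wedge3_continuous:
  assumes "continuous_on S a" "continuous_on S c"
  shows "continuous_on S (\<lambda>v. wedge3 x (inV (a v)) (inV (c v)) :: ('b, 'v) lie tensor3)"
proof -
  have "bilinear (\<lambda>u v. wedge3 x (inV u) (inV v) :: ('b, 'v) lie tensor3)"
    unfolding bilinear_def by (intro conjI allI linearI) (simp_all only: inV_linear wedge3_linear)
  then show ?thesis
    unfolding bilinear_conv_bounded_bilinear by (rule bounded_bilinear.continuous_on[OF _ assms])
qed

lemma mu_slice_of_continuous: "continuous_on S (\<lambda>v. mu D H (slice_of v))"
proof -
  have "continuous_on S (\<lambda>v. cross (\<lambda>l. proj D l v) i j)" for i j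
    unfolding cross_def
    by (intro continuous_on_diff continuous_on_scaleR continuous_on_const wedge3_continuous proj_continuous generator_continuous)
  then show ?thesis
    unfolding mu_slice_of case_prod_unfold
    by (intro continuous_on_scaleR continuous_on_const continuous_on_sum)
qed

lemma square_continuous: "continuous_on S square"
  unfolding square_eq[abs_def] by (intro continuous_on_add Phi_slice_of_continuous mu_slice_of_continuous)

lemma radial_Phi_slice_of: "radial l (Phi D H (slice_of v)) = (norm (proj D l v))\<^sup>2"
  unfolding Phi_slice_of by (rule radial_sum)

lemma radial_square: "radial l (square v) = (norm (proj D l v))\<^sup>2"
proof -
  have "radial l (mu D H (slice_of v)) = 0" unfolding slice_of_def by (rule radial_X[OF mu_in_X[OF proj_family]])
  then show ?thesis unfolding square_eq using linear_simps(1)[OF radial_linear[of l]] radial_Phi_slice_of by simp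
qed

lemma norm_sum_proj: "(norm v)\<^sup>2 = (\<Sum>l\<in>UNIV. (norm (proj D l v))\<^sup>2)"
proof -
  have "v \<bullet> v = (\<Sum>l\<in>UNIV. (v \<bullet> e l) *\<^sub>R e l + (v \<bullet> f l) *\<^sub>R f l) \<bullet> v" unfolding frame_expand[of v, symmetric] ..
  also have "\<dots> = (\<Sum>l\<in>UNIV. (v \<bullet> e l) * (e l \<bullet> v) + (v \<bullet> f l) * (f l \<bullet> v))"
    unfolding inner_sum_left inner_add_left inner_scaleR_left ..
  also have "\<dots> = (\<Sum>l\<in>UNIV. (norm (proj D l v))\<^sup>2)"
    unfolding norm_proj by (intro sum.cong refl) (simp add: power2_eq_square inner_commute[of v])
  finally show ?thesis unfolding power2_norm_eq_inner[of v] .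
qed

text \<open>
  On Schouten squares this is the squared norm of the parameter in \<open>V\<close>: the radial part alone makes the
  squaring map proper.
\<close>

definition total_radius :: "('b, 'v) lie tensor3 \<Rightarrow> real" where
  "total_radius \<Theta> = (\<Sum>l\<in>UNIV. radial l \<Theta>)"

lemma total_radius_continuous: "continuous_on S total_radius"
  unfolding total_radius_def[abs_def] by (intro continuous_on_sum linear_continuous_on radial_linear)

lemma total_radius_square: "(norm v)\<^sup>2 = total_radius (square v)"
  unfolding total_radius_def radial_square by (rule norm_sum_proj)

lemma total_radius_Phi: "(norm v)\<^sup>2 = total_radius (Phi D H (slice_of v))"
  unfolding total_radius_def radial_Phi_slice_of by (rule norm_sum_proj)

lemma Phi_in_D: "Phi D H (slice_of v) \<in> D_space D H"
  unfolding Phi_slice_of by (rule Evec_sum_in)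

lemma mu_slice_of_in_X: "mu D H (slice_of v) \<in> X_space D"
  unfolding slice_of_def by (rule mu_in_X[OF proj_family])

lemma square_in_DX: "square v \<in> DX_space D H"
  unfolding DX_space_def square_eq mem_Collect_eq 
  by (intro exI[of _ "Phi D H (slice_of v)"] exI[of _ "mu D H (slice_of v)"] conjI refl Phi_in_D mu_slice_of_in_X)

lemma Sigma_image: "Sigma_map D ` marked_slice D H = range square"
  unfolding marked_slice_eq square_def[abs_def] image_image ..

lemma Sigma_continuous: "continuous_on (marked_slice D H) (Sigma_map D)"
proof -
  have "continuous_on (marked_slice D H) (\<lambda>r. square (slice_inv r))"
    by (intro continuous_on_compose2[OF square_continuous slice_inv_continuous, where t = UNIV]) auto
  then show ?thesis
    by (rule continuous_on_eq) (auto simp: marked_slice_eq square_def slice_inv_slice_of)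
qed

lemma Sigma_fibre_compact: "compact {r \<in> marked_slice D H. Sigma_map D r = \<Theta>}"
proof -
  have "{r \<in> marked_slice D H. Sigma_map D r = \<Theta>} = slice_of ` {v. square v = \<Theta>}"
    unfolding marked_slice_eq square_def by blast
  then show ?thesis
    using compact_continuous_image[OF slice_of_continuous
      compact_fibre_of_norm_controlled[OF square_continuous total_radius_square]] by simp
qed

lemma Sigma_closed_image:
  assumes "closed C"
  shows "closed (Sigma_map D ` (marked_slice D H \<inter> C))"
proof -
  have "Sigma_map D ` (marked_slice D H \<inter> C) = square ` (slice_of -` C)"
    unfolding marked_slice_eq square_def by blast
  moreover have "closed (slice_of -` C)"
    using slice_of_continuous[of UNIV] by (intro continuous_closed_vimage[OF assms]) (simp add: continuous_on_eq_continuous_at)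
  ultimately show ?thesis
    using closed_image_of_norm_controlled[OF square_continuous total_radius_continuous total_radius_square] by simp
qed

lemma Sigma_proper: "proper_map (top_of_set (marked_slice D H)) (top_of_set (DX_space D H)) (Sigma_map D)"
  unfolding proper_map_def closed_map_def
proof (intro conjI allI impI ballI)
  fix U assume "closedin (top_of_set (marked_slice D H)) U"
  then obtain C where C: "closed C" "U = marked_slice D H \<inter> C" by (auto simp: closedin_closed)
  have "Sigma_map D ` U \<subseteq> DX_space D H"
    unfolding C(2) marked_slice_eq using square_in_DX by (auto simp: square_def)
  then show "closedin (top_of_set (DX_space D H)) (Sigma_map D ` U)"
    using Sigma_closed_image[OF C(1)] unfolding C(2) by (intro closed_subset)
next
  fix \<Theta>
  show "compactin (top_of_set (marked_slice D H)) {r \<in> topspace (top_of_set (marked_slice D H)). Sigma_map D r = \<Theta>}"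
    using Sigma_fibre_compact by (auto simp: compactin_subtopology)
qed

text \<open>
  The decomposition is unique because the two subspaces meet trivially.
\<close>

lemma D_component_eq:
  assumes "d \<in> D_space D H" "x \<in> X_space D"
  shows "D_component D H (d + x) = d"
  unfolding D_component_def
proof (rule the_equality)
  fix d' assume d': "d' \<in> D_space D H \<and> d + x - d' \<in> X_space D"
  have "d + x - d' - x \<in> X_space D" using d' assms(2) subspace_diff[OF subspace_X] by blast
  moreover have "d - d' \<in> D_space D H" using d' assms(1) unfolding D_space_def by (intro span_diff) auto
  ultimately have "d - d' \<in> D_space D H \<inter> X_space D" by simp
  then show "d' = d" unfolding D_X_trivial by simp
qed (use assms in simp)

lemma radial_fibre_eq_slice_of: "radial_fibre D H Y = slice_of ` {v. Phi D H (slice_of v) = Y}"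
  unfolding radial_fibre_def marked_slice_eq by blast

lemma fibre_image:
  "{\<Theta> \<in> Sigma_map D ` marked_slice D H. D_component D H \<Theta> = Y} = (\<lambda>x. Y + x) ` (mu D H ` radial_fibre D H Y)"
proof -
  have dc: "D_component D H (square v) = Phi D H (slice_of v)" for v
    unfolding square_eq by (rule D_component_eq[OF Phi_in_D mu_slice_of_in_X])
  have "{\<Theta> \<in> range square. D_component D H \<Theta> = Y} = square ` {v. D_component D H (square v) = Y}" by blast
  also have "\<dots> = (\<lambda>v. Y + mu D H (slice_of v)) ` {v. Phi D H (slice_of v) = Y}"
    unfolding dc by (intro image_cong refl) (simp add: square_eq)
  also have "\<dots> = (\<lambda>x. Y + x) ` (mu D H ` radial_fibre D H Y)"
    unfolding radial_fibre_eq_slice_of image_image ..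
  finally show ?thesis unfolding Sigma_image .
qed

lemma mu_radial_fibre_compact: "compact (mu D H ` radial_fibre D H Y)"
proof -
  have "mu D H ` radial_fibre D H Y = (\<lambda>v. mu D H (slice_of v)) ` {v. Phi D H (slice_of v) = Y}"
    unfolding radial_fibre_eq_slice_of image_image ..
  then show ?thesis
    using compact_continuous_image[OF mu_slice_of_continuous
      compact_fibre_of_norm_controlled[OF Phi_slice_of_continuous total_radius_Phi]] by simp
qed

end

section \<open>The image is semialgebraic\<close>

lemma sum_single:
  assumes "finite A" "a \<in> A" "\<And>x. x \<in> A \<Longrightarrow> x \<noteq> a \<Longrightarrow> g x = 0"
  shows "sum g A = g a"
proof -
  have "sum g (A - {a}) = 0" by (rule sum.neutral) (use assms(3) in auto)
  then show ?thesis using sum.remove[OF assms(1,2), of g] by simp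
qed

text \<open>
  Since the dual space is spanned by \<open>B\<close>, linearity in each argument propagates the vanishing.
\<close>

lemma tensor3_eq_0:
  fixes \<Theta> :: "'a::real_normed_vector tensor3"
  assumes B: "span B = UNIV" and z: "\<And>\<phi> \<psi> \<eta>. \<phi> \<in> B \<Longrightarrow> \<psi> \<in> B \<Longrightarrow> \<eta> \<in> B \<Longrightarrow> \<Theta> \<phi> \<psi> \<eta> = 0"
  shows "\<Theta> = 0"
proof -
  have ext: "linear h \<Longrightarrow> (\<And>\<phi>. \<phi> \<in> B \<Longrightarrow> h \<phi> = 0) \<Longrightarrow> h \<phi> = 0" for h :: "'a dual \<Rightarrow> real" and \<phi>
    using linear_eq_0_on_span[of h B \<phi>] B by blast
  have lin: "linear (\<lambda>\<phi>. \<Theta> \<phi> \<psi> \<eta>)" "linear (\<lambda>\<psi>. \<Theta> \<phi> \<psi> \<eta>)" "linear (\<lambda>\<eta>. \<Theta> \<phi> \<psi> \<eta>)" for \<phi> \<psi> \<eta>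
    by (intro linearI; simp add: blinfun.add_left blinfun.add_right blinfun.scaleR_left blinfun.scaleR_right)+
  have z3: "\<Theta> \<phi> \<psi> \<eta> = 0" if "\<phi> \<in> B" "\<psi> \<in> B" for \<phi> \<psi> \<eta>
    by (rule ext[OF lin(3)]) (rule z[OF that])
  have z2: "\<Theta> \<phi> \<psi> \<eta> = 0" if "\<phi> \<in> B" for \<phi> \<psi> \<eta>
    by (rule ext[OF lin(2)]) (rule z3[OF that])
  have "\<Theta> \<phi> \<psi> \<eta> = 0" for \<phi> \<psi> \<eta>
    by (rule ext[OF lin(1)]) (rule z2)
  then show ?thesis by (intro blinfun_eqI) simp
qed

definition formZ :: "'b \<Rightarrow> ('b::euclidean_space, 'v::euclidean_space) lie dual" where
  "formZ b = Blinfun (\<lambda>x. blinfun_apply (snd (snd x)) b)"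

lemma formZ_apply [simp]: "formZ b x = blinfun_apply (snd (snd x)) b"
  unfolding formZ_def
  by (rule fun_cong[OF bounded_linear_Blinfun_apply])
     (rule bounded_linear_compose[OF blinfun.bounded_linear_left bounded_linear_compose[OF bounded_linear_snd bounded_linear_snd]])

text \<open>
  Coordinate forms of the three summands. Their number is finite, so equality of trivectors is a finite
  set of linear equations; this is where the finite dimension of the ambient space enters.
\<close>

definition dual_basis :: "('b::euclidean_space, 'v::euclidean_space) lie dual set" where
  "dual_basis = (\<lambda>k. formB (blinfun_inner_right k)) ` Basis \<union> formV ` Basis \<union> formZ ` Basis"

lemma
  shows finite_dual_basis: "finite (dual_basis :: ('b::euclidean_space, 'v::euclidean_space) lie dual set)"
    and span_dual_basis: "span (dual_basis :: ('b::euclidean_space, 'v::euclidean_space) lie dual set) = UNIV"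
proof -
  show "finite (dual_basis :: ('b, 'v) lie dual set)" by (simp add: dual_basis_def)
  have "\<phi> \<in> span dual_basis" for \<phi> :: "('b, 'v) lie dual"
  proof -
    let ?s = "(\<Sum>k\<in>Basis. \<phi> (inB k) *\<^sub>R formB (blinfun_inner_right k)) + (\<Sum>k\<in>Basis. \<phi> (inV k) *\<^sub>R formV k)
       + (\<Sum>k\<in>Basis. \<phi> (0, 0, blinfun_inner_right k) *\<^sub>R formZ k)"
    have "\<phi> = ?s"
    proof (rule blinfun_eqI)
      fix x :: "('b, 'v) lie"
      obtain b u \<zeta> where x: "x = (b, u, \<zeta>)" by (cases x)
      have "\<zeta> y = (\<Sum>k\<in>Basis. \<zeta> k *\<^sub>R blinfun_inner_right k) y" for y
      proof -
        have "\<zeta> y = \<zeta> (\<Sum>k\<in>Basis. (y \<bullet> k) *\<^sub>R k)" by (simp add: euclidean_representation)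
        then show ?thesis
          by (simp add: blinfun.sum_right blinfun.scaleR_right blinfun.sum_left blinfun.scaleR_left inner_commute[of y] mult.commute)
      qed
      then have z: "\<zeta> = (\<Sum>k\<in>Basis. \<zeta> k *\<^sub>R blinfun_inner_right k)" by (rule blinfun_eqI)
      define JB :: "'b \<Rightarrow> ('b, 'v) lie" where "JB b = inB b" for b
      define JV :: "'v \<Rightarrow> ('b, 'v) lie" where "JV v = inV v" for v
      define JZ :: "'b dual \<Rightarrow> ('b, 'v) lie" where "JZ z = (0, 0, z)" for z
      have lin: "linear JB" "linear JV" "linear JZ"
        by (auto intro!: linearI simp: JB_def JV_def JZ_def)
      have "JB b = JB (\<Sum>k\<in>Basis. (b \<bullet> k) *\<^sub>R k)" "JV u = JV (\<Sum>k\<in>Basis. (u \<bullet> k) *\<^sub>R k)"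
        by (simp_all add: euclidean_representation)
      then have JBV: "JB b = (\<Sum>k\<in>Basis. (k \<bullet> b) *\<^sub>R JB k)" "JV u = (\<Sum>k\<in>Basis. (k \<bullet> u) *\<^sub>R JV k)"
        by (simp_all only: linear_sum[OF lin(1)] linear_scale[OF lin(1)] inner_commute[of b]
            linear_sum[OF lin(2)] linear_scale[OF lin(2)] inner_commute[of u])
      have "x = JB b + JV u + JZ \<zeta>" by (simp add: x JB_def JV_def JZ_def)
      also note JBV(1)
      also note JBV(2)
      also have "JZ \<zeta> = (\<Sum>k\<in>Basis. \<zeta> k *\<^sub>R JZ (blinfun_inner_right k))"
        by (subst z, subst linear_sum[OF lin(3)]) (simp add: linear_scale[OF lin(3)])
      finally have "\<phi> x = (\<Sum>k\<in>Basis. (k \<bullet> b) * \<phi> (JB k)) + (\<Sum>k\<in>Basis. (k \<bullet> u) * \<phi> (JV k))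
          + (\<Sum>k\<in>Basis. \<zeta> k * \<phi> (JZ (blinfun_inner_right k)))"
        by (simp add: blinfun.add_right blinfun.sum_right blinfun.scaleR_right)
      also have "\<dots> = ?s x"
        by (simp add: x JB_def JV_def JZ_def blinfun.add_left blinfun.sum_left blinfun.scaleR_left mult.commute)
      finally show "\<phi> x = ?s x" .
    qed
    moreover have "?s \<in> span dual_basis"
      by (intro span_add span_sum span_scale span_base) (auto simp: dual_basis_def)
    ultimately show ?thesis by simp
  qed
  then show "span (dual_basis :: ('b, 'v) lie dual set) = UNIV" by blast
qed

lemma semialgebraic_kernel:
  fixes L :: "('b::euclidean_space, 'v::euclidean_space) lie tensor3 \<Rightarrow> ('b, 'v) lie tensor3"
  assumes L: "bounded_linear L"
  shows "semialgebraic {\<Theta>. L \<Theta> = 0}"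
proof -
  have eq: "L \<Theta> = 0 \<longleftrightarrow> (\<forall>t\<in>dual_basis \<times> dual_basis \<times> dual_basis. L \<Theta> (fst t) (fst (snd t)) (snd (snd t)) = 0)" for \<Theta>
  proof
    assume "\<forall>t\<in>dual_basis \<times> dual_basis \<times> dual_basis. L \<Theta> (fst t) (fst (snd t)) (snd (snd t)) = 0"
    then show "L \<Theta> = 0" by (intro tensor3_eq_0[OF span_dual_basis]) force
  qed simp
  show ?thesis
    unfolding eq using finite_dual_basis
    by (intro semialgebraic_Ball finite_cartesian_product semialgebraic_zero real_polynomial_function.intros(1)
        bounded_linear_compose[OF bounded_linear_eval3 L])
qed

context marked
begin

definition fr :: "bool \<Rightarrow> 'm \<Rightarrow> 'v" where "fr s l = (if s then e l else f l)"

lemma fr_in: "fr s l \<in> plane D l" by (simp add: fr_def e_in f_in)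

lemma plane_fr:
  assumes "p \<in> plane D l"
  shows "p = (\<Sum>s\<in>UNIV. (p \<bullet> fr s l) *\<^sub>R fr s l)"
proof -
  have "(\<Sum>s\<in>UNIV. (p \<bullet> fr s l) *\<^sub>R fr s l) = (p \<bullet> e l) *\<^sub>R e l + (p \<bullet> f l) *\<^sub>R f l"
  proof -
    have "sum g UNIV = g True + g False" for g :: "bool \<Rightarrow> 'v" unfolding UNIV_bool by (simp add: add.commute)
    note two = this
    show ?thesis unfolding two fr_def if_True if_False ..
  qed
  also have "\<dots> = p" by (rule plane_expand[OF assms, symmetric])
  finally show ?thesis by (rule sym)
qed

text \<open>
  The coordinates of the cross part belonging to \<open>P\<^sub>i\<close> and \<open>P\<^sub>j\<close>; the Boolean arguments choose between the two frame
  vectors of each plane.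
\<close>

definition coeff :: "'m \<Rightarrow> 'm \<Rightarrow> 'b \<Rightarrow> bool \<Rightarrow> bool \<Rightarrow> ('b, 'v) lie tensor3 \<Rightarrow> real" where
  "coeff i j k s t \<Theta> = \<Theta> (formB (blinfun_inner_right k)) (formV (fr s i)) (formV (fr t j))"

lemma coeff_linear: "bounded_linear (coeff i j k s t)"
  unfolding coeff_def[abs_def] by (rule bounded_linear_eval3)

definition block :: "'m \<Rightarrow> 'm \<Rightarrow> ('b, 'v) lie tensor3 \<Rightarrow> ('b, 'v) lie tensor3" where
  "block i j \<Theta> = (\<Sum>k\<in>Basis. \<Sum>s\<in>UNIV. \<Sum>t\<in>UNIV. coeff i j k s t \<Theta> *\<^sub>R wedge3 (inB k) (inV (fr s i)) (inV (fr t j)))"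

text \<open>
  Rebuilding a tensor from its radial and cross coordinates. The fixed points are the elements of
  the direct sum of the radial and the cross space, so membership there is a linear condition, and such
  an element is determined by these coordinates.
\<close>

definition DX_projector :: "('b, 'v) lie tensor3 \<Rightarrow> ('b, 'v) lie tensor3" where
  "DX_projector \<Theta> = (\<Sum>l\<in>UNIV. radial l \<Theta> *\<^sub>R Evec D H l) + (\<Sum>(i, j)\<in>{(i, j). i < j}. block i j \<Theta>)"

lemma block_linear: "bounded_linear (block i j)"
  unfolding block_def[abs_def]
  by (intro bounded_linear_sum bounded_linear_compose[OF bounded_linear_scaleR_left] coeff_linear)

lemma DX_projector_linear: "bounded_linear DX_projector"
  unfolding DX_projector_def[abs_def] case_prod_unfold
  by (intro bounded_linear_add bounded_linear_sum block_linear
      bounded_linear_compose[OF bounded_linear_scaleR_left radial_linear])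

lemma coeff_Evec:
  assumes "i \<noteq> j"
  shows "coeff i j k s t (Evec D H l) = 0"
proof -
  have "l \<noteq> i \<or> l \<noteq> j" using assms by blast
  then have "fr s i \<bullet> e l = 0 \<and> fr s i \<bullet> f l = 0 \<or> fr t j \<bullet> e l = 0 \<and> fr t j \<bullet> f l = 0"
    using plane_other fr_in by metis
  then show ?thesis
    unfolding coeff_def Evec_def qturn_e blinfun.scaleR_left eval_wedge3
    by (metis diff_self mult_zero_left mult_zero_right scaleR_zero_right)
qed

text \<open>
  Of the two terms of the minor, the second would pair \<open>P\<^sub>i\<close> with \<open>P\<^sub>m\<close> and \<open>P\<^sub>j\<close> with \<open>P\<^sub>l\<close>; it
  vanishes because both pairs of indices are increasing.
\<close>

lemma coeff_wedge3:
  assumes ij: "i < j" and lm: "l < m" and p: "p \<in> plane D l" and q: "q \<in> plane D m"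
  shows "coeff i j k s t (wedge3 (inB b) (inV p) (inV q)) =
    (if (l, m) = (i, j) then (k \<bullet> b) * ((p \<bullet> fr s i) * (q \<bullet> fr t j)) else 0)"
proof -
  have "fr s i \<bullet> q = 0 \<or> fr t j \<bullet> p = 0"
    using ij lm plane_orthogonal[OF fr_in p] plane_orthogonal[OF fr_in q] by (metis less_asym)
  moreover have "fr s i \<bullet> p = 0 \<or> fr t j \<bullet> q = 0" if "(l, m) \<noteq> (i, j)"
    using that plane_orthogonal[OF fr_in p] plane_orthogonal[OF fr_in q] by auto
  ultimately show ?thesis
    unfolding coeff_def eval_wedge3 by (auto simp: inner_commute)
qed

lemma block_wedge3:
  assumes ij: "i < j" and lm: "l < m" and p: "p \<in> plane D l" and q: "q \<in> plane D m"
  shows "block i j (wedge3 (inB b) (inV p) (inV q)) = (if (i, j) = (l, m) then wedge3 (inB b) (inV p) (inV q) else 0)"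
proof (cases "(i, j) = (l, m)")
  case True
  then have "block i j (wedge3 (inB b) (inV p) (inV q)) =
      (\<Sum>k\<in>Basis. \<Sum>s\<in>UNIV. \<Sum>t\<in>UNIV. ((b \<bullet> k) * ((p \<bullet> fr s i) * (q \<bullet> fr t j))) *\<^sub>R wedge3 (inB k) (inV (fr s i)) (inV (fr t j)))"
    unfolding block_def coeff_wedge3[OF assms] by (simp add: inner_commute[of b])
  also have "\<dots> = wedge3 (inB b) (inV p) (inV q)"
  proof -
    define W :: "'b \<Rightarrow> 'v \<Rightarrow> 'v \<Rightarrow> ('b, 'v) lie tensor3" where "W b u v = wedge3 (inB b) (inV u) (inV v)" for b u v
    have inB_linear: "inB (x + y) = inB x + (inB y :: ('b, 'v) lie)" "inB (c *\<^sub>R x) = c *\<^sub>R (inB x :: ('b, 'v) lie)" for x y :: 'b and c by simp_all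
    have lin: "linear (\<lambda>b. W b u v)" "linear (\<lambda>u. W b u v)" "linear (\<lambda>v. W b u v)" for b u v
      unfolding W_def by (intro linearI; simp only: inB_linear inV_linear wedge3_linear)+
    have pq: "(\<Sum>s\<in>UNIV. (p \<bullet> fr s i) *\<^sub>R fr s i) = p" "(\<Sum>t\<in>UNIV. (q \<bullet> fr t j) *\<^sub>R fr t j) = q"
      using plane_fr[OF p, symmetric] plane_fr[OF q, symmetric] True by simp_all
    have "W b p q = W (\<Sum>k\<in>Basis. (b \<bullet> k) *\<^sub>R k) (\<Sum>s\<in>UNIV. (p \<bullet> fr s i) *\<^sub>R fr s i) (\<Sum>t\<in>UNIV. (q \<bullet> fr t j) *\<^sub>R fr t j)"
      unfolding pq euclidean_representation ..
    also have "\<dots> = (\<Sum>k\<in>Basis. \<Sum>s\<in>UNIV. \<Sum>t\<in>UNIV. ((b \<bullet> k) * ((p \<bullet> fr s i) * (q \<bullet> fr t j))) *\<^sub>R W k (fr s i) (fr t j))"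
      unfolding linear_sum[OF lin(1)] linear_scale[OF lin(1)]
      unfolding linear_sum[OF lin(2)] linear_scale[OF lin(2)]
      unfolding linear_sum[OF lin(3)] linear_scale[OF lin(3)]
      by (simp only: scaleR_sum_right scaleR_scaleR mult.assoc)
    finally show ?thesis unfolding W_def by simp
  qed
  finally show ?thesis using True by simp
next
  case False
  then show ?thesis unfolding block_def coeff_wedge3[OF assms] by auto
qed

lemma DX_projector_D: "d \<in> D_space D H \<Longrightarrow> DX_projector d = d"
proof -
  assume d: "d \<in> D_space D H"
  have "block i j d = 0" if "i < j" for i j
  proof (rule linear_eq_0_on_span[OF bounded_linear.linear[OF block_linear]])
    show "d \<in> span (range (Evec D H))" using d unfolding D_space_def .
    show "block i j x = 0" if "x \<in> range (Evec D H)" for x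
      using coeff_Evec[of i j] that \<open>i < j\<close> unfolding block_def by auto
  qed
  then have "(\<Sum>(i, j)\<in>{(i, j). i < j}. block i j d) = 0" by (intro sum.neutral) auto
  then show "DX_projector d = d" unfolding DX_projector_def D_expand[OF d, symmetric] by simp
qed

lemma DX_projector_X:
  assumes x: "x \<in> X_space D"
  shows "DX_projector x = x"
proof (rule linear_eq_on_span[where f = DX_projector and g = "\<lambda>x. x"])
  show "linear DX_projector" by (rule bounded_linear.linear[OF DX_projector_linear])
  show "linear (\<lambda>x :: ('b, 'v) lie tensor3. x)" by (rule linear_ident)
  show "x \<in> span {wedge3 (inB b) (inV p) (inV q) | b p q i j. i < j \<and> p \<in> plane D i \<and> q \<in> plane D j}"
    using x unfolding X_space_def .
  fix y :: "('b, 'v) lie tensor3"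
  assume "y \<in> {wedge3 (inB b) (inV p) (inV q) | b p q i j. i < j \<and> p \<in> plane D i \<and> q \<in> plane D j}"
  then obtain b p q l m where y: "y = wedge3 (inB b) (inV p) (inV q)" and lm: "l < m" "p \<in> plane D l" "q \<in> plane D m" by blast
  have "(\<Sum>(i, j)\<in>{(i, j). i < j}. block i j y) = (case (l, m) of (i, j) \<Rightarrow> block i j y)"
    by (rule sum_single) (use lm in \<open>auto simp: y block_wedge3[OF _ lm] split: if_splits\<close>)
  also have "\<dots> = y" using lm by (simp add: y block_wedge3[OF _ lm])
  finally show "DX_projector y = y"
    unfolding DX_projector_def using radial_X[OF wedge3_in_X[OF lm]] by (simp add: y)
qed

lemma DX_projector_square: "DX_projector (square v) = square v"
  unfolding square_eq using linear_simps(1)[OF DX_projector_linear] DX_projector_D[OF Phi_in_D] DX_projector_X[OF mu_slice_of_in_X] by simp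

lemma coeff_square:
  assumes ij: "i < j"
  shows "coeff i j k s t (square v) =
    2 * (weight D j (H i) * (k \<bullet> H j) * ((proj D i v \<bullet> fr s i) * (qturn D j (proj D j v) \<bullet> fr t j))
       - weight D i (H j) * (k \<bullet> H i) * ((qturn D i (proj D i v) \<bullet> fr s i) * (proj D j v \<bullet> fr t j)))"
proof -
  let ?u = "\<lambda>l. proj D l v" and ?J = "\<lambda>l. qturn D l (proj D l v)"
  note P = proj_in qturn_in[OF proj_in]
  interpret c: bounded_linear "coeff i j k s t" by (rule coeff_linear)
  have E: "coeff i j k s t (Evec D H l) = 0" for l using ij by (intro coeff_Evec) simp
  let ?r = "weight D j (H i) * (k \<bullet> H j) * ((?u i \<bullet> fr s i) * (?J j \<bullet> fr t j))
       - weight D i (H j) * (k \<bullet> H i) * ((?J i \<bullet> fr s i) * (?u j \<bullet> fr t j))"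
  have C: "coeff i j k s t (cross ?u l m) = (if (l, m) = (i, j) then ?r else 0)" if "l < m" for l m
    unfolding cross_def c.diff c.scaleR coeff_wedge3[OF ij that P(1) P(2)] coeff_wedge3[OF ij that P(2) P(1)] by simp
  have "coeff i j k s t (square v) = 2 * (\<Sum>lm\<in>{(l, m). l < m}. coeff i j k s t (cross ?u (fst lm) (snd lm)))"
    unfolding square_eq Phi_slice_of mu_slice_of by (simp add: c.add c.sum c.scaleR E case_prod_unfold)
  also have "(\<Sum>lm\<in>{(l, m). l < m}. coeff i j k s t (cross ?u (fst lm) (snd lm))) = coeff i j k s t (cross ?u (fst (i, j)) (snd (i, j)))"
    by (rule sum_single) (use ij C in \<open>auto split: if_splits\<close>)
  also have "\<dots> = ?r" using C[OF ij] by simp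
  finally show ?thesis .
qed

text \<open>
  Identify \<open>P\<^sub>i\<close> and \<open>P\<^sub>j\<close> with \<open>\<complex>\<close> by the frames, so that \<open>e\<close> becomes \<open>1\<close> and \<open>f\<close> becomes \<open>\<i>\<close>. Then
  \<open>u \<otimes> v \<mapsto> (z w, z w\<^sup>*)\<close>, where \<open>w\<^sup>*\<close> is the complex conjugate, identifies the real tensor product
  of the planes with \<open>\<complex>\<^sup>2\<close>. The Boolean \<open>c\<close> selects the conjugated component.
\<close>

definition monomial_coord :: "'m \<Rightarrow> 'm \<Rightarrow> 'b \<Rightarrow> bool \<Rightarrow> ('b, 'v) lie tensor3 \<Rightarrow> complex" where
  "monomial_coord i j k c \<Theta> = (if c
     then Complex (coeff i j k True True \<Theta> + coeff i j k False False \<Theta>) (coeff i j k False True \<Theta> - coeff i j k True False \<Theta>)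
     else Complex (coeff i j k True True \<Theta> - coeff i j k False False \<Theta>) (coeff i j k True False \<Theta> + coeff i j k False True \<Theta>))"

lemma monomial_coord_determines:
  assumes "\<And>c. monomial_coord i j k c \<Theta> = monomial_coord i j k c \<Theta>'"
  shows "coeff i j k s t \<Theta> = coeff i j k s t \<Theta>'"
  using assms[of True] assms[of False] unfolding monomial_coord_def
  by (cases s; cases t) auto

lemma monomial_coord_polynomial: "complex_polynomial (monomial_coord i j k c)"
  unfolding complex_polynomial_def monomial_coord_def
  by (cases c) (auto intro!: real_polynomial_function.intros(1) bounded_linear_add bounded_linear_sub coeff_linear)

text \<open>
  With \<open>A = \<lambda>\<^sub>j(h\<^sub>i) \<langle>k, h\<^sub>j\<rangle>\<close> and \<open>B = \<lambda>\<^sub>i(h\<^sub>j) \<langle>k, h\<^sub>i\<rangle>\<close> these are \<open>2 \<i> (A - B)\<close> and \<open>-2 \<i> (A + B)\<close>: conjugation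
  turns the factor \<open>\<i>\<close> of the quarter-turn on \<open>P\<^sub>j\<close> into \<open>-\<i>\<close>.
\<close>

definition monomial_scalar :: "'m \<Rightarrow> 'm \<Rightarrow> 'b \<Rightarrow> bool \<Rightarrow> complex" where
  "monomial_scalar i j k c = \<i> * of_real (if c
     then - 2 * (weight D j (H i) * (k \<bullet> H j) + weight D i (H j) * (k \<bullet> H i))
     else 2 * (weight D j (H i) * (k \<bullet> H j) - weight D i (H j) * (k \<bullet> H i)))"

definition zcoord :: "'v \<Rightarrow> 'm \<Rightarrow> complex" where
  "zcoord v l = Complex (v \<bullet> e l) (v \<bullet> f l)"

text \<open>
  Both quarter-turns act on the two complex components as multiplication by \<open>\<i>\<close> or \<open>-\<i>\<close>. Therefore each
  component of a cross term is a constant multiple of \<open>z\<^sub>i z\<^sub>j\<close> or \<open>z\<^sub>i z\<^sub>j\<^sup>*\<close>. These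
  constants can vanish: for all test vectors if \<open>\<lambda>\<^sub>j(h\<^sub>i) = \<lambda>\<^sub>i(h\<^sub>j) = 0\<close>, and for exactly one of the two products if
  \<open>h\<^sub>j = c h\<^sub>i\<close> with \<open>\<lambda>\<^sub>j(h\<^sub>j) = \<plusminus> c \<lambda>\<^sub>i(h\<^sub>i)\<close>. So the image need not determine both products.
\<close>

lemma monomial_coord_square:
  assumes "i < j"
  shows "monomial_coord i j k c (square v) = monomial_scalar i j k c * zcoord v i * (if c then cnj (zcoord v j) else zcoord v j)"
proof -
  have p: "proj D l v \<bullet> fr True l = v \<bullet> e l" "proj D l v \<bullet> fr False l = v \<bullet> f l"
    "qturn D l (proj D l v) \<bullet> fr True l = - (v \<bullet> f l)" "qturn D l (proj D l v) \<bullet> fr False l = v \<bullet> e l" for l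
    unfolding proj_eq qturn_eq[OF plane_combination] fr_def by (simp_all add: inner_add_left inner_diff_left)
  show ?thesis
    unfolding monomial_coord_def coeff_square[OF assms] p monomial_scalar_def zcoord_def
    by (cases c) (simp_all add: complex_eq_iff algebra_simps)
qed

lemma zcoord_surj: "\<exists>v. zcoord v = z"
proof (intro exI ext)
  let ?v = "\<Sum>k\<in>UNIV. Re (z k) *\<^sub>R e k + Im (z k) *\<^sub>R f k"
  fix l
  have "?v \<bullet> e l = (\<Sum>k\<in>UNIV. if k = l then Re (z l) else 0)" "?v \<bullet> f l = (\<Sum>k\<in>UNIV. if k = l then Im (z l) else 0)"
    unfolding inner_sum_left by (intro sum.cong refl; simp add: inner_add_left)+
  then show "zcoord ?v l = z l" by (simp add: zcoord_def)
qed

lemma radial_square_zcoord: "radial l (square v) = (cmod (zcoord v l))\<^sup>2"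
  unfolding radial_square norm_proj zcoord_def by (simp add: cmod_power2)

definition pairs :: "('m \<times> 'm \<times> 'b \<times> bool) set" where
  "pairs = {(i, j, k, c). i < j \<and> k \<in> Basis}"

text \<open>
  Within the direct sum of the radial and the cross space the coordinates determine the trivector, so
  lying in the image means having the coordinates of some Schouten square.
\<close>

lemma range_square_iff:
  "\<Theta> \<in> range square \<longleftrightarrow> DX_projector \<Theta> - \<Theta> = 0 \<and>
     (\<exists>z. (\<forall>l. radial l \<Theta> = (cmod (z l))\<^sup>2) \<and>
        (\<forall>(i, j, k, c)\<in>pairs. monomial_coord i j k c \<Theta> = monomial_scalar i j k c * z i * (if c then cnj (z j) else z j)))"
  (is "_ \<longleftrightarrow> ?lin \<and> (\<exists>z. ?eqs z)")
proof
  assume "\<Theta> \<in> range square"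
  then obtain v where v: "\<Theta> = square v" by blast
  have "?eqs (zcoord v)" unfolding v by (auto simp: radial_square_zcoord monomial_coord_square pairs_def)
  moreover have ?lin unfolding v DX_projector_square by simp
  ultimately show "?lin \<and> (\<exists>z. ?eqs z)" by blast
next
  assume R: "?lin \<and> (\<exists>z. ?eqs z)"
  then obtain z where z: "?eqs z" by blast
  obtain v where v: "zcoord v = z" using zcoord_surj by blast
  have r: "radial l \<Theta> = radial l (square v)" for l using z by (simp add: radial_square_zcoord v)
  have "monomial_coord i j k c \<Theta> = monomial_coord i j k c (square v)" if "i < j" "k \<in> Basis" for i j k c
    using z that by (auto simp: monomial_coord_square v pairs_def)
  then have "block i j \<Theta> = block i j (square v)" if "i < j" for i j
    unfolding block_def using that by (intro sum.cong refl arg_cong2[where f = scaleR] monomial_coord_determines) auto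
  then have "DX_projector \<Theta> = DX_projector (square v)" unfolding DX_projector_def r by (intro arg_cong2[where f = "(+)"] sum.cong) auto
  then have "\<Theta> = square v" using R unfolding DX_projector_square by simp
  then show "\<Theta> \<in> range square" by blast
qed

lemma semialgebraic_image: "semialgebraic (Sigma_map D ` marked_slice D H)"
proof -
  have "pairs \<subseteq> UNIV \<times> UNIV \<times> Basis \<times> UNIV" unfolding pairs_def by auto
  then have fin: "finite pairs" by (rule finite_subset) simp
  have "semialgebraic {\<Theta>. \<exists>z. (\<forall>l. radial l \<Theta> = (cmod (z l))\<^sup>2) \<and>
      (\<forall>p\<in>pairs. (\<lambda>(i, j, k, c). monomial_coord i j k c) p \<Theta> = (\<lambda>(i, j, k, c). monomial_scalar i j k c) p * z (fst p)
         * (if snd (snd (snd p)) then cnj (z (fst (snd p))) else z (fst (snd p))))}"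
    by (rule semialgebraic_quadratic_monomials[OF _ fin])
      (auto intro: monomial_coord_polynomial real_polynomial_function.intros(1) radial_linear)
  then have mon: "semialgebraic {\<Theta>. \<exists>z. (\<forall>l. radial l \<Theta> = (cmod (z l))\<^sup>2) \<and>
      (\<forall>(i, j, k, c)\<in>pairs. monomial_coord i j k c \<Theta> = monomial_scalar i j k c * z i * (if c then cnj (z j) else z j))}"
    by (simp add: case_prod_unfold)
  have lin: "semialgebraic {\<Theta>. DX_projector \<Theta> - \<Theta> = 0}"
    by (intro semialgebraic_kernel bounded_linear_sub DX_projector_linear bounded_linear_ident)
  have "range square = {\<Theta>. DX_projector \<Theta> - \<Theta> = 0 \<and> (\<exists>z. (\<forall>l. radial l \<Theta> = (cmod (z l))\<^sup>2) \<and>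
      (\<forall>(i, j, k, c)\<in>pairs. monomial_coord i j k c \<Theta> = monomial_scalar i j k c * z i * (if c then cnj (z j) else z j)))}"
    by (intro set_eqI) (simp only: range_square_iff mem_Collect_eq)
  then show ?thesis unfolding Sigma_image using semialgebraic_conj[OF lin mon] by simp
qed

end

section \<open>The Schouten square on a marked slice\<close>

theorem theoremA:
  fixes D :: "('m::{finite,linorder}, 'b::euclidean_space, 'v::euclidean_space) rot_datum"
    and H :: "'m \<Rightarrow> 'b"
  assumes "rotational_datum D"
    and "positive_marking D H"
  shows
    \<comment> \<open>(a)\<close>
    "(D_space D H \<inter> X_space D = {0} \<and>
      bij_betw (slice H) (Pi UNIV (plane D)) (marked_slice D H) \<and>
      (\<forall>u \<in> Pi UNIV (plane D).
         let r = (\<Sum>l\<in>UNIV. wedge2 (inB (H l)) (inV (u l))) in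
           r \<in> marked_slice D H \<and>
           schouten (bracket D) r r = Phi D H r + mu D H r \<and>
           Phi D H r = (\<Sum>l\<in>UNIV. (norm (u l))\<^sup>2 *\<^sub>R Evec D H l) \<and>
           Phi D H r \<in> D_space D H \<and>
           mu D H r = 2 *\<^sub>R (\<Sum>(i, j)\<in>{(i, j). i < j}.
               weight D j (H i) *\<^sub>R wedge3 (inB (H j)) (inV (u i)) (inV (qturn D j (u j)))
             - weight D i (H j) *\<^sub>R wedge3 (inB (H i)) (inV (qturn D i (u i))) (inV (u j))) \<and>
           mu D H r \<in> X_space D) \<and>
      Phi D H ` marked_slice D H = C_cone D H \<and>
      simplicial_cone (C_cone D H) \<and>
      (\<forall>t. (\<forall>l. t l \<ge> 0) \<longrightarrow>
         radial_fibre D H (\<Sum>l\<in>UNIV. t l *\<^sub>R Evec D H l) =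
           slice H ` Pi UNIV (\<lambda>l. if t l > 0 then plane D l \<inter> sphere 0 (sqrt (t l)) else {0})) \<and>
      symplectic (omega D) \<and>
      (\<forall>l v. ((\<lambda>s. torus_act D (s *\<^sub>R axis l 1) v) has_vector_derivative generator D l v) (at 0)) \<and>
      is_moment_map D (mu_torus D) \<and>
      (\<exists>\<iota>.
         linear \<iota> \<and> inj \<iota> \<and> (\<forall>l. \<iota> (eps_dual l) = 2 *\<^sub>R Evec D H l) \<and>
         (\<forall>v. Phi D H (slice H (\<lambda>l. proj D l v)) = \<iota> (mu_torus D v))))
     \<and>
     \<comment> \<open>(b)\<close>
     (\<forall>ip :: 'b \<Rightarrow> 'b \<Rightarrow> real. pos_def_inner ip \<longrightarrow>
        (\<forall>r \<in> marked_slice D H.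
           ext3_norm (lie_inner ip) (Phi D H r) \<ge> kappa0 D H ip * (ext2_norm (lie_inner ip) r)\<^sup>2) \<and>
        (\<forall>\<kappa>. (\<forall>r \<in> marked_slice D H.
               ext3_norm (lie_inner ip) (Phi D H r) \<ge> \<kappa> * (ext2_norm (lie_inner ip) r)\<^sup>2)
             \<longrightarrow> \<kappa> \<le> kappa0 D H ip) \<and>
        (\<forall>u \<in> Pi UNIV (plane D). \<forall>R.
           let r = (\<Sum>l\<in>UNIV. wedge2 (inB (H l)) (inV (u l))) in
           (ext2_norm (lie_inner ip) r)\<^sup>2 = R\<^sup>2 \<and> R\<^sup>2 > 0 \<longrightarrow>
             (ext3_norm (lie_inner ip) (Phi D H r) = kappa0 D H ip * (ext2_norm (lie_inner ip) r)\<^sup>2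
              \<longleftrightarrow>
              (\<forall>l. (norm (u l))\<^sup>2 = (R\<^sup>2 / (weight D l (H l))\<^sup>2) /
                     (\<Sum>j\<in>UNIV. ip (H j) (H j) / (weight D j (H j))\<^sup>2)))))
     \<and>
     \<comment> \<open>(c)\<close>
     (Sigma_map D \<in> marked_slice D H \<rightarrow> DX_space D H \<and>
      continuous_on (marked_slice D H) (Sigma_map D) \<and>
      proper_map (top_of_set (marked_slice D H)) (top_of_set (DX_space D H)) (Sigma_map D) \<and>
      (\<forall>Y \<in> C_cone D H.
         {\<Theta> \<in> Sigma_map D ` marked_slice D H. D_component D H \<Theta> = Y} =
           (\<lambda>x. Y + x) ` (mu D H ` radial_fibre D H Y) \<and>
         compact (mu D H ` radial_fibre D H Y)) \<and>
      closed (Sigma_map D ` marked_slice D H) \<and>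
      semialgebraic (Sigma_map D ` marked_slice D H) \<and>
      (\<forall>\<Theta> \<in> DX_space D H. compact {r \<in> marked_slice D H. Sigma_map D r = \<Theta>}))"
  proof -
  interpret marked D H
    using assms by unfold_locales
  have slice_sum: "(\<Sum>l\<in>UNIV. wedge2 (inB (H l)) (inV (u l))) = slice H u" for u :: "'m \<Rightarrow> 'v"
    by (simp add: slice_def)
  have slice_mem: "slice H u \<in> marked_slice D H" if "u \<in> Pi UNIV (plane D)" for u
    using that unfolding marked_slice_def by blast
  show ?thesis
    unfolding slice_sum Let_def
  proof (intro conjI)
    show "bij_betw (slice H) (Pi UNIV (plane D)) (marked_slice D H)"
      unfolding bij_betw_def marked_slice_def using slice_inj by blast
    show "\<forall>u\<in>Pi UNIV (plane D).
        slice H u \<in> marked_slice D H \<and>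
        schouten (bracket D) (slice H u) (slice H u) = Phi D H (slice H u) + mu D H (slice H u) \<and>
        Phi D H (slice H u) = (\<Sum>l\<in>UNIV. (norm (u l))\<^sup>2 *\<^sub>R Evec D H l) \<and>
        Phi D H (slice H u) \<in> D_space D H \<and>
        mu D H (slice H u) = 2 *\<^sub>R (\<Sum>(i, j)\<in>{(i, j). i < j}.
            weight D j (H i) *\<^sub>R wedge3 (inB (H j)) (inV (u i)) (inV (qturn D j (u j)))
          - weight D i (H j) *\<^sub>R wedge3 (inB (H i)) (inV (qturn D i (u i))) (inV (u j))) \<and>
        mu D H (slice H u) \<in> X_space D"
    proof (intro ballI conjI)
      fix u assume u: "u \<in> Pi UNIV (plane D)"
      show "slice H u \<in> marked_slice D H" by (rule slice_mem[OF u])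
      show "schouten (bracket D) (slice H u) (slice H u) = Phi D H (slice H u) + mu D H (slice H u)"
        by (rule schouten_decomposition[OF u])
      show "Phi D H (slice H u) = (\<Sum>l\<in>UNIV. (norm (u l))\<^sup>2 *\<^sub>R Evec D H l)" by (rule Phi_slice[OF u])
      show "Phi D H (slice H u) \<in> D_space D H" unfolding Phi_slice[OF u] by (rule Evec_sum_in)
      show "mu D H (slice H u) = 2 *\<^sub>R (\<Sum>(i, j)\<in>{(i, j). i < j}.
            weight D j (H i) *\<^sub>R wedge3 (inB (H j)) (inV (u i)) (inV (qturn D j (u j)))
          - weight D i (H j) *\<^sub>R wedge3 (inB (H i)) (inV (qturn D i (u i))) (inV (u j)))"
        by (rule mu_slice[OF u, unfolded cross_def])
      show "mu D H (slice H u) \<in> X_space D" by (rule mu_in_X[OF u])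
    qed
    show "\<forall>ip. pos_def_inner ip \<longrightarrow>
        (\<forall>r\<in>marked_slice D H. kappa0 D H ip * (ext2_norm (lie_inner ip) r)\<^sup>2 \<le> ext3_norm (lie_inner ip) (Phi D H r)) \<and>
        (\<forall>\<kappa>. (\<forall>r\<in>marked_slice D H. \<kappa> * (ext2_norm (lie_inner ip) r)\<^sup>2 \<le> ext3_norm (lie_inner ip) (Phi D H r))
            \<longrightarrow> \<kappa> \<le> kappa0 D H ip) \<and>
        (\<forall>u\<in>Pi UNIV (plane D). \<forall>R.
            (ext2_norm (lie_inner ip) (slice H u))\<^sup>2 = R\<^sup>2 \<and> 0 < R\<^sup>2 \<longrightarrow>
            (ext3_norm (lie_inner ip) (Phi D H (slice H u)) = kappa0 D H ip * (ext2_norm (lie_inner ip) (slice H u))\<^sup>2) =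
            (\<forall>l. (norm (u l))\<^sup>2 = R\<^sup>2 / (weight D l (H l))\<^sup>2 / (\<Sum>j\<in>UNIV. ip (H j) (H j) / (weight D j (H j))\<^sup>2)))"
    proof (intro allI impI conjI ballI; (elim conjE)?)
      fix ip :: "'b \<Rightarrow> 'b \<Rightarrow> real" assume ip: "pos_def_inner ip"
      show "kappa0 D H ip * (ext2_norm (lie_inner ip) r)\<^sup>2 \<le> ext3_norm (lie_inner ip) (Phi D H r)"
        if r: "r \<in> marked_slice D H" for r
      proof -
        from r obtain u where u: "u \<in> Pi UNIV (plane D)" "r = slice H u" unfolding marked_slice_def by blast
        show ?thesis unfolding u(2) by (rule radial_estimate(1)[OF ip u(1)])
      qed
      show "\<kappa> \<le> kappa0 D H ip"
        if "\<forall>r\<in>marked_slice D H. \<kappa> * (ext2_norm (lie_inner ip) r)\<^sup>2 \<le> ext3_norm (lie_inner ip) (Phi D H r)" for \<kappa>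
        by (rule radial_constant_optimal[OF ip that])
      show "(ext3_norm (lie_inner ip) (Phi D H (slice H u)) = kappa0 D H ip * (ext2_norm (lie_inner ip) (slice H u))\<^sup>2) =
            (\<forall>l. (norm (u l))\<^sup>2 = R\<^sup>2 / (weight D l (H l))\<^sup>2 / (\<Sum>j\<in>UNIV. ip (H j) (H j) / (weight D j (H j))\<^sup>2))"
        if u: "u \<in> Pi UNIV (plane D)" and R: "(ext2_norm (lie_inner ip) (slice H u))\<^sup>2 = R\<^sup>2" for u R
        using radial_estimate(2)[OF ip u] unfolding R .
    qed
    show "Sigma_map D \<in> marked_slice D H \<rightarrow> DX_space D H"
      unfolding marked_slice_eq using square_in_DX by (auto simp: square_def)
    show "\<forall>Y\<in>C_cone D H.
        {\<Theta> \<in> Sigma_map D ` marked_slice D H. D_component D H \<Theta> = Y} = (+) Y ` mu D H ` radial_fibre D H Y \<and>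
        compact (mu D H ` radial_fibre D H Y)"
      using fibre_image mu_radial_fibre_compact by blast
    show "closed (Sigma_map D ` marked_slice D H)"
      using Sigma_closed_image[of UNIV] by simp
  qed (use D_X_trivial Phi_image simplicial_C radial_fibre_eq symplectic_omega torus_generator moment_map
        toric_factorization Sigma_continuous Sigma_proper semialgebraic_image Sigma_fibre_compact in blast)+
qed

end
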